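(* Let $0<\alpha<2$ and let $\{X_t\}_{t\in\mathbb T^d}$ be a measurable stationary S$\alpha$S random field with decomposition $X\overset d=X^P+X^N$ as in the context. Then $\{X_t\}$ is weakly mixing (equivalently, ergodic) if and only if the component $X^P$ vanishes, i.e., if and only if $\{X_t\}$ is generated by a null $\mathbb T^d$-action.
   Context: $\mathbb T\in\{\mathbb Z,\mathbb R\}$. Every measurable stationary S$\alpha$S field has a minimal spectral representation $X_t=\int_Sf_t\,dM_\alpha$ (meaning $\mathbb E\exp(i\sum_j\theta_jX_{t_j})=\exp(-\int|\sum_j\theta_jf_{t_j}|^\alpha d\mu)$, on a standard Lebesgue space $(S,\mathcal B,\mu)$; minimal = full support and ratio $\sigma$-algebra $\sigma(f_t/f_\tau)=\mathcal B$ mod $\mu$) of the form $f_t=c_t(\frac{d\mu\circ\phi_t}{d\mu})^{1/\alpha}f_0\circ\phi_t$ with $\mathcal G=\{\phi_t\}$ a non-singular $\mathbb T^d$-action and $c_t\in\{\pm1\}$ a cocycle. $P_{\mathcal G}$ is the mod-$\mu$ largest support $\{d\nu/d\mu>0\}$ of a finite $\mathcal G$-invariant measure $\nu\ll\mu$, $N_{\mathcal G}=S\setminus P_{\mathcal G}$, $X^P_t=\int_{P_{\mathcal G}}f_t\,dM_\alpha$, $X^N_t=\int_{N_{\mathcal G}}f_t\,dM_\alpha$; "generated by a null action" means $\mu(P_{\mathcal G})=0$. Ergodicity and weak mixing: with $X_t=X_0\circ\theta_t$, $\theta$ measure-preserving, $\sigma_X=\sigma(X_t)$, $B(T)=(-T,T]^d\cap\mathbb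 T^d$, $C(T)=(2T)^d$: ergodic if $\frac1{C(T)}\int_{B(T)}\mathbb P(A\cap\theta_t(B))\lambda(dt)\to\mathbb P(A)\mathbb P(B)$ for all $A,B\in\sigma_X$; weakly mixing if for some density-one set $D$ (complement $E$ satisfies $\frac1{C(T)}\int_{B(T)}\mathbf 1_E d\lambda\to0$), $\mathbb P(A\cap\theta_{t_n}(B))\to\mathbb P(A)\mathbb P(B)$ for all $A,B\in\sigma_X$ and all sequences $t_n\in D$ with $\max_i|t_{n,i}|\to\infty$. *)

theory Defs
  imports "HOL-Probability.Probability"
begin

datatype tcase = IntCase | RealCase

definition lattice :: "(real ^ 'd) set" where
  "lattice = {t. \<forall>i. t $ i \<in> \<int>}"

definition index_set :: "tcase \<Rightarrow> (real ^ 'd) set" where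
  "index_set tc = (case tc of IntCase \<Rightarrow> lattice | RealCase \<Rightarrow> UNIV)"

definition index_measure :: "tcase \<Rightarrow> (real ^ 'd) measure" where
  "index_measure tc = (case tc of IntCase \<Rightarrow> count_space lattice | RealCase \<Rightarrow> lborel)"

definition box_B :: "tcase \<Rightarrow> real \<Rightarrow> (real ^ 'd) set" where
  "box_B tc T = {t \<in> index_set tc. \<forall>i. - T < t $ i \<and> t $ i \<le> T}"

definition vol_C :: "'d itself \<Rightarrow> real \<Rightarrow> real" where
  "vol_C _ T = (2 * T) ^ CARD('d)"

definition avg :: "tcase \<Rightarrow> real \<Rightarrow> ((real ^ 'd) \<Rightarrow> real) \<Rightarrow> real" where
  "avg tc T g = (1 / vol_C TYPE('d) T) * (\<integral>t. indicator (box_B tc T) t * g t \<partial>(index_measure tc :: (real^'d) measure))"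

definition path :: "tcase \<Rightarrow> (real ^ 'd \<Rightarrow> 'w \<Rightarrow> real) \<Rightarrow> 'w \<Rightarrow> (real ^ 'd \<Rightarrow> real)" where
  "path tc X \<omega> = restrict (\<lambda>s. X s \<omega>) (index_set tc)"

text \<open>sigma_X consists of the events {path in C}, C in the product sigma-algebra.\<close>
definition path_sets :: "tcase \<Rightarrow> (real ^ 'd \<Rightarrow> real) set set" where
  "path_sets tc = sets (PiM (index_set tc) (\<lambda>_. (borel :: real measure)))"

definition path_prob :: "'w measure \<Rightarrow> tcase \<Rightarrow> (real ^ 'd \<Rightarrow> 'w \<Rightarrow> real) \<Rightarrow> (real ^ 'd \<Rightarrow> real) set \<Rightarrow> real" where
  "path_prob P tc X C = measure P {\<omega> \<in> space P. path tc X \<omega> \<in> C}"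

text \<open>P(A \<inter> theta_t(B)) for A = {path in C}, B = {path in D}; theta_t(B) = {(X_(s-t))_s in D}.\<close>
definition joint_prob :: "'w measure \<Rightarrow> tcase \<Rightarrow> (real ^ 'd \<Rightarrow> 'w \<Rightarrow> real) \<Rightarrow> (real ^ 'd \<Rightarrow> real) set \<Rightarrow> (real ^ 'd \<Rightarrow> real) set \<Rightarrow> real ^ 'd \<Rightarrow> real" where
  "joint_prob P tc X C D t = measure P {\<omega> \<in> space P. path tc X \<omega> \<in> C \<and> path tc (\<lambda>s. X (s - t)) \<omega> \<in> D}"

definition ergodic_field :: "'w measure \<Rightarrow> tcase \<Rightarrow> (real ^ 'd \<Rightarrow> 'w \<Rightarrow> real) \<Rightarrow> bool" where
  "ergodic_field P tc X \<longleftrightarrow>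
     (\<forall>C \<in> path_sets tc. \<forall>D \<in> path_sets tc.
        ((\<lambda>T. avg tc T (joint_prob P tc X C D)) \<longlongrightarrow> path_prob P tc X C * path_prob P tc X D) at_top)"

definition weakly_mixing_field :: "'w measure \<Rightarrow> tcase \<Rightarrow> (real ^ 'd \<Rightarrow> 'w \<Rightarrow> real) \<Rightarrow> bool" where
  "weakly_mixing_field P tc X \<longleftrightarrow>
     (\<exists>Dn. Dn \<subseteq> index_set tc \<and> Dn \<in> sets (index_measure tc) \<and>
        ((\<lambda>T. avg tc T (indicator (index_set tc - Dn))) \<longlongrightarrow> 0) at_top \<and>
        (\<forall>C \<in> path_sets tc. \<forall>D \<in> path_sets tc. \<forall>tn :: nat \<Rightarrow> real ^ 'd.
           (\<forall>n. tn n \<in> Dn) \<and> filterlim (\<lambda>n. Max (range (\<lambda>i. \<bar>tn n $ i\<bar>))) at_top sequentially \<longrightarrow>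
           (\<lambda>n. joint_prob P tc X C D (tn n)) \<longlonglongrightarrow> path_prob P tc X C * path_prob P tc X D))"

definition measurable_field :: "'w measure \<Rightarrow> tcase \<Rightarrow> (real ^ 'd \<Rightarrow> 'w \<Rightarrow> real) \<Rightarrow> bool" where
  "measurable_field P tc X \<longleftrightarrow>
     (\<forall>t \<in> index_set tc. X t \<in> borel_measurable P) \<and>
     (tc = RealCase \<longrightarrow> (\<lambda>(t, \<omega>). X t \<omega>) \<in> borel_measurable (lborel \<Otimes>\<^sub>M P))"

definition stationary_field :: "'w measure \<Rightarrow> tcase \<Rightarrow> (real ^ 'd \<Rightarrow> 'w \<Rightarrow> real) \<Rightarrow> bool" where
  "stationary_field P tc X \<longleftrightarrow>
     (\<forall>J t. finite J \<and> J \<subseteq> index_set tc \<and> t \<in> index_set tc \<longrightarrow>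
        distr P (PiM J (\<lambda>_. borel)) (\<lambda>\<omega>. restrict (\<lambda>s. X (s + t) \<omega>) J)
      = distr P (PiM J (\<lambda>_. borel)) (\<lambda>\<omega>. restrict (\<lambda>s. X s \<omega>) J))"

text \<open>X_t = int_S f_t dM_alpha, in the sense of finite-dimensional characteristic functions.\<close>
definition sas_spectral_rep :: "real \<Rightarrow> 'w measure \<Rightarrow> tcase \<Rightarrow> (real ^ 'd \<Rightarrow> 'w \<Rightarrow> real)
    \<Rightarrow> 's measure \<Rightarrow> (real ^ 'd \<Rightarrow> 's \<Rightarrow> real) \<Rightarrow> bool" where
  "sas_spectral_rep \<alpha> P tc X \<mu> f \<longleftrightarrow>
     (\<forall>t \<in> index_set tc. f t \<in> borel_measurable \<mu> \<and> integrable \<mu> (\<lambda>x. \<bar>f t x\<bar> powr \<alpha>)) \<and>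
     (\<forall>J (\<theta> :: real ^ 'd \<Rightarrow> real). finite J \<and> J \<subseteq> index_set tc \<longrightarrow>
        (CLINT \<omega>|P. cis (\<Sum>t\<in>J. \<theta> t * X t \<omega>))
        = complex_of_real (exp (- (\<integral>x. \<bar>\<Sum>t\<in>J. \<theta> t * f t x\<bar> powr \<alpha> \<partial>\<mu>))))"

definition ratio :: "real \<Rightarrow> real \<Rightarrow> ereal" where
  "ratio a b = (if b \<noteq> 0 then ereal (a / b) else if a > 0 then \<infinity> else if a < 0 then - \<infinity> else 0)"

definition ratio_sigma :: "tcase \<Rightarrow> 's measure \<Rightarrow> (real ^ 'd \<Rightarrow> 's \<Rightarrow> real) \<Rightarrow> 's set set" where
  "ratio_sigma tc \<mu> f = sigma_sets (space \<mu>)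
     (\<Union>t \<in> index_set tc. \<Union>\<tau> \<in> index_set tc.
        {(\<lambda>x. ratio (f t x) (f \<tau> x)) -` B \<inter> space \<mu> | B. B \<in> sets (borel :: ereal measure)})"

definition minimal_rep :: "tcase \<Rightarrow> 's measure \<Rightarrow> (real ^ 'd \<Rightarrow> 's \<Rightarrow> real) \<Rightarrow> bool" where
  "minimal_rep tc \<mu> f \<longleftrightarrow>
     \<comment> \<open>full support: supp{f_t} = S mod mu\<close>
     (\<forall>A \<in> sets \<mu>. (\<forall>t \<in> index_set tc. AE x in \<mu>. x \<in> A \<longrightarrow> f t x = 0) \<longrightarrow> emeasure \<mu> A = 0) \<and>
     \<comment> \<open>ratio sigma-algebra equals the full sigma-algebra mod mu\<close>
     (\<forall>B \<in> sets \<mu>. \<exists>B' \<in> ratio_sigma tc \<mu> f. emeasure \<mu> ((B - B') \<union> (B' - B)) = 0)"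

definition nonsingular_action :: "tcase \<Rightarrow> 's measure \<Rightarrow> (real ^ 'd \<Rightarrow> 's \<Rightarrow> 's) \<Rightarrow> bool" where
  "nonsingular_action tc \<mu> \<phi> \<longleftrightarrow>
     (\<forall>t \<in> index_set tc. \<phi> t \<in> measurable \<mu> \<mu> \<and>
        (\<forall>A \<in> sets \<mu>. emeasure \<mu> (\<phi> t -` A \<inter> space \<mu>) = 0 \<longleftrightarrow> emeasure \<mu> A = 0)) \<and>
     (\<forall>x \<in> space \<mu>. \<phi> 0 x = x) \<and>
     (\<forall>s \<in> index_set tc. \<forall>t \<in> index_set tc. \<forall>x \<in> space \<mu>. \<phi> (s + t) x = \<phi> s (\<phi> t x)) \<and>
     (tc = RealCase \<longrightarrow> (\<lambda>(t, x). \<phi> t x) \<in> measurable (lborel \<Otimes>\<^sub>M \<mu>) \<mu>)"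

definition sign_cocycle :: "tcase \<Rightarrow> 's measure \<Rightarrow> (real ^ 'd \<Rightarrow> 's \<Rightarrow> 's) \<Rightarrow> (real ^ 'd \<Rightarrow> 's \<Rightarrow> real) \<Rightarrow> bool" where
  "sign_cocycle tc \<mu> \<phi> c \<longleftrightarrow>
     (\<forall>t \<in> index_set tc. c t \<in> borel_measurable \<mu> \<and> (\<forall>x \<in> space \<mu>. c t x \<in> {-1, 1})) \<and>
     (\<forall>s \<in> index_set tc. \<forall>t \<in> index_set tc. AE x in \<mu>. c (s + t) x = c s x * c t (\<phi> s x)) \<and>
     (tc = RealCase \<longrightarrow> (\<lambda>(t, x). c t x) \<in> borel_measurable (lborel \<Otimes>\<^sub>M \<mu>))"

text \<open>f_t = c_t (d(mu o phi_t)/d mu)^(1/alpha) f_0 o phi_t, where (mu o phi_t)(A) = mu(phi_t(A)) = mu(phi_(-t)^(-1) A).\<close>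
definition action_form :: "real \<Rightarrow> tcase \<Rightarrow> 's measure \<Rightarrow> (real ^ 'd \<Rightarrow> 's \<Rightarrow> 's) \<Rightarrow> (real ^ 'd \<Rightarrow> 's \<Rightarrow> real)
    \<Rightarrow> (real ^ 'd \<Rightarrow> 's \<Rightarrow> real) \<Rightarrow> bool" where
  "action_form \<alpha> tc \<mu> \<phi> c f \<longleftrightarrow>
     (\<forall>t \<in> index_set tc. AE x in \<mu>.
        f t x = c t x * enn2real (RN_deriv \<mu> (distr \<mu> \<mu> (\<phi> (- t))) x) powr (1 / \<alpha>) * f 0 (\<phi> t x))"

definition invariant_finite_ac :: "tcase \<Rightarrow> 's measure \<Rightarrow> (real ^ 'd \<Rightarrow> 's \<Rightarrow> 's) \<Rightarrow> 's measure \<Rightarrow> bool" where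
  "invariant_finite_ac tc \<mu> \<phi> \<nu> \<longleftrightarrow>
     sets \<nu> = sets \<mu> \<and> finite_measure \<nu> \<and> absolutely_continuous \<mu> \<nu> \<and>
     (\<forall>t \<in> index_set tc. \<forall>A \<in> sets \<mu>. emeasure \<nu> (\<phi> t -` A \<inter> space \<mu>) = emeasure \<nu> A)"

definition density_support :: "'s measure \<Rightarrow> 's measure \<Rightarrow> 's set" where
  "density_support \<mu> \<nu> = {x \<in> space \<mu>. RN_deriv \<mu> \<nu> x > 0}"

definition positive_part :: "tcase \<Rightarrow> 's measure \<Rightarrow> (real ^ 'd \<Rightarrow> 's \<Rightarrow> 's) \<Rightarrow> 's set \<Rightarrow> bool" where
  "positive_part tc \<mu> \<phi> Pset \<longleftrightarrow>
     Pset \<in> sets \<mu> \<and>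
     (\<exists>\<nu>. invariant_finite_ac tc \<mu> \<phi> \<nu> \<and>
        emeasure \<mu> ((Pset - density_support \<mu> \<nu>) \<union> (density_support \<mu> \<nu> - Pset)) = 0) \<and>
     (\<forall>\<nu>. invariant_finite_ac tc \<mu> \<phi> \<nu> \<longrightarrow> emeasure \<mu> (density_support \<mu> \<nu> - Pset) = 0)"

end

theory Submission
  imports Defs "HOL-Real_Asymp.Real_Asymp"
begin

text \<open>
  Put \<open>v t = |f t| powr (\<alpha>/2)\<close>, a vector of L2, and let \<open>kernel t\<close> be the inner product of \<open>v 0\<close> and
  \<open>v t\<close>. The action form says that t acts on the v t by the unitary Koopman representation
  \<open>h \<mapsto> sqrt (d(\<mu> o \<phi>_t)/d\<mu>) * h o \<phi>_t\<close>, whose invariant vectors are square roots of densities of finite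
  invariant measures. So if the action is null, von Neumann's mean ergodic theorem makes the box
  averages of the nonnegative function \<open>kernel\<close> vanish, hence \<open>kernel\<close> tends to 0 along a set of density one.
  Since \<open>||a + b|^\<alpha> - |a|^\<alpha> - |b|^\<alpha>| \<le> 4 |a|^(\<alpha>/2) |b|^(\<alpha>/2)\<close>, the joint characteristic functions then
  factorise along this set, which is weak mixing.

  Conversely, ergodicity applied to cos and sin of multiples of X 0 shows that for most t the norms of
  \<open>f 0 + f t\<close> and \<open>f 0 - f t\<close> are close to \<open>2 |f 0|^\<alpha>\<close>, which (as \<open>\<alpha> < 2\<close>) forces the integral of
  \<open>min (|f 0|^\<alpha>) (|f t|^\<alpha>)\<close> to be small. Given a finite invariant measure \<open>\<nu>\<close>, a set on which \<open>|f 0|^\<alpha>\<close>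
  dominates a multiple of the density of \<open>\<nu>\<close> then has arbitrarily many almost disjoint translates of
  equal measure, so it is null; hence every f t vanishes on the support of \<open>\<nu>\<close>, and by full
  support \<open>\<nu> = 0\<close>.
\<close>

section \<open>Averages over boxes\<close>

text \<open>The half power removes the sign cocycle from \<open>v t\<close> and keeps the inner
  products nonnegative. Two obstacles shape the first half. Factorising the characteristic functions
  for all finite sets of times needs \<open>kernel (t + r)\<close> small for every r along one and
  the same set of times. Over the reals this is brought down to countably many r by uniform
  continuity of \<open>kernel\<close>, which has to be extracted from measurability of the field,
  since joint measurability is assumed of X and not of f. Moreover the joint law of the path and its
  shift is compared on arbitrary path events; convergence of characteristic functions suffices for
  this because every shifted path has the same law. In the second half, ergodicity controls only
  averages. They are upgraded to smallness at most times by a variance computation: the frequencies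
  1 and \<open>2 powr (1 / \<alpha>)\<close> give the limits of the averages of a function and of
  its square.\<close>

definition sup_norm :: "real ^ 'd \<Rightarrow> real" where
  "sup_norm t = Max (range (\<lambda>i. \<bar>t $ i\<bar>))"

lemma sup_norm_le_iff: "sup_norm (t :: real ^ 'd) \<le> r \<longleftrightarrow> (\<forall>i. \<bar>t $ i\<bar> \<le> r)"
  unfolding sup_norm_def by (subst Max_le_iff) auto

lemma component_le_sup_norm: "\<bar>t $ i\<bar> \<le> sup_norm (t :: real ^ 'd)"
  unfolding sup_norm_def by (rule Max_ge) auto

lemma sup_norm_nonneg: "0 \<le> sup_norm (t :: real ^ 'd)"
  using component_le_sup_norm[of t undefined] by linarith

lemma sup_norm_minus: "sup_norm (- t :: real ^ 'd) = sup_norm t"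
  by (simp add: sup_norm_def)

lemma sup_norm_measurable [measurable]: "sup_norm \<in> borel_measurable (borel :: (real ^ 'd) measure)"
proof (rule borel_measurable_iff_le[THEN iffD2], rule allI)
  fix a
  have "{t \<in> space borel. sup_norm (t :: real ^ 'd) \<le> a} = {t. \<forall>i. \<bar>t $ i\<bar> \<le> a}"
    by (auto simp: sup_norm_le_iff)
  also have "\<dots> = (\<Inter>i. {t. \<bar>t $ i\<bar> \<le> a})" by auto
  also have "closed \<dots>" by (intro closed_INT ballI closed_Collect_le continuous_intros)
  then have "\<dots> \<in> sets borel" by (rule borel_closed)
  finally show "{t \<in> space borel. sup_norm (t :: real ^ 'd) \<le> a} \<in> sets borel" .
qed

section \<open>The index group, its invariant measure and its boxes\<close>

lemma index_set_zero [simp]: "0 \<in> index_set tc"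
  by (auto simp: index_set_def lattice_def split: tcase.split)

lemma index_set_add: "s \<in> index_set tc \<Longrightarrow> t \<in> index_set tc \<Longrightarrow> s + t \<in> index_set tc"
  by (auto simp: index_set_def lattice_def split: tcase.splits)

lemma index_set_diff: "s \<in> index_set tc \<Longrightarrow> t \<in> index_set tc \<Longrightarrow> s - t \<in> index_set tc"
  by (auto simp: index_set_def lattice_def split: tcase.splits)

lemma index_set_minus: "t \<in> index_set tc \<Longrightarrow> - t \<in> index_set tc"
  by (auto simp: index_set_def lattice_def split: tcase.splits)

lemma space_index_measure [simp]: "space (index_measure tc) = index_set tc"
  by (auto simp: index_set_def index_measure_def split: tcase.splits)

lemma borel_sets_index_measure:
  "A \<in> sets borel \<Longrightarrow> A \<inter> index_set tc \<in> sets (index_measure tc)"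
  by (auto simp: index_set_def index_measure_def split: tcase.splits)

lemma borel_measurable_index_measure:
  "g \<in> borel_measurable borel \<Longrightarrow> g \<in> borel_measurable (index_measure tc)"
  by (auto simp: index_measure_def split: tcase.splits)

lemma shift_measurable [measurable]:
  "s \<in> index_set tc \<Longrightarrow> (\<lambda>t. t + s) \<in> measurable (index_measure tc) (index_measure tc)"
  by (cases tc) (auto simp: index_measure_def index_set_def lattice_def)

lemma distr_shift_index_measure:
  assumes s: "s \<in> index_set tc"
  shows "distr (index_measure tc) (index_measure tc) (\<lambda>t. t + s) = (index_measure tc :: (real ^ 'd) measure)"
proof (cases tc)
  case IntCase
  have "bij_betw (\<lambda>t. t + s) (lattice :: (real ^ 'd) set) lattice"
    using s IntCase
    by (intro bij_betwI[where g = "\<lambda>t. t - s"]) (auto simp: index_set_def lattice_def)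
  then show ?thesis using IntCase by (simp add: index_measure_def distr_bij_count_space)
next
  case RealCase
  have "distr lborel lborel (\<lambda>t. t + s) = distr lborel borel ((+) s)"
    by (intro distr_cong) (auto simp: add.commute)
  then show ?thesis using RealCase by (simp add: index_measure_def lborel_distr_plus)
qed

lemma integral_shift_index_measure:
  fixes g :: "real ^ 'd \<Rightarrow> real"
  assumes s: "s \<in> index_set tc" and g: "g \<in> borel_measurable (index_measure tc)"
  shows "(\<integral>t. g (t + s) \<partial>index_measure tc) = (\<integral>t. g t \<partial>index_measure tc)"
  using integral_distr[OF shift_measurable[OF s] g] distr_shift_index_measure[OF s] by simp

lemma box_B_sets [measurable]: "box_B tc T \<in> sets (index_measure tc :: (real ^ 'd) measure)"
proof -
  have "{t :: real ^ 'd. \<forall>i. - T < t $ i \<and> t $ i \<le> T} = (\<Inter>i. {t. - T < t $ i} \<inter> {t. t $ i \<le> T})"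
    by auto
  also have "\<dots> \<in> sets borel"
    by (intro sets.countable_INT' sets.Int borel_open borel_closed open_Collect_less closed_Collect_le
        continuous_intros) auto
  finally have "{t :: real ^ 'd. \<forall>i. - T < t $ i \<and> t $ i \<le> T} \<inter> index_set tc \<in> sets (index_measure tc)"
    by (rule borel_sets_index_measure)
  then show ?thesis by (simp add: box_B_def Int_def conj_commute)
qed

lemma box_B_sup_norm: "t \<in> box_B tc T \<Longrightarrow> sup_norm t \<le> T"
  by (auto simp: box_B_def sup_norm_le_iff abs_le_iff) (smt (verit))

lemma box_B_index: "t \<in> box_B tc T \<Longrightarrow> t \<in> index_set tc"
  by (simp add: box_B_def)

lemma box_B_shift:
  assumes "t \<in> box_B tc T" "s \<in> index_set tc" "sup_norm s \<le> r"
  shows "t + s \<in> box_B tc (T + r)"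
  using assms component_le_sup_norm[of s] unfolding box_B_def sup_norm_le_iff
  by (auto simp: index_set_add) (smt (verit) assms(3))+

lemma card_int_box:
  assumes "T > 0"
  shows "finite (box_B IntCase T :: (real ^ 'd) set)"
    and "card (box_B IntCase T :: (real ^ 'd) set) = nat (\<lfloor>T\<rfloor> - \<lfloor>-T\<rfloor>) ^ CARD('d)"
proof -
  \<comment> \<open>The boxes are open on the left, so the least admissible integer is one above the
    floor of -T.\<close>
  let ?S = "{\<lfloor>-T\<rfloor>+1..\<lfloor>T\<rfloor>}"
  let ?g = "\<lambda>k :: 'd \<Rightarrow> int. (\<chi> i. real_of_int (k i)) :: real ^ 'd"
  have S: "k \<in> ?S \<longleftrightarrow> - T < real_of_int k \<and> real_of_int k \<le> T" for k
    by (auto simp: le_floor_iff floor_less_iff add1_zle_eq)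
  have im: "?g ` (PiE UNIV (\<lambda>_. ?S)) = box_B IntCase T"
  proof (intro set_eqI iffI)
    fix t assume "t \<in> ?g ` (PiE UNIV (\<lambda>_. ?S))"
    then show "t \<in> box_B IntCase T"
      using S by (auto simp: box_B_def index_set_def lattice_def PiE_iff)
  next
    fix t :: "real ^ 'd" assume t: "t \<in> box_B IntCase T"
    then have "\<And>i. t $ i \<in> \<int>" by (auto simp: box_B_def index_set_def lattice_def)
    then have "\<forall>i. \<exists>k. t $ i = real_of_int k" by (meson Ints_cases)
    then obtain k where k: "\<And>i. t $ i = real_of_int (k i)" by metis
    then have "t = ?g k" by (simp add: vec_eq_iff)
    moreover have "k \<in> PiE UNIV (\<lambda>_. ?S)" using t k S by (auto simp: box_B_def)
    ultimately show "t \<in> ?g ` (PiE UNIV (\<lambda>_. ?S))" by blast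
  qed
  have inj: "inj_on ?g (PiE UNIV (\<lambda>_. ?S))"
    by (auto simp: inj_on_def vec_eq_iff)
  have fin: "finite (PiE (UNIV :: 'd set) (\<lambda>_. ?S))" by (rule finite_PiE) auto
  show "finite (box_B IntCase T :: (real ^ 'd) set)" using fin im[symmetric] by simp
  have "card (box_B IntCase T :: (real ^ 'd) set) = card (PiE (UNIV :: 'd set) (\<lambda>_. ?S))"
    using card_image[OF inj] im by simp
  also have "\<dots> = nat (\<lfloor>T\<rfloor> - \<lfloor>-T\<rfloor>) ^ CARD('d)" by (simp add: card_PiE)
  finally show "card (box_B IntCase T :: (real ^ 'd) set) = nat (\<lfloor>T\<rfloor> - \<lfloor>-T\<rfloor>) ^ CARD('d)" .
qed

text \<open>The half-open box lies between an open and a closed box of equal volume, which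
  determines its volume.\<close>

lemma real_box_bounds:
  "box (\<chi> i. - T) (\<chi> i. T) \<subseteq> box_B RealCase T" "box_B RealCase T \<subseteq> cbox (\<chi> i. - T) (\<chi> i. T)"
  by (auto simp: box_B_def index_set_def mem_box_cart less_imp_le)

lemma measure_real_box:
  assumes "T > 0"
  shows "emeasure lborel (box_B RealCase T :: (real ^ 'd) set) = ennreal ((2 * T) ^ CARD('d))"
proof -
  have ne: "\<And>b. b \<in> Basis \<Longrightarrow> (\<chi> i. - T) \<bullet> b \<le> (\<chi> i. T :: real ^ 'd) \<bullet> b"
    using assms by (auto simp: Basis_vec_def inner_axis)
  have pr: "(\<Prod>b\<in>Basis. ((\<chi> i. T) - (\<chi> i. - T) :: real ^ 'd) \<bullet> b) = (2 * T) ^ CARD('d)"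
  proof -
    have "(\<Prod>b\<in>Basis. ((\<chi> i. T) - (\<chi> i. - T) :: real ^ 'd) \<bullet> b) = (\<Prod>b\<in>(Basis :: (real ^ 'd) set). 2 * T)"
      by (rule prod.cong) (auto simp: Basis_vec_def inner_axis)
    then show ?thesis by simp
  qed
  have m: "box_B RealCase T \<in> sets (lborel :: (real ^ 'd) measure)"
    using box_B_sets[of RealCase T] by (simp add: index_measure_def)
  have "emeasure lborel (box_B RealCase T :: (real ^ 'd) set) \<le> emeasure lborel (cbox (\<chi> i. - T) (\<chi> i. T) :: (real ^ 'd) set)"
    by (rule emeasure_mono[OF real_box_bounds(2)]) simp
  moreover have "emeasure lborel (box (\<chi> i. - T) (\<chi> i. T) :: (real ^ 'd) set) \<le> emeasure lborel (box_B RealCase T :: (real ^ 'd) set)"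
    by (rule emeasure_mono[OF real_box_bounds(1) m])
  ultimately show ?thesis
    using emeasure_lborel_box[OF ne] emeasure_lborel_cbox[OF ne] pr by (simp add: antisym)
qed

lemma box_B_finite: 
  assumes "T > 0"
  shows "emeasure (index_measure tc) (box_B tc T :: (real ^ 'd) set) < \<infinity>"
proof (cases tc)
  case IntCase
  then show ?thesis using card_int_box(1)[OF assms, where 'd = 'd] 
    by (simp add: index_measure_def emeasure_count_space_finite box_B_def index_set_def ennreal_of_nat_eq_real_of_nat)
next
  case RealCase
  then show ?thesis using measure_real_box[OF assms, where 'd = 'd] by (simp add: index_measure_def)
qed

text \<open>For real indices the ratio is eventually constant. On the lattice a side contains
  between 2T - 1 and 2T + 1 points, so the normaliser is correct only asymptotically, and averages
  of constants converge instead of being exact.\<close>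

lemma box_B_ratio:
  "((\<lambda>T. measure (index_measure tc) (box_B tc T :: (real ^ 'd) set) / vol_C TYPE('d) T) \<longlongrightarrow> 1) at_top"
proof (cases tc)
  case RealCase
  have "eventually (\<lambda>T. measure (index_measure tc) (box_B tc T :: (real ^ 'd) set) / vol_C TYPE('d) T = 1) at_top"
    using eventually_gt_at_top[of 0]
  proof eventually_elim
    case (elim T)
    then show ?case using measure_real_box[OF elim, where 'd = 'd]
      by (simp add: RealCase index_measure_def measure_def vol_C_def)
  qed
  then show ?thesis by (simp add: tendsto_eventually)
next
  case IntCase
  have lim: "((\<lambda>T :: real. (of_int (\<lfloor>T\<rfloor> - \<lfloor>-T\<rfloor>) / (2 * T)) ^ CARD('d)) \<longlongrightarrow> 1 ^ CARD('d)) at_top"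
  proof (rule tendsto_power, rule tendsto_sandwich)
    show "eventually (\<lambda>T :: real. (2 * T - 1) / (2 * T) \<le> of_int (\<lfloor>T\<rfloor> - \<lfloor>-T\<rfloor>) / (2 * T)) at_top"
      using eventually_gt_at_top[of 0]
      by eventually_elim (intro divide_right_mono; simp?; linarith)
    show "eventually (\<lambda>T :: real. of_int (\<lfloor>T\<rfloor> - \<lfloor>-T\<rfloor>) / (2 * T) \<le> (2 * T + 1) / (2 * T)) at_top"
      using eventually_gt_at_top[of 0]
      by eventually_elim (intro divide_right_mono; simp?; linarith)
    show "((\<lambda>T :: real. (2 * T - 1) / (2 * T)) \<longlongrightarrow> 1) at_top" by real_asymp
    show "((\<lambda>T :: real. (2 * T + 1) / (2 * T)) \<longlongrightarrow> 1) at_top" by real_asymp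
  qed
  have "eventually (\<lambda>T. measure (index_measure tc) (box_B tc T :: (real ^ 'd) set) / vol_C TYPE('d) T
     = (of_int (\<lfloor>T\<rfloor> - \<lfloor>-T\<rfloor>) / (2 * T)) ^ CARD('d)) at_top"
    using eventually_gt_at_top[of 0]
  proof eventually_elim
    case (elim T)
    have sub: "box_B IntCase T \<subseteq> (lattice :: (real ^ 'd) set)" by (auto simp: box_B_def index_set_def)
    have "measure (index_measure tc) (box_B tc T :: (real ^ 'd) set) = real (nat (\<lfloor>T\<rfloor> - \<lfloor>-T\<rfloor>)) ^ CARD('d)"
      using card_int_box[OF elim, where 'd = 'd] sub
      by (simp add: IntCase index_measure_def measure_count_space)
    moreover have "\<lfloor>T\<rfloor> - \<lfloor>-T\<rfloor> \<ge> 0" using elim by linarith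
    ultimately show ?case by (simp add: vol_C_def power_divide)
  qed
  with lim show ?thesis by (simp add: tendsto_cong)
qed

section \<open>Calculus of box averages for bounded measurable functions\<close>

definition bounded_measurable :: "tcase \<Rightarrow> (real ^ 'd \<Rightarrow> real) \<Rightarrow> bool" where
  "bounded_measurable tc g \<longleftrightarrow>
     g \<in> borel_measurable (index_measure tc) \<and> (\<exists>B. \<forall>t\<in>index_set tc. \<bar>g t\<bar> \<le> B)"

lemma bounded_measurableI:
  "g \<in> borel_measurable (index_measure tc) \<Longrightarrow> (\<And>t. t \<in> index_set tc \<Longrightarrow> \<bar>g t\<bar> \<le> B) \<Longrightarrow> bounded_measurable tc g"
  by (auto simp: bounded_measurable_def)

lemma bounded_measurableD:
  "bounded_measurable tc g \<Longrightarrow> g \<in> borel_measurable (index_measure tc)"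
  by (auto simp: bounded_measurable_def)

lemma bounded_measurable_const: "bounded_measurable tc (\<lambda>t. c)"
  by (rule bounded_measurableI[of _ _ "\<bar>c\<bar>"]) auto

lemma bounded_measurable_indicator:
  "A \<in> sets (index_measure tc) \<Longrightarrow> bounded_measurable tc (indicator A)"
  by (rule bounded_measurableI[of _ _ 1]) (auto simp: indicator_def)

lemma bounded_measurable_add:
  assumes "bounded_measurable tc g" "bounded_measurable tc h"
  shows "bounded_measurable tc (\<lambda>t. g t + h t)"
proof -
  obtain B C where "\<forall>t\<in>index_set tc. \<bar>g t\<bar> \<le> B" "\<forall>t\<in>index_set tc. \<bar>h t\<bar> \<le> C"
    using assms unfolding bounded_measurable_def by blast
  then show ?thesis using assms[THEN bounded_measurableD]
    by (intro bounded_measurableI[of _ _ "B + C"]) (auto intro: order_trans[OF abs_triangle_ineq add_mono])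
qed

lemma bounded_measurable_mult:
  assumes "bounded_measurable tc g" "bounded_measurable tc h"
  shows "bounded_measurable tc (\<lambda>t. g t * h t)"
proof -
  obtain B C where "\<forall>t\<in>index_set tc. \<bar>g t\<bar> \<le> B" "\<forall>t\<in>index_set tc. \<bar>h t\<bar> \<le> C"
    using assms unfolding bounded_measurable_def by blast
  then show ?thesis using assms[THEN bounded_measurableD]
    by (intro bounded_measurableI[of _ _ "B * C"])
      (auto simp: abs_mult intro!: mult_mono intro: order_trans[OF abs_ge_zero])
qed

lemma bounded_measurable_diff:
  assumes "bounded_measurable tc g" "bounded_measurable tc h"
  shows "bounded_measurable tc (\<lambda>t. g t - h t)"
  using bounded_measurable_add[OF assms(1) bounded_measurable_mult[OF bounded_measurable_const[of _ "-1"] assms(2)]]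
  by simp

lemma bounded_measurable_abs:
  assumes "bounded_measurable tc g"
  shows "bounded_measurable tc (\<lambda>t. \<bar>g t\<bar>)"
  using assms unfolding bounded_measurable_def by auto

lemma bounded_measurable_sum:
  "(\<And>i. i \<in> A \<Longrightarrow> bounded_measurable tc (g i)) \<Longrightarrow> bounded_measurable tc (\<lambda>t. \<Sum>i\<in>A. g i t)"
  by (induction A rule: infinite_finite_induct) (auto intro: bounded_measurable_const bounded_measurable_add)

lemma bounded_measurable_shift:
  assumes "bounded_measurable tc g" "s \<in> index_set tc"
  shows "bounded_measurable tc (\<lambda>t. g (t + s))"
  using assms measurable_compose[OF shift_measurable[OF assms(2)] bounded_measurableD[OF assms(1)]]
  unfolding bounded_measurable_def by (auto intro: index_set_add)

lemma integrable_box: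
  fixes g :: "real ^ 'd \<Rightarrow> real"
  assumes "bounded_measurable tc g" "T > 0"
  shows "integrable (index_measure tc) (\<lambda>t. indicator (box_B tc T) t * g t)"
proof -
  obtain B where B: "\<And>t. t \<in> index_set tc \<Longrightarrow> \<bar>g t\<bar> \<le> B" and [measurable]: "g \<in> borel_measurable (index_measure tc)"
    using assms unfolding bounded_measurable_def by blast
  show ?thesis
  proof (rule Bochner_Integration.integrable_bound)
    show "integrable (index_measure tc) (\<lambda>t :: real ^ 'd. indicator (box_B tc T) t * B)"
      using box_B_finite[OF assms(2), of tc, where 'd = 'd] by (intro integrable_mult_left integrable_real_indicator) auto
    show "AE t in index_measure tc. norm (indicator (box_B tc T) t * g t) \<le> norm (indicator (box_B tc T) t * B)"
      using B by (intro AE_I2) (fastforce simp: indicator_def)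
  qed measurable
qed

lemma avg_mono:
  fixes g h :: "real ^ 'd \<Rightarrow> real"
  assumes "bounded_measurable tc g" "bounded_measurable tc h" "T > 0" "\<And>t. t \<in> box_B tc T \<Longrightarrow> g t \<le> h t"
  shows "avg tc T g \<le> avg tc T h"
  unfolding avg_def
proof (rule mult_left_mono, rule integral_mono)
  show "indicator (box_B tc T) t * g t \<le> indicator (box_B tc T) t * h t" for t
    using assms(4) by (auto simp: indicator_def)
qed (use assms(3) in \<open>auto simp: vol_C_def intro!: integrable_box assms\<close>)

lemma avg_add:
  fixes g h :: "real ^ 'd \<Rightarrow> real"
  assumes "bounded_measurable tc g" "bounded_measurable tc h" "T > 0"
  shows "avg tc T (\<lambda>t. g t + h t) = avg tc T g + avg tc T h"
  using Bochner_Integration.integral_add[OF integrable_box[OF assms(1,3)] integrable_box[OF assms(2,3)]]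
  by (simp add: avg_def distrib_left add_divide_distrib)

lemma avg_cmult: "avg tc T (\<lambda>t. c * g t) = c * avg tc T g"
  unfolding avg_def by (simp add: mult.left_commute[of _ c])

lemma avg_diff:
  fixes g h :: "real ^ 'd \<Rightarrow> real"
  assumes "bounded_measurable tc g" "bounded_measurable tc h" "T > 0"
  shows "avg tc T (\<lambda>t. g t - h t) = avg tc T g - avg tc T h"
  using avg_add[OF assms(1) bounded_measurable_mult[OF bounded_measurable_const[of _ "-1"] assms(2)] assms(3)]
    avg_cmult[of tc T "-1" h]
  by simp

lemma avg_const: "avg tc T (\<lambda>t :: real ^ 'd. c) = c * (measure (index_measure tc) (box_B tc T :: (real ^ 'd) set) / vol_C TYPE('d) T)"
proof -
  have "box_B tc T \<inter> index_set tc = (box_B tc T :: (real ^ 'd) set)" by (auto simp: box_B_def)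
  then show ?thesis by (simp add: avg_def)
qed

lemma avg_const_tendsto: "((\<lambda>T. avg tc T (\<lambda>t :: real ^ 'd. c)) \<longlongrightarrow> c) at_top"
  using tendsto_mult[OF tendsto_const[of c] box_B_ratio[of tc, where 'd = 'd]] by (simp add: avg_const)

lemma avg_nonneg:
  fixes g :: "real ^ 'd \<Rightarrow> real"
  assumes "\<And>t. t \<in> index_set tc \<Longrightarrow> 0 \<le> g t" "T > 0"
  shows "0 \<le> avg tc T g"
  unfolding avg_def
  by (intro mult_nonneg_nonneg integral_nonneg_AE AE_I2) (use assms in \<open>auto simp: vol_C_def indicator_def\<close>)

lemma avg_abs_le:
  fixes g :: "real ^ 'd \<Rightarrow> real"
  assumes "bounded_measurable tc g" "T > 0"
  shows "\<bar>avg tc T g\<bar> \<le> avg tc T (\<lambda>t. \<bar>g t\<bar>)"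
proof -
  have "avg tc T g \<le> avg tc T (\<lambda>t. \<bar>g t\<bar>)"
    by (intro avg_mono assms bounded_measurable_abs) auto
  moreover have "avg tc T (\<lambda>t. (-1) * g t) \<le> avg tc T (\<lambda>t. \<bar>g t\<bar>)"
    by (intro avg_mono assms bounded_measurable_abs bounded_measurable_mult bounded_measurable_const) auto
  ultimately show ?thesis using avg_cmult[of tc T "-1" g] by linarith
qed

lemma bounded_measurable_cong:
  assumes "bounded_measurable tc h" and eq: "\<And>t. t \<in> index_set tc \<Longrightarrow> g t = h t"
  shows "bounded_measurable tc g"
proof -
  obtain B where B: "\<And>t. t \<in> index_set tc \<Longrightarrow> \<bar>h t\<bar> \<le> B" and h: "h \<in> borel_measurable (index_measure tc)"
    using assms(1) unfolding bounded_measurable_def by blast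
  show ?thesis
  proof (rule bounded_measurableI)
    show "g \<in> borel_measurable (index_measure tc)"
      using h by (subst measurable_cong[where g = h]) (simp_all add: eq)
    show "\<bar>g t\<bar> \<le> B" if "t \<in> index_set tc" for t using B[OF that] eq[OF that] by simp
  qed
qed

lemma avg_cong:
  assumes "\<And>t. t \<in> index_set tc \<Longrightarrow> g t = h t"
  shows "avg tc T g = avg tc T h"
  unfolding avg_def using assms
  by (intro arg_cong[where f = "\<lambda>z. _ * z"] Bochner_Integration.integral_cong) simp_all

lemma vol_C_ratio_tendsto:
  "((\<lambda>T. vol_C TYPE('d::finite) (T + r) / vol_C TYPE('d) T) \<longlongrightarrow> 1) at_top"
proof -
  have "((\<lambda>T. ((T + r) / T) ^ CARD('d)) \<longlongrightarrow> 1 ^ CARD('d)) at_top"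
    by (rule tendsto_power) real_asymp
  moreover have "((T + r) / T) ^ CARD('d) = vol_C TYPE('d) (T + r) / vol_C TYPE('d) T" for T
    unfolding vol_C_def power_mult_distrib by (simp add: power_divide)
  ultimately show ?thesis by simp
qed

lemma avg_shift_le:
  fixes g :: "real ^ 'd \<Rightarrow> real"
  assumes "bounded_measurable tc g" "\<And>t. t \<in> index_set tc \<Longrightarrow> 0 \<le> g t"
    and "s \<in> index_set tc" "sup_norm s \<le> r" "T > 0"
  shows "avg tc T (\<lambda>t. g (t + s)) \<le> vol_C TYPE('d) (T + r) / vol_C TYPE('d) T * avg tc (T + r) g"
proof -
  have r: "r \<ge> 0" using sup_norm_nonneg[of s] assms by linarith
  have "(\<integral>t. indicator (box_B tc T) t * g (t + s) \<partial>index_measure tc)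
     \<le> (\<integral>t. indicator (box_B tc (T + r)) (t + s) * g (t + s) \<partial>index_measure tc)"
  proof (rule integral_mono)
    show "integrable (index_measure tc) (\<lambda>t. indicator (box_B tc T) t * g (t + s))"
      by (intro integrable_box bounded_measurable_shift assms)
    have "integrable (distr (index_measure tc) (index_measure tc) (\<lambda>t. t + s)) (\<lambda>t. indicator (box_B tc (T + r)) t * g t)"
      unfolding distr_shift_index_measure[OF assms(3)] by (intro integrable_box assms) (use assms r in auto)
    then show "integrable (index_measure tc) (\<lambda>t. indicator (box_B tc (T + r)) (t + s) * g (t + s))"
      by (rule integrable_distr[OF shift_measurable[OF assms(3)]])
    show "indicator (box_B tc T) t * g (t + s) \<le> indicator (box_B tc (T + r)) (t + s) * g (t + s)"
      if "t \<in> space (index_measure tc)" for t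
      using that box_B_shift[of t tc T s r] assms by (auto simp: indicator_def index_set_add)
  qed
  also have "\<dots> = (\<integral>t. indicator (box_B tc (T + r)) t * g t \<partial>index_measure tc)"
    using bounded_measurableD[OF assms(1)]
    by (intro integral_shift_index_measure[OF assms(3)] borel_measurable_times borel_measurable_indicator box_B_sets)
  finally have "(1 / vol_C TYPE('d) T) * (\<integral>t. indicator (box_B tc T) t * g (t + s) \<partial>index_measure tc)
     \<le> (1 / vol_C TYPE('d) T) * (\<integral>t. indicator (box_B tc (T + r)) t * g t \<partial>index_measure tc)"
    by (rule mult_left_mono) (use assms in \<open>auto simp: vol_C_def\<close>)
  moreover have "vol_C TYPE('d) (T + r) \<noteq> 0" using assms r by (simp add: vol_C_def)
  ultimately show ?thesis by (simp add: avg_def)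
qed

text \<open>The enlargement of the box costs only a volume ratio that tends to 1.\<close>

lemma avg_zero_shift:
  fixes g :: "real ^ 'd \<Rightarrow> real"
  assumes "bounded_measurable tc g" "\<And>t. t \<in> index_set tc \<Longrightarrow> 0 \<le> g t" "s \<in> index_set tc"
    and "((\<lambda>T. avg tc T g) \<longlongrightarrow> 0) at_top"
  shows "((\<lambda>T. avg tc T (\<lambda>t. g (t + s))) \<longlongrightarrow> 0) at_top"
proof (rule tendsto_sandwich[OF _ _ tendsto_const])
  show "eventually (\<lambda>T. 0 \<le> avg tc T (\<lambda>t. g (t + s))) at_top"
    using eventually_gt_at_top[of 0] by eventually_elim (intro avg_nonneg assms index_set_add)
  show "eventually (\<lambda>T. avg tc T (\<lambda>t. g (t + s))
     \<le> vol_C TYPE('d) (T + sup_norm s) / vol_C TYPE('d) T * avg tc (T + sup_norm s) g) at_top"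
    using eventually_gt_at_top[of 0] by eventually_elim (intro avg_shift_le assms order_refl)
  have "((\<lambda>T. avg tc (T + sup_norm s) g) \<longlongrightarrow> 0) at_top"
    by (rule filterlim_compose[OF assms(4)]) real_asymp
  from tendsto_mult[OF vol_C_ratio_tendsto this]
  show "((\<lambda>T. vol_C TYPE('d) (T + sup_norm s) / vol_C TYPE('d) T * avg tc (T + sup_norm s) g) \<longlongrightarrow> 0) at_top"
    by simp
qed

lemma avg_zero_add:
  fixes g h :: "real ^ 'd \<Rightarrow> real"
  assumes "bounded_measurable tc g" "bounded_measurable tc h"
    and "((\<lambda>T. avg tc T g) \<longlongrightarrow> 0) at_top" "((\<lambda>T. avg tc T h) \<longlongrightarrow> 0) at_top"
  shows "((\<lambda>T. avg tc T (\<lambda>t. g t + h t)) \<longlongrightarrow> 0) at_top"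
proof -
  have "((\<lambda>T. avg tc T g + avg tc T h) \<longlongrightarrow> 0 + 0) at_top" by (intro tendsto_add assms)
  moreover have "eventually (\<lambda>T. avg tc T g + avg tc T h = avg tc T (\<lambda>t. g t + h t)) at_top"
    using eventually_gt_at_top[of 0] by eventually_elim (simp add: avg_add assms)
  ultimately show ?thesis by (simp add: tendsto_cong)
qed

lemma avg_zero_sum:
  fixes g :: "'i \<Rightarrow> real ^ 'd \<Rightarrow> real"
  assumes "finite A" "\<And>i. i \<in> A \<Longrightarrow> bounded_measurable tc (g i)"
    and "\<And>i. i \<in> A \<Longrightarrow> ((\<lambda>T. avg tc T (g i)) \<longlongrightarrow> 0) at_top"
  shows "((\<lambda>T. avg tc T (\<lambda>t. \<Sum>i\<in>A. g i t)) \<longlongrightarrow> 0) at_top"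
  using assms
proof (induction A rule: finite_induct)
  case empty
  show ?case by (simp add: avg_const_tendsto)
next
  case (insert a A)
  then show ?case by (auto intro!: avg_zero_add bounded_measurable_sum)
qed

text \<open>The weighted sum dominates every single shift up to the factor \<open>2 ^ k\<close>, so
  a set of times along which H tends to 0 is good for all the countably many shifts at once. The
  geometric weights make the tail uniformly small, and the average of H is governed by finitely many
  shifts.\<close>

lemma avg_zero_series:
  fixes K :: "real ^ 'd \<Rightarrow> real"
  assumes K: "bounded_measurable tc K" "\<And>t. t \<in> index_set tc \<Longrightarrow> 0 \<le> K t" "\<And>t. t \<in> index_set tc \<Longrightarrow> K t \<le> B"
    and s: "\<And>k. s k \<in> index_set tc"
    and lim: "((\<lambda>T. avg tc T K) \<longlongrightarrow> 0) at_top"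
  defines "H \<equiv> (\<lambda>t. \<Sum>k. (1/2) ^ k * K (t + s k))"
  shows "bounded_measurable tc H" "((\<lambda>T. avg tc T H) \<longlongrightarrow> 0) at_top"
    and "\<And>t k. t \<in> index_set tc \<Longrightarrow> (1/2) ^ k * K (t + s k) \<le> H t"
    and "\<And>t. t \<in> index_set tc \<Longrightarrow> 0 \<le> H t"
proof -
  note Ks = K(2,3)[OF index_set_add[OF _ s]]
  have sums: "summable (\<lambda>k. (1/2) ^ k * K (t + s k))" if "t \<in> index_set tc" for t
    by (rule summable_comparison_test'[of "\<lambda>k. (1/2) ^ k * B" 0])
      (use Ks[OF that] in \<open>auto intro!: summable_mult2 summable_geometric mult_left_mono\<close>)
  have Hm: "H \<in> borel_measurable (index_measure tc)"
    unfolding H_def using bounded_measurableD[OF bounded_measurable_shift[OF K(1) s]]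
    by (intro borel_measurable_suminf borel_measurable_times) auto
  show Hge: "(1/2) ^ k * K (t + s k) \<le> H t" if "t \<in> index_set tc" for t k
    unfolding H_def using sum_le_suminf[OF sums[OF that], of "{k}"] Ks[OF that] by auto
  show H0: "0 \<le> H t" if "t \<in> index_set tc" for t
    using Hge[OF that, of 0] Ks(1)[OF that, of 0] by simp
  \<comment> \<open>Cutting the series at n leaves at most B times the sum of the remaining weights,
    which is \<open>2 * B * (1/2) ^ n\<close>.\<close>
  have split: "H t \<le> (\<Sum>k<n. (1/2) ^ k * K (t + s k)) + 2 * B * (1/2) ^ n" if "t \<in> index_set tc" for t n
  proof -
    have "H t = (\<Sum>k. (1/2) ^ (k + n) * K (t + s (k + n))) + (\<Sum>k<n. (1/2) ^ k * K (t + s k))"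
      unfolding H_def using suminf_split_initial_segment[OF sums[OF that], of n] by simp
    moreover have "(\<Sum>k. (1/2) ^ (k + n) * K (t + s (k + n))) \<le> (\<Sum>k. (1/2) ^ k * ((1/2) ^ n * B))"
    proof (rule suminf_le)
      show "summable (\<lambda>k. (1/2) ^ (k + n) * K (t + s (k + n)))"
        using sums[OF that] summable_iff_shift[of "\<lambda>k. (1/2) ^ k * K (t + s k)" n] by simp
    qed (use Ks[OF that] in \<open>auto simp: power_add intro!: summable_mult2 summable_geometric mult_left_mono\<close>)
    moreover have "(\<Sum>k. (1/2) ^ k * ((1/2) ^ n * B)) = 2 * B * (1/2) ^ n"
      using suminf_mult2[OF summable_geometric, of "1/2 :: real" "(1/2) ^ n * B", symmetric] suminf_geometric[of "1/2 :: real"]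
      by (simp only:) simp
    ultimately show ?thesis by simp
  qed
  show Hb: "bounded_measurable tc H"
    by (rule bounded_measurableI[OF Hm, of "2 * B"]) (use split[of _ 0] H0 in auto)
  show "((\<lambda>T. avg tc T H) \<longlongrightarrow> 0) at_top"
  proof (rule tendstoI)
    fix e :: real assume e: "e > 0"
    obtain n where n: "2 * \<bar>B\<bar> * (1/2) ^ n < e / 4"
    proof -
      have "(\<lambda>n. 2 * \<bar>B\<bar> * (1/2) ^ n) \<longlonglongrightarrow> 2 * \<bar>B\<bar> * 0"
        by (intro tendsto_mult tendsto_const LIMSEQ_power_zero) auto
      from order_tendstoD(2)[OF this, of "e/4"] e show ?thesis
        using that by (auto simp: eventually_sequentially)
    qed
    let ?S = "\<lambda>t. \<Sum>k<n. (1/2) ^ k * K (t + s k)"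
    have bm: "bounded_measurable tc (\<lambda>t. (1/2) ^ k * K (t + s k))" for k
      by (intro bounded_measurable_mult bounded_measurable_const bounded_measurable_shift K s)
    then have bS: "bounded_measurable tc ?S" by (rule bounded_measurable_sum)
    have "((\<lambda>T. avg tc T ?S) \<longlongrightarrow> 0) at_top"
    proof (rule avg_zero_sum[OF _ bm])
      show "((\<lambda>T. avg tc T (\<lambda>t. (1/2) ^ k * K (t + s k))) \<longlongrightarrow> 0) at_top" for k
        using tendsto_mult[OF tendsto_const avg_zero_shift[OF K(1,2) s lim], of "(1/2) ^ k" k] by (simp add: avg_cmult)
    qed simp
    then have "eventually (\<lambda>T. avg tc T ?S < e / 4) at_top" using e by (intro order_tendstoD(2)) auto
    moreover have "eventually (\<lambda>T. avg tc T (\<lambda>t :: real ^ 'd. e / 4) < e / 2) at_top"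
      using e by (intro order_tendstoD(2)[OF avg_const_tendsto]) auto
    ultimately show "eventually (\<lambda>T. dist (avg tc T H) 0 < e) at_top"
      using eventually_gt_at_top[of 0]
    proof eventually_elim
      case (elim T)
      have "avg tc T H \<le> avg tc T (\<lambda>t. ?S t + e / 4)"
      proof (rule avg_mono[OF Hb bounded_measurable_add[OF bS bounded_measurable_const] elim(3)])
        fix t :: "real ^ 'd" assume "t \<in> box_B tc T"
        moreover have "2 * B * (1/2) ^ n \<le> 2 * \<bar>B\<bar> * (1/2) ^ n" by (intro mult_right_mono) auto
        ultimately show "H t \<le> ?S t + e / 4"
          using split[OF box_B_index, of t T n] n by linarith
      qed
      also have "\<dots> = avg tc T ?S + avg tc T (\<lambda>t :: real ^ 'd. e / 4)"
        by (intro avg_add bS bounded_measurable_const elim)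
      finally show ?case using elim avg_nonneg[of tc H T, OF H0 elim(3)] e by simp
    qed
  qed
qed

text \<open>The Koopman-von Neumann lemma: for a nonnegative bounded function, vanishing averages
  yield convergence to 0 along a set of density one. The threshold that defines D varies with the
  point, so a single set works and no sequence of sets for fixed thresholds has to be glued
  together.\<close>

lemma density_one_set:
  fixes H :: "real ^ 'd \<Rightarrow> real"
  assumes H: "bounded_measurable tc H" "\<And>t. t \<in> index_set tc \<Longrightarrow> 0 \<le> H t"
    and lim: "((\<lambda>T. avg tc T H) \<longlongrightarrow> 0) at_top"
  obtains D where "D \<subseteq> index_set tc" "D \<in> sets (index_measure tc)"
    "((\<lambda>T. avg tc T (indicator (index_set tc - D))) \<longlongrightarrow> 0) at_top"
    "\<And>t. (\<And>n. t n \<in> D) \<Longrightarrow> filterlim (\<lambda>n :: nat. sup_norm (t n)) at_top sequentially \<Longrightarrow> (\<lambda>n. H (t n)) \<longlonglongrightarrow> 0"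
proof -
  obtain T0 where T0: "\<And>T. T \<ge> T0 \<Longrightarrow> \<bar>avg tc T H\<bar> < 1" "T0 > 0"
  proof -
    have "eventually (\<lambda>T. \<bar>avg tc T H\<bar> < 1 \<and> T > 0) at_top"
      using tendstoD[OF lim zero_less_one] eventually_gt_at_top[of 0] by eventually_elim auto
    then obtain a where "\<And>T. T \<ge> a \<Longrightarrow> \<bar>avg tc T H\<bar> < 1 \<and> T > 0" by (auto simp: eventually_at_top_linorder)
    then show ?thesis using that[of a] by blast
  qed
  \<comment> \<open>A nonincreasing majorant of the averages: on the box of radius T it is at least its value at T,
    so a single Markov inequality bounds the exceptional set.\<close>
  define S where "S T = (SUP T'\<in>{max T T0..}. avg tc T' H) + 1 / max T T0" for T
  have bdd: "bdd_above ((\<lambda>T'. avg tc T' H) ` {max T T0..})" for T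
    by (rule bdd_aboveI[of _ 1]) (use T0(1) in \<open>force simp: abs_less_iff\<close>)
  have S_ge: "avg tc T H \<le> S T" if "T \<ge> T0" for T
    using cSUP_upper[OF _ bdd[of T], of T] that T0(2) unfolding S_def by (auto intro: add_increasing2)
  have sup0: "0 \<le> (SUP T'\<in>{max T T0..}. avg tc T' H)" for T
    using cSUP_upper[OF _ bdd[of T], of "max T T0"] avg_nonneg[of tc H "max T T0", OF H(2)] T0(2) by force
  \<comment> \<open>The summand \<open>1 / max T T0\<close> in S exists for this strict positivity:
    the Markov bound below divides by \<open>sqrt (S T)\<close>.\<close>
  have S_pos: "S T > 0" for T using sup0[of T] T0(2) unfolding S_def by (intro add_nonneg_pos) auto
  have anti: "S T' \<le> S T" if "T \<le> T'" for T T'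
    unfolding S_def using that T0(2)
    by (intro add_mono cSUP_subset_mono bdd divide_left_mono) (auto simp: max_def)
  have S_lim: "(S \<longlongrightarrow> 0) at_top"
  proof (rule tendstoI)
    fix e :: real assume e: "e > 0"
    have "eventually (\<lambda>T. \<bar>avg tc T H\<bar> < e / 2) at_top" using tendstoD[OF lim, of "e/2"] e by simp
    then obtain a where a: "\<And>T. T \<ge> a \<Longrightarrow> \<bar>avg tc T H\<bar> < e / 2" by (auto simp: eventually_at_top_linorder)
    show "eventually (\<lambda>T. dist (S T) 0 < e) at_top"
      using eventually_ge_at_top[of a] eventually_ge_at_top[of T0] eventually_gt_at_top[of "2 / e"]
    proof eventually_elim
      case (elim T)
      have "(SUP T'\<in>{max T T0..}. avg tc T' H) \<le> e / 2"
        
      proof (rule cSUP_least)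
        show "avg tc x H \<le> e / 2" if "x \<in> {max T T0..}" for x
          using a[of x] that elim by auto
      qed auto
      moreover have "1 / max T T0 < e / 2" using elim e T0(2)
        by (simp add: field_simps max_def)
      ultimately show ?case using S_pos[of T] unfolding S_def by simp
    qed
  qed
  have [measurable]: "S \<in> borel_measurable borel"
  proof -
    have "(\<lambda>T. - S T) \<in> borel_measurable borel" by (rule borel_measurable_mono) (use anti in \<open>auto simp: mono_def\<close>)
    then show ?thesis using borel_measurable_uminus_eq[of S borel] by simp
  qed
  have g_meas [measurable]: "(\<lambda>t. sqrt (S (sup_norm t))) \<in> borel_measurable (index_measure tc :: (real ^ 'd) measure)"
    by (intro borel_measurable_index_measure) measurable
  have [measurable]: "H \<in> borel_measurable (index_measure tc)" using H(1) by (rule bounded_measurableD)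
  \<comment> \<open>The square root balances two demands: the threshold tends to 0 at infinity, and
    the Markov inequality still bounds the exceptional density by S / sqrt S = sqrt S.\<close>
  define D where "D = {t \<in> space (index_measure tc). H t \<le> sqrt (S (sup_norm t))}"
  show thesis
  proof
    show "D \<subseteq> index_set tc" by (auto simp: D_def)
    show D_sets: "D \<in> sets (index_measure tc)" unfolding D_def by measurable
    have bE: "bounded_measurable tc (indicator (index_set tc - D))"
      by (rule bounded_measurable_indicator)
        (use sets.compl_sets[OF D_sets] in simp)
    have ub: "eventually (\<lambda>T. avg tc T (indicator (index_set tc - D)) \<le> sqrt (S T)) at_top"
      using eventually_ge_at_top[of T0]
    proof eventually_elim
      case (elim T)
      have "avg tc T (indicator (index_set tc - D)) \<le> avg tc T (\<lambda>t. (1 / sqrt (S T)) * H t)"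
      proof (rule avg_mono[OF bE bounded_measurable_mult[OF bounded_measurable_const H(1)]])
        fix t :: "real ^ 'd" assume t: "t \<in> box_B tc T"
        show "indicator (index_set tc - D) t \<le> (1 / sqrt (S T)) * H t"
        proof (cases "t \<in> D")
          case True
          then show ?thesis using H(2) S_pos[of T] box_B_index[OF t] by simp
        next
          case False
          then have "sqrt (S T) < H t" 
            using anti[OF box_B_sup_norm[OF t]] box_B_index[OF t] unfolding D_def
            by (auto simp: not_le intro: le_less_trans[OF real_sqrt_le_mono])
          then show ?thesis using S_pos[of T] False box_B_index[OF t] by (simp add: field_simps)
        qed
      qed (use elim T0 in auto)
      also have "\<dots> = avg tc T H / sqrt (S T)" unfolding avg_cmult by simp
      also have "\<dots> \<le> S T / sqrt (S T)" using S_ge[OF elim] S_pos[of T] by (intro divide_right_mono) auto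
      also have "\<dots> = sqrt (S T)" by (simp add: real_div_sqrt S_pos less_imp_le)
      finally show ?case .
    qed
    have sq: "((\<lambda>T. sqrt (S T)) \<longlongrightarrow> 0) at_top"
      using tendsto_real_sqrt[OF S_lim] by simp
    show "((\<lambda>T. avg tc T (indicator (index_set tc - D))) \<longlongrightarrow> 0) at_top"
    proof (rule tendsto_sandwich[OF _ ub tendsto_const sq])
      show "eventually (\<lambda>T. 0 \<le> avg tc T (indicator (index_set tc - D))) at_top"
        using eventually_gt_at_top[of 0] by eventually_elim (intro avg_nonneg, auto)
    qed
    fix t :: "nat \<Rightarrow> real ^ 'd" assume t: "\<And>n. t n \<in> D" "filterlim (\<lambda>n. sup_norm (t n)) at_top sequentially"
    show "(\<lambda>n. H (t n)) \<longlonglongrightarrow> 0"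
    proof (rule tendsto_sandwich[OF _ _ tendsto_const filterlim_compose[OF sq t(2)]])
      show "eventually (\<lambda>n. 0 \<le> H (t n)) sequentially" using t(1) H(2) by (auto simp: D_def)
      show "eventually (\<lambda>n. H (t n) \<le> sqrt (S (sup_norm (t n)))) sequentially" using t(1) by (auto simp: D_def)
    qed
  qed
qed

section \<open>Nonsingular flows and the positive part\<close>

locale nonsingular_flow = sigma_finite_measure \<mu> for \<mu> :: "'s measure" +
  fixes tc :: tcase and \<phi> :: "real ^ 'd \<Rightarrow> 's \<Rightarrow> 's"
  assumes nonsingular: "nonsingular_action tc \<mu> \<phi>"
begin

lemma flow_measurable: "t \<in> index_set tc \<Longrightarrow> \<phi> t \<in> measurable \<mu> \<mu>"
  using nonsingular by (simp add: nonsingular_action_def)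

lemma flow_space: "t \<in> index_set tc \<Longrightarrow> x \<in> space \<mu> \<Longrightarrow> \<phi> t x \<in> space \<mu>"
  using flow_measurable by (rule measurable_space)

lemma flow_add: "s \<in> index_set tc \<Longrightarrow> t \<in> index_set tc \<Longrightarrow> x \<in> space \<mu> \<Longrightarrow> \<phi> (s + t) x = \<phi> s (\<phi> t x)"
  using nonsingular by (simp add: nonsingular_action_def)

lemma flow_inverse: "t \<in> index_set tc \<Longrightarrow> x \<in> space \<mu> \<Longrightarrow> \<phi> t (\<phi> (- t) x) = x"
  using flow_add[of t "- t" x] nonsingular by (simp add: nonsingular_action_def index_set_minus)

lemma flow_null:
  "t \<in> index_set tc \<Longrightarrow> A \<in> sets \<mu> \<Longrightarrow> emeasure \<mu> (\<phi> t -` A \<inter> space \<mu>) = 0 \<longleftrightarrow> emeasure \<mu> A = 0"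
  using nonsingular by (simp add: nonsingular_action_def)

lemma absolutely_continuous_flow:
  assumes "t \<in> index_set tc"
  shows "absolutely_continuous \<mu> (distr \<mu> \<mu> (\<phi> t))"
  unfolding absolutely_continuous_def null_sets_def
  using flow_null[OF assms] by (auto simp: emeasure_distr flow_measurable[OF assms])

text \<open>An exhaustion by sets of finite measure is carried along by the inverse map.
  Sigma-finiteness of the image measure is what makes the derivative of the flow finite almost
  everywhere.\<close>

lemma sigma_finite_flow:
  assumes t: "t \<in> index_set tc"
  shows "sigma_finite_measure (distr \<mu> \<mu> (\<phi> t))"
proof -
  obtain A where A: "countable A" "A \<subseteq> sets \<mu>" "\<Union>A = space \<mu>" "\<And>a. a \<in> A \<Longrightarrow> emeasure \<mu> a \<noteq> \<infinity>"
    using sigma_finite_countable by blast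
  have mt: "- t \<in> index_set tc" using t by (rule index_set_minus)
  let ?B = "(\<lambda>a. \<phi> (- t) -` a \<inter> space \<mu>) ` A"
  show ?thesis
  proof (rule sigma_finite_measure.intro, intro exI[of _ ?B] conjI ballI)
    show "countable ?B" using A(1) by simp
    show "?B \<subseteq> sets (distr \<mu> \<mu> (\<phi> t))" using A(2) flow_measurable[OF mt] by (auto intro: measurable_sets)
    have "\<Union>?B = \<phi> (- t) -` (\<Union>A) \<inter> space \<mu>" by auto
    then show "\<Union>?B = space (distr \<mu> \<mu> (\<phi> t))" using A(3) flow_space[OF mt] by auto
    fix b assume "b \<in> ?B"
    then obtain a where a: "a \<in> A" "b = \<phi> (- t) -` a \<inter> space \<mu>" by auto
    have "\<phi> t -` b \<inter> space \<mu> = a"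
    proof -
      have "a \<subseteq> space \<mu>" using a(1) A(2) by (intro sets.sets_into_space) auto
      then show ?thesis using a(2) flow_inverse[OF mt] flow_space[OF t] by (auto simp: subset_iff)
    qed
    then show "emeasure (distr \<mu> \<mu> (\<phi> t)) b \<noteq> \<infinity>"
      using a A(2,4) measurable_sets[OF flow_measurable[OF mt], of a]
      by (simp add: emeasure_distr[OF flow_measurable[OF t]] subset_iff)
  qed
qed

text \<open>Null sets pull back to null sets, so almost sure identities may be evaluated along the
  flow.\<close>

lemma AE_flow:
  assumes t: "t \<in> index_set tc" and Q: "AE x in \<mu>. Q x"
  shows "AE x in \<mu>. Q (\<phi> t x)"
proof -
  obtain N where N: "N \<in> null_sets \<mu>" "{x \<in> space \<mu>. \<not> Q x} \<subseteq> N" using Q by (auto simp: eventually_ae_filter)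
  have "\<phi> t -` N \<inter> space \<mu> \<in> null_sets \<mu>"
    using N(1) flow_null[OF t] flow_measurable[OF t] by (auto simp: null_sets_def intro: measurable_sets)
  then show ?thesis
    by (rule AE_I') (use N(2) flow_space[OF t] in auto)
qed

text \<open>The derivative of \<mu> composed with the map of time t. The image is taken under
  \<open>\<phi> (- t)\<close> because the measure of the forward image of A is that of the preimage
  of A under the inverse map.\<close>

definition flow_deriv :: "real ^ 'd \<Rightarrow> 's \<Rightarrow> ennreal" where
  "flow_deriv t = RN_deriv \<mu> (distr \<mu> \<mu> (\<phi> (- t)))"

lemma flow_deriv_measurable [measurable]: "flow_deriv t \<in> borel_measurable \<mu>"
  by (simp add: flow_deriv_def)

lemma flow_deriv_finite:
  assumes t: "t \<in> index_set tc"
  shows "AE x in \<mu>. flow_deriv t x \<noteq> \<infinity>"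
  unfolding flow_deriv_def using index_set_minus[OF t]
  by (intro RN_deriv_finite sigma_finite_flow absolutely_continuous_flow) auto

lemma nn_integral_flow_deriv:
  assumes t: "t \<in> index_set tc" and h [measurable]: "h \<in> borel_measurable \<mu>"
  shows "(\<integral>\<^sup>+x. flow_deriv t x * h x \<partial>\<mu>) = (\<integral>\<^sup>+x. h (\<phi> (- t) x) \<partial>\<mu>)"
proof -
  have mt: "- t \<in> index_set tc" using t by (rule index_set_minus)
  have "(\<integral>\<^sup>+x. flow_deriv t x * h x \<partial>\<mu>) = integral\<^sup>N (distr \<mu> \<mu> (\<phi> (- t))) h"
    unfolding flow_deriv_def
    using RN_deriv_nn_integral[OF absolutely_continuous_flow[OF mt] _ h] by simp
  then show ?thesis using flow_measurable[OF mt] by (simp add: nn_integral_distr)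
qed

text \<open>Composition with \<open>\<phi> t\<close>, weighted by the derivative, preserves
  integrals. Applied to products of two vectors this is unitarity of the representation on
  L2.\<close>

lemma nn_integral_flow:
  assumes t: "t \<in> index_set tc" and h [measurable]: "h \<in> borel_measurable \<mu>"
  shows "(\<integral>\<^sup>+x. flow_deriv t x * h (\<phi> t x) \<partial>\<mu>) = (\<integral>\<^sup>+x. h x \<partial>\<mu>)"
proof -
  note [measurable] = flow_measurable[OF t]
  have "(\<integral>\<^sup>+x. flow_deriv t x * h (\<phi> t x) \<partial>\<mu>) = (\<integral>\<^sup>+x. h (\<phi> t (\<phi> (- t) x)) \<partial>\<mu>)"
    by (rule nn_integral_flow_deriv[OF t]) measurable
  also have "\<dots> = (\<integral>\<^sup>+x. h x \<partial>\<mu>)"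
    by (rule nn_integral_cong) (simp add: flow_inverse[OF t])
  finally show ?thesis .
qed

text \<open>Pushing a measure forward by the inverse map acts on densities as weighted composition
  with \<open>\<phi> t\<close>. Uniqueness of densities turns this into the cocycle rule and into
  the equation for invariant densities.\<close>

lemma density_flow:
  assumes t: "t \<in> index_set tc" and w [measurable]: "w \<in> borel_measurable \<mu>"
  shows "density \<mu> (\<lambda>x. flow_deriv t x * w (\<phi> t x)) = distr (density \<mu> w) \<mu> (\<phi> (- t))"
proof (rule measure_eqI)
  have mt: "- t \<in> index_set tc" using t by (rule index_set_minus)
  note [measurable] = flow_measurable[OF t] flow_measurable[OF mt]
  fix A assume "A \<in> sets (density \<mu> (\<lambda>x. flow_deriv t x * w (\<phi> t x)))"
  then have A [measurable]: "A \<in> sets \<mu>" by simp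
  have "emeasure (density \<mu> (\<lambda>x. flow_deriv t x * w (\<phi> t x))) A
      = (\<integral>\<^sup>+x. flow_deriv t x * (w (\<phi> t x) * indicator A x) \<partial>\<mu>)"
    by (subst emeasure_density) (auto simp: mult.assoc)
  also have "\<dots> = (\<integral>\<^sup>+x. w (\<phi> t (\<phi> (- t) x)) * indicator A (\<phi> (- t) x) \<partial>\<mu>)"
    by (rule nn_integral_flow_deriv[OF t]) measurable
  also have "\<dots> = (\<integral>\<^sup>+x. w x * indicator (\<phi> (- t) -` A \<inter> space \<mu>) x \<partial>\<mu>)"
    by (rule nn_integral_cong) (auto simp: flow_inverse[OF t] indicator_def)
  also have "\<dots> = emeasure (distr (density \<mu> w) \<mu> (\<phi> (- t))) A"
    by (subst emeasure_distr) (auto simp: emeasure_density)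
  finally show "emeasure (density \<mu> (\<lambda>x. flow_deriv t x * w (\<phi> t x))) A = emeasure (distr (density \<mu> w) \<mu> (\<phi> (- t))) A" .
qed simp

text \<open>Both sides are densities of the image of \<mu> under \<open>\<phi> (- t)\<close>,
  reached once in two steps and once directly.\<close>

lemma flow_deriv_cocycle:
  assumes s: "s \<in> index_set tc" and t: "t \<in> index_set tc"
  shows "AE x in \<mu>. flow_deriv s x * flow_deriv (t - s) (\<phi> s x) = flow_deriv t x"
proof -
  have d: "t - s \<in> index_set tc" "- (t - s) \<in> index_set tc" "- s \<in> index_set tc" "- t \<in> index_set tc"
    using s t by (auto intro: index_set_diff index_set_minus simp del: minus_diff_eq)
  have "density \<mu> (flow_deriv (t - s)) = distr \<mu> \<mu> (\<phi> (- (t - s)))"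
    unfolding flow_deriv_def using d by (intro density_RN_deriv absolutely_continuous_flow) auto
  then have "density \<mu> (\<lambda>x. flow_deriv s x * flow_deriv (t - s) (\<phi> s x))
     = distr (distr \<mu> \<mu> (\<phi> (- (t - s)))) \<mu> (\<phi> (- s))"
    by (simp add: density_flow[OF s])
  also have "\<dots> = distr \<mu> \<mu> (\<phi> (- s) \<circ> \<phi> (- (t - s)))"
    by (rule distr_distr[OF flow_measurable[OF d(3)] flow_measurable[OF d(2)]])
  also have "\<dots> = distr \<mu> \<mu> (\<phi> (- t))"
    using flow_add[OF d(3) d(2), symmetric] by (intro distr_cong) auto
  finally show ?thesis
    unfolding flow_deriv_def[of t]
    by (intro RN_deriv_unique) (use flow_measurable[OF s] in measurable)
qed

text \<open>Both sides are densities of \<nu>, because pushing \<nu> forward by the inverse map does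
  not change it.\<close>

lemma invariant_density:
  assumes \<nu>: "invariant_finite_ac tc \<mu> \<phi> \<nu>" and t: "t \<in> index_set tc"
  shows "AE x in \<mu>. flow_deriv t x * RN_deriv \<mu> \<nu> (\<phi> t x) = RN_deriv \<mu> \<nu> x"
proof (rule RN_deriv_unique)
  have mt: "- t \<in> index_set tc" using t by (rule index_set_minus)
  have sets [measurable_cong]: "sets \<nu> = sets \<mu>" using \<nu> by (simp add: invariant_finite_ac_def)
  have d: "density \<mu> (RN_deriv \<mu> \<nu>) = \<nu>"
    using \<nu> by (intro density_RN_deriv) (auto simp: invariant_finite_ac_def)
  have m: "\<phi> (- t) \<in> measurable \<nu> \<mu>" using flow_measurable[OF mt] by measurable
  have "distr \<nu> \<mu> (\<phi> (- t)) = \<nu>"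
  proof (rule measure_eqI)
    fix A assume "A \<in> sets (distr \<nu> \<mu> (\<phi> (- t)))"
    then show "emeasure (distr \<nu> \<mu> (\<phi> (- t))) A = emeasure \<nu> A"
      using \<nu> mt m sets_eq_imp_space_eq[OF sets] by (simp add: emeasure_distr invariant_finite_ac_def)
  qed (simp add: sets)
  then show "density \<mu> (\<lambda>x. flow_deriv t x * RN_deriv \<mu> \<nu> (\<phi> t x)) = \<nu>"
    by (simp add: density_flow[OF t] d)
  show "(\<lambda>x. flow_deriv t x * RN_deriv \<mu> \<nu> (\<phi> t x)) \<in> borel_measurable \<mu>"
    using flow_measurable[OF t] by measurable
qed

text \<open>A combination with positive weights has the union of the supports as its support. The
  weights \<open>(1/2) ^ n\<close>, divided by 1 plus the mass of the n-th measure, keep the total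
  mass finite.\<close>

lemma invariant_countable_sum:
  assumes \<nu>: "\<And>n :: nat. invariant_finite_ac tc \<mu> \<phi> (\<nu> n)"
  obtains \<nu>' where "invariant_finite_ac tc \<mu> \<phi> \<nu>'"
    "AE x in \<mu>. x \<in> density_support \<mu> \<nu>' \<longleftrightarrow> x \<in> (\<Union>n. density_support \<mu> (\<nu> n))"
proof -
  define c where "c n = (1/2) ^ n / (1 + measure (\<nu> n) (space \<mu>))" for n
  define w where "w x = (\<Sum>n. ennreal (c n) * RN_deriv \<mu> (\<nu> n) x)" for x
  define \<nu>' where "\<nu>' = density \<mu> w"
  have c_pos: "c n > 0" for n by (auto simp: c_def add_pos_nonneg)
  have w_meas [measurable]: "w \<in> borel_measurable \<mu>" unfolding w_def by measurable
  have sets: "sets (\<nu> n) = sets \<mu>" for n using \<nu> by (simp add: invariant_finite_ac_def)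
  have d: "density \<mu> (RN_deriv \<mu> (\<nu> n)) = \<nu> n" for n
    using \<nu>[of n] by (intro density_RN_deriv) (auto simp: invariant_finite_ac_def)
  have em: "emeasure \<nu>' A = (\<Sum>n. ennreal (c n) * emeasure (\<nu> n) A)" if A [measurable]: "A \<in> sets \<mu>" for A
  proof -
    have "emeasure \<nu>' A = (\<integral>\<^sup>+x. (\<Sum>n. ennreal (c n) * (RN_deriv \<mu> (\<nu> n) x * indicator A x)) \<partial>\<mu>)"
      unfolding \<nu>'_def w_def by (subst emeasure_density) (auto simp: ennreal_suminf_multc[symmetric] mult.assoc)
    also have "\<dots> = (\<Sum>n. ennreal (c n) * (\<integral>\<^sup>+x. RN_deriv \<mu> (\<nu> n) x * indicator A x \<partial>\<mu>))"
      by (subst nn_integral_suminf) (auto simp: nn_integral_cmult)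
    also have "\<dots> = (\<Sum>n. ennreal (c n) * emeasure (density \<mu> (RN_deriv \<mu> (\<nu> n))) A)"
      by (simp add: emeasure_density)
    also have "\<dots> = (\<Sum>n. ennreal (c n) * emeasure (\<nu> n) A)" by (simp only: d)
    finally show ?thesis .
  qed
  have le: "ennreal (c n) * emeasure (\<nu> n) (space \<mu>) \<le> ennreal ((1/2) ^ n)" for n
  proof -
    interpret n: finite_measure "\<nu> n" using \<nu>[of n] by (simp add: invariant_finite_ac_def)
    have "c n * measure (\<nu> n) (space \<mu>) \<le> (1/2) ^ n"
      unfolding c_def by (simp add: divide_le_eq add_pos_nonneg mult_left_mono)
    then show ?thesis using c_pos[of n] by (simp add: n.emeasure_eq_measure ennreal_mult[symmetric])
  qed
  have "emeasure \<nu>' (space \<mu>) \<le> (\<Sum>n. ennreal ((1/2) ^ n))"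
    unfolding em[OF sets.top] by (intro suminf_le le) auto
  also have "\<dots> < \<infinity>"
    by (subst suminf_ennreal2) (auto intro: summable_geometric)
  finally have fin: "emeasure \<nu>' (space \<mu>) < \<infinity>" .
  show thesis
  proof
    have "emeasure \<nu>' (\<phi> t -` A \<inter> space \<mu>) = emeasure \<nu>' A" if "t \<in> index_set tc" "A \<in> sets \<mu>" for t A
      using \<nu> that by (simp add: em measurable_sets[OF flow_measurable] invariant_finite_ac_def)
    moreover have "finite_measure \<nu>'" by (rule finite_measureI) (use fin in \<open>auto simp: \<nu>'_def\<close>)
    moreover have "absolutely_continuous \<mu> \<nu>'" unfolding \<nu>'_def by (rule absolutely_continuousI_density) simp
    ultimately show "invariant_finite_ac tc \<mu> \<phi> \<nu>'" by (simp add: invariant_finite_ac_def \<nu>'_def)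
    have "AE x in \<mu>. w x = RN_deriv \<mu> \<nu>' x"
      by (rule RN_deriv_unique) (auto simp: \<nu>'_def)
    then show "AE x in \<mu>. x \<in> density_support \<mu> \<nu>' \<longleftrightarrow> x \<in> (\<Union>n. density_support \<mu> (\<nu> n))"
    proof (rule AE_mp, intro AE_I2 impI)
      fix x assume x: "x \<in> space \<mu>" "w x = RN_deriv \<mu> \<nu>' x"
      have "w x = 0 \<longleftrightarrow> (\<forall>n. RN_deriv \<mu> (\<nu> n) x = 0)"
        unfolding w_def using c_pos by (subst suminf_eq_zero_iff) (auto simp: ennreal_eq_0_iff not_le[symmetric])
      then show "x \<in> density_support \<mu> \<nu>' \<longleftrightarrow> x \<in> (\<Union>n. density_support \<mu> (\<nu> n))"
        using x by (auto simp: density_support_def zero_less_iff_neq_zero)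
    qed
  qed
qed

lemma density_support_sets [measurable]: "density_support \<mu> \<nu> \<in> sets \<mu>"
  unfolding density_support_def by measurable

text \<open>Exhaustion: among the finite invariant measures, maximise the size of the support,
  measured by a finite measure m with the null sets of \<mu>. A countable sum attains the supremum,
  and a support sticking out by a set that is not null would exceed it.\<close>

lemma exists_positive_part: "\<exists>Pset. positive_part tc \<mu> \<phi> Pset"
proof -
  obtain h where h [measurable]: "h \<in> borel_measurable \<mu>" and hf: "integral\<^sup>N \<mu> h \<noteq> \<infinity>"
    and hpos: "\<And>x. x \<in> space \<mu> \<Longrightarrow> 0 < h x \<and> h x < \<infinity>"
    using Ex_finite_integrable_function by blast
  define m where "m = density \<mu> h"
  have "finite_measure m"
    by (rule finite_measureI) (use hf in \<open>auto simp: m_def emeasure_density cong: nn_integral_cong\<close>)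
  then interpret m: finite_measure m .
  have sets_m: "sets m = sets \<mu>" by (simp add: m_def)
  have null_m: "emeasure \<mu> B = 0" if B [measurable]: "B \<in> sets \<mu>" and "measure m B = 0" for B
  proof -
    have "emeasure m B = 0" using that(2) by (simp add: m.emeasure_eq_measure)
    then have "(\<integral>\<^sup>+x. h x * indicator B x \<partial>\<mu>) = 0" unfolding m_def by (simp add: emeasure_density)
    then have "AE x in \<mu>. h x * indicator B x = 0" by (subst (asm) nn_integral_0_iff_AE) auto
    then have "AE x in \<mu>. x \<notin> B"
    proof (rule AE_mp, intro AE_I2 impI notI)
      fix x assume "x \<in> space \<mu>" "h x * indicator B x = 0" "x \<in> B"
      then show False using hpos[of x] by simp
    qed
    then show ?thesis using AE_iff_null_sets[OF B] by (auto simp: null_sets_def)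
  qed
  have AE_m: "AE x in m. Q x" if "AE x in \<mu>. Q x" for Q
    unfolding m_def by (rule AE_density[THEN iffD2]) (use that in auto)
  let ?I = "{\<nu>. invariant_finite_ac tc \<mu> \<phi> \<nu>}"
  let ?g = "\<lambda>\<nu>. measure m (density_support \<mu> \<nu>)"
  \<comment> \<open>The zero measure is invariant. Without any member the supremum of reals below
    would carry no meaning.\<close>
  have ne: "?I \<noteq> {}"
  proof -
    have "invariant_finite_ac tc \<mu> \<phi> (null_measure \<mu>)"
      by (auto simp: invariant_finite_ac_def absolutely_continuous_def null_sets_def intro!: finite_measureI)
    then show ?thesis by blast
  qed
  have bdd: "bdd_above (?g ` ?I)"
    by (rule bdd_aboveI[of _ "measure m (space m)"]) (auto intro: m.bounded_measure)
  define a where "a = (SUP \<nu>\<in>?I. ?g \<nu>)"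
  have "\<exists>\<nu>. invariant_finite_ac tc \<mu> \<phi> \<nu> \<and> a - 1 / real (Suc n) < ?g \<nu>" for n
    using less_cSUP_iff[OF ne bdd, of "a - 1 / real (Suc n)"] unfolding a_def[symmetric] by auto
  then obtain \<nu> where \<nu>: "\<And>n. invariant_finite_ac tc \<mu> \<phi> (\<nu> n)" and \<nu>a: "\<And>n. a - 1 / real (Suc n) < ?g (\<nu> n)"
    by metis
  define P where "P = (\<Union>n. density_support \<mu> (\<nu> n))"
  have P [measurable]: "P \<in> sets \<mu>" unfolding P_def by measurable
  have up: "measure m (P \<union> density_support \<mu> \<nu>') \<le> a" if \<nu>': "invariant_finite_ac tc \<mu> \<phi> \<nu>'" for \<nu>'
  proof -
    \<comment> \<open>\<open>case_nat\<close> puts the competitor in front of the maximising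
      sequence, so the countable sum has support P joined with the support of the
      competitor.\<close>
    have "invariant_finite_ac tc \<mu> \<phi> (case_nat \<nu>' \<nu> n)" for n using \<nu> \<nu>' by (cases n) auto
    then obtain \<nu>2 where \<nu>2: "invariant_finite_ac tc \<mu> \<phi> \<nu>2"
      "AE x in \<mu>. x \<in> density_support \<mu> \<nu>2 \<longleftrightarrow> x \<in> (\<Union>n. density_support \<mu> (case_nat \<nu>' \<nu> n))"
      by (rule invariant_countable_sum)
    have "(\<Union>n. density_support \<mu> (case_nat \<nu>' \<nu> n)) = P \<union> density_support \<mu> \<nu>'"
    proof (intro set_eqI iffI)
      fix x assume "x \<in> (\<Union>n. density_support \<mu> (case_nat \<nu>' \<nu> n))"
      then obtain n where "x \<in> density_support \<mu> (case_nat \<nu>' \<nu> n)" by auto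
      then show "x \<in> P \<union> density_support \<mu> \<nu>'" by (cases n) (auto simp: P_def)
    next
      fix x assume "x \<in> P \<union> density_support \<mu> \<nu>'"
      then consider n where "x \<in> density_support \<mu> (case_nat \<nu>' \<nu> (Suc n))" | "x \<in> density_support \<mu> (case_nat \<nu>' \<nu> 0)"
        by (auto simp: P_def)
      then show "x \<in> (\<Union>n. density_support \<mu> (case_nat \<nu>' \<nu> n))" by cases blast+
    qed
    then have "measure m (P \<union> density_support \<mu> \<nu>') = ?g \<nu>2"
      using AE_m[OF \<nu>2(2)] by (intro m.finite_measure_eq_AE) (auto simp: sets_m)
    also have "\<dots> \<le> a" unfolding a_def by (rule cSUP_upper[OF _ bdd]) (use \<nu>2 in auto)
    finally show ?thesis .
  qed
  have ge: "a \<le> measure m P"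
  proof (rule field_le_epsilon)
    fix e :: real assume "e > 0"
    then obtain n where "1 / real (Suc n) < e" using nat_approx_posE by blast
    moreover have "?g (\<nu> n) \<le> measure m P" by (rule m.finite_measure_mono) (auto simp: P_def sets_m)
    ultimately show "a \<le> measure m P + e" using \<nu>a[of n] by linarith
  qed
  have "emeasure \<mu> (density_support \<mu> \<nu>' - P) = 0" if \<nu>': "invariant_finite_ac tc \<mu> \<phi> \<nu>'" for \<nu>'
  proof (rule null_m)
    have "measure m (P \<union> density_support \<mu> \<nu>') = measure m P + measure m (density_support \<mu> \<nu>' - P)"
      by (rule m.finite_measure_Union') (auto simp: sets_m)
    then show "measure m (density_support \<mu> \<nu>' - P) = 0"
      using up[OF \<nu>'] ge measure_nonneg[of m "density_support \<mu> \<nu>' - P"] by linarith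
  qed simp
  moreover obtain \<nu>1 where "invariant_finite_ac tc \<mu> \<phi> \<nu>1" "AE x in \<mu>. x \<in> density_support \<mu> \<nu>1 \<longleftrightarrow> x \<in> P"
    unfolding P_def by (rule invariant_countable_sum[OF \<nu>])
  moreover have "emeasure \<mu> ((P - density_support \<mu> \<nu>1) \<union> (density_support \<mu> \<nu>1 - P)) = 0"
  proof -
    let ?N = "(P - density_support \<mu> \<nu>1) \<union> (density_support \<mu> \<nu>1 - P)"
    have "AE x in \<mu>. x \<notin> ?N" using calculation(3) by eventually_elim auto
    then show ?thesis using AE_iff_null_sets[of ?N \<mu>] by (auto simp: null_sets_def)
  qed
  ultimately show ?thesis using P unfolding positive_part_def by blast
qed

end

section \<open>Trigonometric approximation of path events\<close>

lemma integral_indicator_complex: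
  "(\<integral>x. indicator A x \<partial>M) = complex_of_real (measure M (A \<inter> space M))"
proof -
  have "(\<integral>x. indicator A x \<partial>M) = (\<integral>x. complex_of_real (indicator A x) \<partial>M)"
    by (rule Bochner_Integration.integral_cong) (auto simp: indicator_def)
  then show ?thesis by (simp add: integral_complex_of_real)
qed

text \<open>The complex span of the characters of finitely many coordinates. The inductive form
  reduces any statement that is linear in the function to characters.\<close>

inductive_set trig_poly :: "'i set \<Rightarrow> (('i \<Rightarrow> real) \<Rightarrow> complex) set" for I where
  char: "finite J \<Longrightarrow> J \<subseteq> I \<Longrightarrow> (\<lambda>x. cis (\<Sum>s\<in>J. \<theta> s * x s)) \<in> trig_poly I"
| add: "p \<in> trig_poly I \<Longrightarrow> q \<in> trig_poly I \<Longrightarrow> (\<lambda>x. p x + q x) \<in> trig_poly I"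
| scale: "p \<in> trig_poly I \<Longrightarrow> (\<lambda>x. a * p x) \<in> trig_poly I"

text \<open>Two characters may live on different finite sets of coordinates; their coefficients are
  extended by zero to the union and added.\<close>

lemma trig_poly_mult:
  assumes "p \<in> trig_poly I" "q \<in> trig_poly I"
  shows "(\<lambda>x. p x * q x) \<in> trig_poly I"
  using assms(1)
proof induction
  case (char J \<theta>)
  note J = char
  show ?case using assms(2)
  proof induction
    case (char K \<eta>)
    let ?c = "\<lambda>s. (if s \<in> J then \<theta> s else 0) + (if s \<in> K then \<eta> s else 0)"
    have eq: "(\<Sum>s\<in>J. \<theta> s * x s) + (\<Sum>s\<in>K. \<eta> s * x s) = (\<Sum>s\<in>J \<union> K. ?c s * x s)" for x :: "'a \<Rightarrow> real"
    proof -
      have "(\<Sum>s\<in>J. \<theta> s * x s) = (\<Sum>s\<in>J \<union> K. (if s \<in> J then \<theta> s else 0) * x s)"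
        using J(1) char(1) by (intro sum.mono_neutral_cong_left) auto
      moreover have "(\<Sum>s\<in>K. \<eta> s * x s) = (\<Sum>s\<in>J \<union> K. (if s \<in> K then \<eta> s else 0) * x s)"
        using J(1) char(1) by (intro sum.mono_neutral_cong_left) auto
      ultimately show ?thesis by (simp add: sum.distrib distrib_right)
    qed
    have "(\<lambda>x. cis (\<Sum>s\<in>J \<union> K. ?c s * x s)) \<in> trig_poly I" using J char by (intro trig_poly.char) auto
    then show ?case by (simp add: cis_mult eq)
  next
    case (add p q)
    then show ?case using trig_poly.add[OF add.IH] by (simp add: distrib_left)
  next
    case (scale p a)
    then show ?case using trig_poly.scale[OF scale.IH, of a] by (simp add: mult.left_commute)
  qed
next
  case (add p q)
  then show ?case using trig_poly.add[OF add.IH] by (simp add: distrib_right)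
next
  case (scale p a)
  then show ?case using trig_poly.scale[OF scale.IH, of a] by (simp add: mult.assoc)
qed

lemma trig_poly_const: "(\<lambda>x. a) \<in> trig_poly I"
  using trig_poly.scale[OF trig_poly.char[of "{}" I undefined], of a] by simp

lemma trig_poly_measurable [measurable_dest]:
  "p \<in> trig_poly I \<Longrightarrow> p \<in> borel_measurable (PiM I (\<lambda>_. borel))"
proof (induction rule: trig_poly.induct)
  case (char J \<theta>)
  have "(\<lambda>x. \<Sum>s\<in>J. \<theta> s * x s) \<in> borel_measurable (PiM I (\<lambda>_. borel :: real measure))"
    using char by (intro borel_measurable_sum borel_measurable_times borel_measurable_const) 
      (auto intro!: measurable_component_singleton)
  then show ?case
    by (rule measurable_compose) (intro borel_measurable_continuous_onI continuous_on_cis continuous_on_id)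
qed auto

lemma trig_poly_bounded:
  assumes "p \<in> trig_poly I"
  obtains B where "B > 0" "\<And>x. norm (p x) \<le> B"
proof -
  from assms have "\<exists>B>0. \<forall>x. norm (p x) \<le> B"
  proof induction
    case (char J \<theta>)
    then show ?case by (intro exI[of _ 1]) auto
  next
    case (add p q)
    then obtain B C where "B > 0" "C > 0" "\<forall>x. norm (p x) \<le> B" "\<forall>x. norm (q x) \<le> C" by blast
    then show ?case by (intro exI[of _ "B + C"]) (auto intro: order_trans[OF norm_triangle_ineq add_mono])
  next
    case (scale p a)
    then obtain B where "B > 0" "\<forall>x. norm (p x) \<le> B" by blast
    then show ?case
      by (intro exI[of _ "(norm a + 1) * B"])
        (auto simp: norm_mult intro!: mult_mono add_nonneg_pos mult_pos_pos)
  qed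
  then show ?thesis using that by blast
qed

lemma trig_poly_sin:
  assumes "i \<in> I"
  shows "(\<lambda>x. complex_of_real (sin (r * x i))) \<in> trig_poly I"
proof -
  have c: "(\<lambda>x. cis (r * x i)) \<in> trig_poly I" for r
    using trig_poly.char[of "{i}" I "\<lambda>_. r"] assms by simp
  have "(\<lambda>x. (1 / (2 * \<i>)) * (cis (r * x i) + (-1) * cis ((- r) * x i))) \<in> trig_poly I"
    by (intro trig_poly.scale trig_poly.add c)
  moreover have "(1 / (2 * \<i>)) * (cis y + (-1) * cis (- y)) = complex_of_real (sin y)" for y
    by (simp add: complex_eq_iff Re_divide Im_divide)
  ultimately show ?thesis by simp
qed

text \<open>Trigonometric polynomials form an algebra containing the sines. With r = 1/R and R
  large, \<open>R * sin (r * x i)\<close> is a bounded stand-in for the coordinate itself.\<close>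

lemma trig_poly_polynomial_sin:
  assumes "real_polynomial_function p" "i \<in> I"
  shows "(\<lambda>x. complex_of_real (p (R * sin (r * x i)))) \<in> trig_poly I"
  using assms(1)
proof induction
  case (linear f)
  have "f y = f 1 * y" for y :: real
  proof -
    have "f (y *\<^sub>R 1) = y *\<^sub>R f 1" by (rule linear_scale[OF bounded_linear.linear[OF linear]])
    then show ?thesis by (simp add: mult.commute)
  qed
  then have "complex_of_real (f (R * sin (r * x i))) = complex_of_real (f 1 * R) * complex_of_real (sin (r * x i))" for x :: "'a \<Rightarrow> real"
    by (metis mult.assoc of_real_mult)
  then show ?case using trig_poly.scale[OF trig_poly_sin[OF assms(2)], of "complex_of_real (f 1 * R)" r]
    by (simp only:)
next
  case (const c)
  show ?case by (rule trig_poly_const)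
next
  case (add f g)
  then show ?case using trig_poly.add by force
next
  case (mult f g)
  then show ?case using trig_poly_mult by force
qed

text \<open>Bounded functions in the L1 closure of the trigonometric polynomials. The bound makes
  them integrable for a probability measure and lets products be estimated.\<close>

definition trig_approximable :: "('i \<Rightarrow> real) measure \<Rightarrow> 'i set \<Rightarrow> (('i \<Rightarrow> real) \<Rightarrow> complex) \<Rightarrow> bool" where
  "trig_approximable Q I F \<longleftrightarrow> F \<in> borel_measurable Q \<and> (\<exists>B. \<forall>x. norm (F x) \<le> B) \<and>
     (\<forall>e>0. \<exists>q\<in>trig_poly I. (\<integral>x. norm (F x - q x) \<partial>Q) < e)"

section \<open>Approximation of path events in L1\<close>

locale path_law = prob_space Q for Q :: "('i \<Rightarrow> real) measure" and I :: "'i set" +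
  assumes sets_Q [measurable_cong]: "sets Q = sets (PiM I (\<lambda>_. borel))"
begin

lemma space_Q: "space Q = (\<Pi>\<^sub>E i\<in>I. UNIV)"
  using sets_eq_imp_space_eq[OF sets_Q] by (simp add: space_PiM)

lemma trig_poly_Q [measurable_dest]: "q \<in> trig_poly I \<Longrightarrow> q \<in> borel_measurable Q"
  using trig_poly_measurable measurable_cong_sets[OF sets_Q refl] by blast

lemma integrable_bounded:
  fixes F :: "_ \<Rightarrow> complex"
  assumes "F \<in> borel_measurable Q" "\<And>x. norm (F x) \<le> B"
  shows "integrable Q F"
  by (rule integrable_const_bound[of _ B]) (use assms in auto)

lemma integrable_trig_poly: "q \<in> trig_poly I \<Longrightarrow> integrable Q q"
  by (rule trig_poly_bounded, assumption, rule integrable_bounded, rule trig_poly_Q)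

lemma integrable_approximable: "trig_approximable Q I F \<Longrightarrow> integrable Q F"
  unfolding trig_approximable_def by (auto intro: integrable_bounded)

lemma trig_approximable_trig_poly:
  assumes "q \<in> trig_poly I"
  shows "trig_approximable Q I q"
  unfolding trig_approximable_def
proof (intro conjI allI impI)
  show "\<exists>B. \<forall>x. norm (q x) \<le> B" by (rule trig_poly_bounded[OF assms]) blast
  show "\<exists>p\<in>trig_poly I. (\<integral>x. norm (q x - p x) \<partial>Q) < e" if "e > 0" for e
    using assms that by (intro bexI[of _ q]) auto
qed (rule trig_poly_Q[OF assms])

text \<open>Dominated convergence brings G within e/2 of some \<open>F n\<close>, and an approximant
  of that function is then within e of G.\<close>

lemma trig_approximable_limit:
  assumes F: "\<And>n :: nat. trig_approximable Q I (F n)" "\<And>n x. norm (F n x) \<le> B"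
    and lim: "\<And>x. x \<in> space Q \<Longrightarrow> (\<lambda>n. F n x) \<longlonglongrightarrow> G x" and G: "G \<in> borel_measurable Q" "\<And>x. norm (G x) \<le> B"
  shows "trig_approximable Q I G"
  unfolding trig_approximable_def
proof (intro conjI allI impI)
  show "\<exists>B. \<forall>x. norm (G x) \<le> B" using G by blast
  fix e :: real assume e: "e > 0"
  have Fm [measurable]: "F n \<in> borel_measurable Q" for n using F(1) by (simp add: trig_approximable_def)
  note [measurable] = G(1)
  have "(\<lambda>n. \<integral>x. norm (G x - F n x) \<partial>Q) \<longlonglongrightarrow> (\<integral>x. 0 \<partial>Q)"
  proof (rule integral_dominated_convergence[where w = "\<lambda>_. 2 * B"])
    show "AE x in Q. (\<lambda>n. norm (G x - F n x)) \<longlonglongrightarrow> 0"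
    proof (intro AE_I2)
      fix x assume "x \<in> space Q"
      from tendsto_norm[OF tendsto_diff[OF tendsto_const[of "G x"] lim[OF this]]]
      show "(\<lambda>n. norm (G x - F n x)) \<longlonglongrightarrow> 0" by simp
    qed
    show "AE x in Q. norm (norm (G x - F n x)) \<le> 2 * B" for n
    proof (intro AE_I2)
      fix x show "norm (norm (G x - F n x)) \<le> 2 * B"
        using norm_triangle_ineq4[of "G x" "F n x"] G(2)[of x] F(2)[of n x] by simp
    qed
  qed auto
  from order_tendstoD(2)[OF this, of "e/2"] e obtain n where n: "(\<integral>x. norm (G x - F n x) \<partial>Q) < e / 2"
    by (auto simp: eventually_sequentially)
  obtain q where q: "q \<in> trig_poly I" "(\<integral>x. norm (F n x - q x) \<partial>Q) < e / 2"
    using F(1)[of n] e unfolding trig_approximable_def by (meson half_gt_zero)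
  have i: "integrable Q G" "integrable Q (F n)" "integrable Q q"
    using integrable_bounded[OF G] integrable_approximable[OF F(1)] integrable_trig_poly[OF q(1)] by auto
  have "(\<integral>x. norm (G x - q x) \<partial>Q) \<le> (\<integral>x. norm (G x - F n x) + norm (F n x - q x) \<partial>Q)"
    using i by (intro integral_mono) (auto intro: norm_triangle_ineq[of "G x - F n x" "F n x - q x" for x, simplified])
  also have "\<dots> = (\<integral>x. norm (G x - F n x) \<partial>Q) + (\<integral>x. norm (F n x - q x) \<partial>Q)"
    using i by (intro Bochner_Integration.integral_add) auto
  finally show "\<exists>q\<in>trig_poly I. (\<integral>x. norm (G x - q x) \<partial>Q) < e" using q n by (intro bexI[of _ q]) auto
qed (rule G(1))

lemma trig_approximable_mult:
  assumes F: "trig_approximable Q I F" and p: "p \<in> trig_poly I"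
  shows "trig_approximable Q I (\<lambda>x. F x * p x)"
  unfolding trig_approximable_def
proof (intro conjI allI impI)
  obtain B where B: "B > 0" "\<And>x. norm (p x) \<le> B" using trig_poly_bounded[OF p] by blast
  obtain C where C: "\<And>x. norm (F x) \<le> C" using F unfolding trig_approximable_def by blast
  note [measurable] = trig_poly_Q[OF p]
  have [measurable]: "F \<in> borel_measurable Q" using F by (simp add: trig_approximable_def)
  show "(\<lambda>x. F x * p x) \<in> borel_measurable Q" by measurable
  show "\<exists>B. \<forall>x. norm (F x * p x) \<le> B"
    using B C by (intro exI[of _ "C * B"]) (auto simp: norm_mult intro!: mult_mono intro: order_trans[OF norm_ge_zero])
  fix e :: real assume "e > 0"
  then obtain q where q: "q \<in> trig_poly I" "(\<integral>x. norm (F x - q x) \<partial>Q) < e / B"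
    using F B(1) unfolding trig_approximable_def by (meson divide_pos_pos)
  note i = integrable_approximable[OF F] integrable_trig_poly[OF q(1)]
  have i2: "integrable Q (\<lambda>x. F x * p x)" "integrable Q (\<lambda>x. q x * p x)"
    using integrable_trig_poly[OF trig_poly_mult[OF q(1) p]] B C
    by (auto intro!: integrable_bounded[of _ "C * B"] simp: norm_mult intro!: mult_mono intro: order_trans[OF norm_ge_zero C])
  have "(\<integral>x. norm (F x * p x - q x * p x) \<partial>Q) \<le> (\<integral>x. norm (F x - q x) * B \<partial>Q)"
  proof (rule integral_mono)
    show "norm (F x * p x - q x * p x) \<le> norm (F x - q x) * B" for x
      using B(2)[of x] by (simp add: norm_mult mult_left_mono flip: left_diff_distrib)
  qed (use i i2 in auto)
  also have "\<dots> < e" using q B(1) by (simp add: pos_less_divide_eq)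
  finally show "\<exists>r\<in>trig_poly I. (\<integral>x. norm (F x * p x - r x) \<partial>Q) < e"
    by (intro bexI[OF _ trig_poly_mult[OF q(1) p]])
qed

lemma trig_approximable_add:
  assumes F: "trig_approximable Q I F" and G: "trig_approximable Q I G"
  shows "trig_approximable Q I (\<lambda>x. F x + G x)"
  unfolding trig_approximable_def
proof (intro conjI allI impI)
  obtain B C where "\<forall>x. norm (F x) \<le> B" "\<forall>x. norm (G x) \<le> C" using F G unfolding trig_approximable_def by blast
  then show "\<exists>B. \<forall>x. norm (F x + G x) \<le> B"
    by (intro exI[of _ "B + C"]) (auto intro: order_trans[OF norm_triangle_ineq add_mono])
  show "(\<lambda>x. F x + G x) \<in> borel_measurable Q" using F G by (auto simp: trig_approximable_def)
  fix e :: real assume "e > 0"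
  then obtain p q where pq: "p \<in> trig_poly I" "q \<in> trig_poly I" "(\<integral>x. norm (F x - p x) \<partial>Q) < e / 2" "(\<integral>x. norm (G x - q x) \<partial>Q) < e / 2"
    using F G unfolding trig_approximable_def by (meson half_gt_zero)
  note i = integrable_approximable[OF F] integrable_approximable[OF G] integrable_trig_poly[OF pq(1)] integrable_trig_poly[OF pq(2)]
  have "(\<integral>x. norm ((F x + G x) - (p x + q x)) \<partial>Q) \<le> (\<integral>x. norm (F x - p x) + norm (G x - q x) \<partial>Q)"
    using i by (intro integral_mono) (auto intro: norm_diff_triangle_ineq)
  also have "\<dots> = (\<integral>x. norm (F x - p x) \<partial>Q) + (\<integral>x. norm (G x - q x) \<partial>Q)"
    using i by (intro Bochner_Integration.integral_add) auto
  finally show "\<exists>r\<in>trig_poly I. (\<integral>x. norm ((F x + G x) - r x) \<partial>Q) < e"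
    using pq trig_poly.add[OF pq(1,2)] by (intro bexI[of _ "\<lambda>x. p x + q x"]) auto
qed

lemma coordinate_measurable: "i \<in> I \<Longrightarrow> (\<lambda>x. x i) \<in> borel_measurable Q"
  using measurable_component_singleton[of i I "\<lambda>_. borel :: real measure"] measurable_cong_sets[OF sets_Q refl] by blast

text \<open>Put R = n + 1. The function R sin(y/R) has values in [-R, R], where a Weierstrass
  polynomial is within 1/R of \<psi>, and it tends to y. The polynomial evaluated there is a
  trigonometric polynomial, stays bounded by 2, and converges pointwise to \<psi>.\<close>

lemma trig_approximable_mult_continuous:
  assumes F: "trig_approximable Q I F" and i: "i \<in> I"
    and \<psi>: "continuous_on UNIV (\<psi> :: real \<Rightarrow> real)" "\<And>y. \<bar>\<psi> y\<bar> \<le> 1"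
  shows "trig_approximable Q I (\<lambda>x. F x * \<psi> (x i))"
proof -
  obtain C where C: "\<And>x. norm (F x) \<le> C" using F unfolding trig_approximable_def by blast
  have C0: "C \<ge> 0" using order_trans[OF norm_ge_zero C] .
  have "\<exists>p. real_polynomial_function p \<and> (\<forall>y\<in>{-real (Suc n)..real (Suc n)}. \<bar>\<psi> y - p y\<bar> < 1 / real (Suc n))" for n
    by (rule Stone_Weierstrass_real_polynomial_function[where S = "{-real (Suc n)..real (Suc n)}" and f = \<psi> and e = "1 / real (Suc n)"])
      (use \<psi> in \<open>auto intro: continuous_on_subset\<close>)
  then obtain p where p: "\<And>n. real_polynomial_function (p n)"
    "\<And>n y. \<bar>y\<bar> \<le> real (Suc n) \<Longrightarrow> \<bar>\<psi> y - p n y\<bar> < 1 / real (Suc n)"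
    by (metis abs_le_iff atLeastAtMost_iff minus_le_iff)
  define S where "S n y = real (Suc n) * sin (1 / real (Suc n) * y)" for n and y :: real
  have S_bd: "\<bar>S n y\<bar> \<le> real (Suc n)" for n y
    unfolding S_def using abs_sin_le_one[of "1 / real (Suc n) * y"] by (simp add: abs_mult mult_left_le)
  have S_lim: "(\<lambda>n. S n y) \<longlonglongrightarrow> y" for y
  proof -
    have "(\<lambda>n. S n y) = (\<lambda>n. (\<lambda>m. real m * sin (1 / real m * y)) (Suc n))" by (simp add: S_def)
    moreover have "(\<lambda>m. real m * sin (1 / real m * y)) \<longlonglongrightarrow> y" by real_asymp
    ultimately show ?thesis using LIMSEQ_Suc[of "\<lambda>m. real m * sin (1 / real m * y)" y] by simp
  qed
  have pS: "(\<lambda>n. p n (S n y)) \<longlonglongrightarrow> \<psi> y" for y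
  proof -
    have "(\<lambda>n. p n (S n y) - \<psi> (S n y)) \<longlonglongrightarrow> 0"
    proof (rule Lim_null_comparison)
      show "eventually (\<lambda>n. norm (p n (S n y) - \<psi> (S n y)) \<le> 1 / real (Suc n)) sequentially"
        using p(2)[OF S_bd] by (intro always_eventually allI) (simp add: abs_minus_commute less_imp_le)
      show "(\<lambda>n. 1 / real (Suc n)) \<longlonglongrightarrow> 0" by (rule LIMSEQ_Suc[OF lim_1_over_n])
    qed
    moreover have "(\<lambda>n. \<psi> (S n y)) \<longlonglongrightarrow> \<psi> y"
      using \<psi>(1) S_lim[of y] by (auto simp: continuous_on_eq_continuous_at intro: isCont_tendsto_compose)
    ultimately show ?thesis using tendsto_add by fastforce
  qed
  have p_bd: "\<bar>p n (S n y)\<bar> \<le> 2" for n y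
  proof -
    have "1 / real (Suc n) \<le> 1" by simp
    then show ?thesis using p(2)[OF S_bd, of n y] \<psi>(2)[of "S n y"] by linarith
  qed
  have [measurable]: "\<psi> \<in> borel_measurable borel" using \<psi>(1) by (rule borel_measurable_continuous_onI)
  show ?thesis
  proof (rule trig_approximable_limit[where F = "\<lambda>n x. F x * complex_of_real (p n (S n (x i)))" and B = "C * 2"])
    show "trig_approximable Q I (\<lambda>x. F x * complex_of_real (p n (S n (x i))))" for n
      unfolding S_def by (rule trig_approximable_mult[OF F trig_poly_polynomial_sin[OF p(1) i]])
    show "norm (F x * complex_of_real (p n (S n (x i)))) \<le> C * 2" for n x
      unfolding norm_mult by (intro mult_mono) (use C C0 p_bd in auto)
    show "norm (F x * complex_of_real (\<psi> (x i))) \<le> C * 2" for x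
      unfolding norm_mult using \<psi>(2)[of "x i"] by (intro mult_mono) (use C C0 in auto)
    show "(\<lambda>n. F x * complex_of_real (p n (S n (x i)))) \<longlonglongrightarrow> F x * complex_of_real (\<psi> (x i))" for x
      by (intro tendsto_mult tendsto_const tendsto_of_real pS)
    show "(\<lambda>x. F x * complex_of_real (\<psi> (x i))) \<in> borel_measurable Q"
    proof (rule borel_measurable_times)
      show "F \<in> borel_measurable Q" using F by (simp add: trig_approximable_def)
      show "(\<lambda>x. complex_of_real (\<psi> (x i))) \<in> borel_measurable Q"
        by (rule measurable_compose[OF coordinate_measurable[OF i]]) measurable
    qed
  qed
qed

text \<open>Continuous ramps rising from 0 at a to 1 at a + 1/n increase to the indicator of the
  open half-line.\<close>

lemma trig_approximable_mult_halfline: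
  assumes F: "trig_approximable Q I F" and i: "i \<in> I"
  shows "trig_approximable Q I (\<lambda>x. F x * indicator {a<..} (x i))"
proof -
  obtain C where C: "\<And>x. norm (F x) \<le> C" using F unfolding trig_approximable_def by blast
  have C0: "C \<ge> 0" using order_trans[OF norm_ge_zero C] .
  define \<psi> where "\<psi> n y = min 1 (max 0 (real n * (y - a)))" for n and y :: real
  have lim: "(\<lambda>n. complex_of_real (\<psi> n y)) \<longlonglongrightarrow> indicator {a<..} y" for y
  proof (cases "y > a")
    case True
    then obtain N where "1 / (y - a) < real N" using reals_Archimedean2 by blast
    then have N: "1 \<le> real N * (y - a)" using True by (simp add: divide_less_eq)
    have "\<psi> n y = 1" if "n \<ge> N" for n
    proof -
      have "1 \<le> real n * (y - a)" using N that True by (meson diff_gt_0_iff_gt less_imp_le mult_right_mono of_nat_le_iff order_trans)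
      then show ?thesis by (simp add: \<psi>_def)
    qed
    then show ?thesis using True by (intro tendsto_eventually) (auto simp: eventually_sequentially)
  next
    case False
    then have "\<psi> n y = 0" for n using False mult_nonneg_nonpos[of "real n" "y - a"] unfolding \<psi>_def by (simp add: max_absorb1)
    then show ?thesis using False by simp
  qed
  show ?thesis
  proof (rule trig_approximable_limit[where F = "\<lambda>n x. F x * complex_of_real (\<psi> n (x i))" and B = C])
    show "trig_approximable Q I (\<lambda>x. F x * complex_of_real (\<psi> n (x i)))" for n
      by (rule trig_approximable_mult_continuous[OF F i]) (auto simp: \<psi>_def intro!: continuous_intros)
    show "norm (F x * complex_of_real (\<psi> n (x i))) \<le> C" for n x
      using mult_mono[OF C[of x], of "\<bar>\<psi> n (x i)\<bar>" 1] C0 by (auto simp: norm_mult \<psi>_def)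
    show "norm (F x * indicator {a<..} (x i)) \<le> C" for x
      using C[of x] C0 by (auto simp: indicator_def)
    show "(\<lambda>n. F x * complex_of_real (\<psi> n (x i))) \<longlonglongrightarrow> F x * indicator {a<..} (x i)" for x
      by (intro tendsto_mult tendsto_const lim)
    show "(\<lambda>x. F x * indicator {a<..} (x i)) \<in> borel_measurable Q"
    proof (rule borel_measurable_times)
      show "F \<in> borel_measurable Q" using F by (simp add: trig_approximable_def)
      show "(\<lambda>x. indicator {a<..} (x i) :: complex) \<in> borel_measurable Q"
        by (rule measurable_compose[OF coordinate_measurable[OF i]]) measurable
    qed
  qed
qed

text \<open>A generating system closed under intersection whose indicators are finite products of
  half-line indicators, so that the approximation reaches them one coordinate at a time.\<close>

definition upper_orthants :: "('i \<Rightarrow> real) set set" where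
  "upper_orthants = {{x \<in> \<Pi>\<^sub>E i\<in>I. UNIV. \<forall>i\<in>J. a i < x i} | J a. finite J \<and> J \<subseteq> I}"

lemma sets_Q_upper_orthants: "sets Q = sigma_sets (\<Pi>\<^sub>E i\<in>I. UNIV) upper_orthants"
proof
  have sub: "upper_orthants \<subseteq> Pow (\<Pi>\<^sub>E i\<in>I. UNIV)" by (auto simp: upper_orthants_def)
  let ?S = "sigma (\<Pi>\<^sub>E i\<in>I. UNIV) upper_orthants"
  have meas: "(\<lambda>x. x i) \<in> borel_measurable ?S" if i: "i \<in> I" for i
  proof (rule borel_measurable_iff_greater[THEN iffD2], rule allI)
    fix b :: real
    have "{x \<in> \<Pi>\<^sub>E i\<in>I. UNIV. b < x i} \<in> upper_orthants"
      unfolding upper_orthants_def by (auto intro!: exI[of _ "{i}"] exI[of _ "\<lambda>_. b"] simp: i)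
    then show "{x \<in> space ?S. b < x i} \<in> sets ?S" using sub by (auto simp: space_measure_of sets_measure_of)
  qed
  have "{f \<in> \<Pi>\<^sub>E i\<in>I. UNIV. f i \<in> A} \<in> sets ?S" if "i \<in> I" "A \<in> sets borel" for i and A :: "real set"
    using measurable_sets[OF meas[OF that(1)] that(2)] sub by (simp add: vimage_def Int_def space_measure_of conj_commute)
  then show "sets Q \<subseteq> sigma_sets (\<Pi>\<^sub>E i\<in>I. UNIV) upper_orthants"
    unfolding sets_Q sets_PiM_single space_borel using sub
    by (intro sigma_sets_mono) (auto simp: sets_measure_of)
  show "sigma_sets (\<Pi>\<^sub>E i\<in>I. UNIV) upper_orthants \<subseteq> sets Q"
  proof -
    have "upper_orthants \<subseteq> sets Q"
    proof
      fix A assume "A \<in> upper_orthants"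
      then obtain J a where J: "finite J" "J \<subseteq> I" "A = {x \<in> space Q. \<forall>i\<in>J. a i < x i}"
        by (auto simp: upper_orthants_def space_Q)
      have "{x \<in> space Q. a i < x i} \<in> sets Q" if "i \<in> J" for i
      proof -
        have [measurable]: "(\<lambda>x. x i) \<in> borel_measurable Q" using coordinate_measurable that J by blast
        show ?thesis by measurable
      qed
      then show "A \<in> sets Q" unfolding J(3) using J(1) by (intro sets.sets_Collect_finite_All) auto
    qed
    then show ?thesis using sets.sigma_sets_subset[of upper_orthants Q] by (simp add: space_Q)
  qed
qed

text \<open>Outside the space of Q nothing contributes to the integrals, but a function built from
  coordinates need not agree with the indicator there.\<close>

lemma trig_approximable_indicator_cong:
  assumes F: "trig_approximable Q I F" and A: "A \<in> sets Q" and eq: "\<And>x. x \<in> space Q \<Longrightarrow> F x = indicator A x"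
  shows "trig_approximable Q I (indicator A)"
  unfolding trig_approximable_def
proof (intro conjI allI impI)
  show "indicator A \<in> borel_measurable Q" using A by (rule borel_measurable_indicator)
  show "\<exists>B. \<forall>x. norm (indicator A x :: complex) \<le> B" by (intro exI[of _ 1]) (auto simp: indicator_def)
  fix e :: real assume "e > 0"
  then obtain q where q: "q \<in> trig_poly I" "(\<integral>x. norm (F x - q x) \<partial>Q) < e"
    using F unfolding trig_approximable_def by blast
  moreover have "(\<integral>x. norm (F x - q x) \<partial>Q) = (\<integral>x. norm (indicator A x - q x) \<partial>Q)"
    by (rule Bochner_Integration.integral_cong) (simp_all add: eq)
  ultimately show "\<exists>q\<in>trig_poly I. (\<integral>x. norm (indicator A x - q x) \<partial>Q) < e" by (intro bexI[of _ q]) simp_all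
qed

text \<open>Dynkin induction: orthants by multiplying half-line indicators, complements by
  linearity, disjoint unions as bounded pointwise limits of partial sums.\<close>

lemma trig_approximable_indicator:
  assumes "C \<in> sets Q"
  shows "trig_approximable Q I (indicator C)"
proof -
  have "Int_stable upper_orthants"
  proof (rule Int_stableI)
    fix A B assume "A \<in> upper_orthants" "B \<in> upper_orthants"
    then obtain J a K b where J: "finite J" "J \<subseteq> I" "A = {x \<in> \<Pi>\<^sub>E i\<in>I. UNIV. \<forall>i\<in>J. a i < x i}"
      and K: "finite K" "K \<subseteq> I" "B = {x \<in> \<Pi>\<^sub>E i\<in>I. UNIV. \<forall>i\<in>K. b i < x i}"
      unfolding upper_orthants_def by blast
    \<comment> \<open>On a common coordinate the larger of the two bounds counts, elsewhere the only
      bound present.\<close>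
    let ?c = "\<lambda>i. if i \<in> J then if i \<in> K then max (a i) (b i) else a i else b i"
    have "A \<inter> B = {x \<in> \<Pi>\<^sub>E i\<in>I. UNIV. \<forall>i\<in>J \<union> K. ?c i < x i}"
      unfolding J(3) K(3) by (auto split: if_splits)
    then show "A \<inter> B \<in> upper_orthants"
      unfolding upper_orthants_def using J K by (intro CollectI exI[of _ "J \<union> K"] exI[of _ ?c]) auto
  qed
  moreover have "upper_orthants \<subseteq> Pow (\<Pi>\<^sub>E i\<in>I. UNIV)" by (auto simp: upper_orthants_def)
  moreover have "C \<in> sigma_sets (\<Pi>\<^sub>E i\<in>I. UNIV) upper_orthants" using assms sets_Q_upper_orthants by simp
  ultimately show ?thesis
  proof (induction rule: sigma_sets_induct_disjoint)
    case (basic A)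
    then obtain J a where J: "finite J" "J \<subseteq> I" "A = {x \<in> space Q. \<forall>i\<in>J. a i < x i}"
      unfolding upper_orthants_def space_Q by blast
    have "trig_approximable Q I (\<lambda>x. \<Prod>i\<in>J. indicator {a i<..} (x i))"
      using J(1,2)
    proof (induction J rule: finite_induct)
      case empty
      show ?case using trig_approximable_trig_poly[OF trig_poly_const[of 1]] by simp
    next
      case (insert j J)
      then show ?case using trig_approximable_mult_halfline[of "\<lambda>x. \<Prod>i\<in>J. indicator {a i<..} (x i)" j "a j"]
        by (simp add: mult.commute[of "indicator {a j<..} _"])
    qed
    moreover have "(\<Prod>i\<in>J. indicator {a i<..} (x i)) = (indicator A x :: complex)" if "x \<in> space Q" for x
      using that J(1) by (auto simp: J(3) indicator_def prod_zero_iff not_less)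
    ultimately have *: "trig_approximable Q I (\<lambda>x. \<Prod>i\<in>J. indicator {a i<..} (x i))"
      and eq: "\<And>x. x \<in> space Q \<Longrightarrow> (\<Prod>i\<in>J. indicator {a i<..} (x i)) = (indicator A x :: complex)" by auto
    have A [measurable]: "A \<in> sets Q" using basic sets_Q_upper_orthants by auto
    show ?case
      using * A eq by (rule trig_approximable_indicator_cong)
  next
    case empty
    show ?case using trig_approximable_trig_poly[OF trig_poly_const[of 0]] by (simp add: indicator_def)
  next
    case (compl A)
    have A [measurable]: "A \<in> sets Q" using compl sets_Q_upper_orthants by auto
    have "trig_approximable Q I (\<lambda>x. 1 + indicator A x * (-1))"
      by (intro trig_approximable_add trig_approximable_mult trig_approximable_trig_poly trig_poly_const compl)
    moreover have "(\<Pi>\<^sub>E i\<in>I. UNIV) - A \<in> sets Q" using sets.compl_sets[OF A] by (simp add: space_Q)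
    moreover have "(1 + indicator A x * (-1)) = (indicator ((\<Pi>\<^sub>E i\<in>I. UNIV) - A) x :: complex)" if "x \<in> space Q" for x
      using that by (auto simp: indicator_def space_Q)
    ultimately show ?case by (rule trig_approximable_indicator_cong)
  next
    case (union A)
    have A [measurable]: "A i \<in> sets Q" for i using union sets_Q_upper_orthants by auto
    have ap: "trig_approximable Q I (\<lambda>x. \<Sum>i<n. indicator (A i) x)" for n
    proof (induction n)
      case 0
      show ?case using trig_approximable_trig_poly[OF trig_poly_const[of 0]] by simp
    next
      case (Suc n)
      then show ?case using trig_approximable_add[OF Suc union(3)] by simp
    qed
    have eq: "(\<Sum>i<n. indicator (A i) x) = (indicator (\<Union>i<n. A i) x :: complex)" for n x
      by (rule indicator_UN_disjoint[symmetric]) (use union(1) in \<open>auto simp: disjoint_family_on_def\<close>)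
    have lim: "(\<lambda>n. indicator (\<Union>i<n. A i) x :: complex) \<longlonglongrightarrow> indicator (\<Union>i. A i) x" for x
      by (rule LIMSEQ_indicator_UN)
    show ?case
    proof (rule trig_approximable_limit[where B = 1 and F = "\<lambda>n. indicator (\<Union>i<n. A i)", OF _ _ lim])
      show "norm (indicator B x :: complex) \<le> 1" for B and x :: "'i \<Rightarrow> real" by (simp add: indicator_def)
      then show "norm (indicator B x :: complex) \<le> 1" for B and x :: "'i \<Rightarrow> real" .
      show "trig_approximable Q I (indicator (\<Union>i<n. A i))" for n using ap[of n] unfolding eq .
    qed measurable
  qed
qed

text \<open>Convergence passes from characters to trigonometric polynomials by linearity and to
  indicators by approximation in L1(Q). Since every \<open>Z n\<close> has the same law Q, the
  approximation error does not depend on n; hence arbitrary events are reached and not only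
  continuity sets.\<close>

lemma independence_limit:
  fixes P :: "'w measure"
  assumes P: "prob_space P" and Y: "Y \<in> measurable P Q" and Z: "\<And>n :: nat. Z n \<in> measurable P Q"
    and dY: "distr P Q Y = Q" and dZ: "\<And>n. distr P Q (Z n) = Q"
    and char: "\<And>J K \<theta> \<eta>. finite J \<Longrightarrow> J \<subseteq> I \<Longrightarrow> finite K \<Longrightarrow> K \<subseteq> I \<Longrightarrow>
       (\<lambda>n. \<integral>\<omega>. cis (\<Sum>s\<in>J. \<theta> s * Y \<omega> s) * cis (\<Sum>s\<in>K. \<eta> s * Z n \<omega> s) \<partial>P)
         \<longlonglongrightarrow> (\<integral>x. cis (\<Sum>s\<in>J. \<theta> s * x s) \<partial>Q) * (\<integral>x. cis (\<Sum>s\<in>K. \<eta> s * x s) \<partial>Q)"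
    and C: "C \<in> sets Q" and D: "D \<in> sets Q"
  shows "(\<lambda>n. measure P {\<omega> \<in> space P. Y \<omega> \<in> C \<and> Z n \<omega> \<in> D}) \<longlonglongrightarrow> measure Q C * measure Q D"
proof -
  interpret P: prob_space P by fact
  note [measurable] = Y Z C D
  have int_P: "integrable P (\<lambda>\<omega>. F \<omega>)" if "F \<in> borel_measurable P" "\<And>\<omega>. norm (F \<omega>) \<le> B" for F :: "'w \<Rightarrow> complex" and B
    by (rule P.integrable_const_bound[of _ B]) (use that in auto)
  have int_pq: "integrable P (\<lambda>\<omega>. p (Y \<omega>) * q (Z n \<omega>))" if p: "p \<in> trig_poly I" and q: "q \<in> trig_poly I" for p q n
  proof -
    obtain A B where "A > 0" "\<And>x. norm (p x) \<le> A" "B > 0" "\<And>x. norm (q x) \<le> B"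
      using trig_poly_bounded[OF p] trig_poly_bounded[OF q] by metis
    then show ?thesis using trig_poly_Q[OF p] trig_poly_Q[OF q]
      by (intro int_P[of _ "A * B"]) (auto simp: norm_mult intro!: mult_mono intro: less_imp_le)
  qed
  have main: "(\<lambda>n. \<integral>\<omega>. p (Y \<omega>) * q (Z n \<omega>) \<partial>P) \<longlonglongrightarrow> (\<integral>x. p x \<partial>Q) * (\<integral>x. q x \<partial>Q)"
    if p: "p \<in> trig_poly I" and q: "q \<in> trig_poly I" for p q
    using p
  proof induction
    case (char J \<theta>)
    note J = char
    have cJ: "(\<lambda>x. cis (\<Sum>s\<in>J. \<theta> s * x s)) \<in> trig_poly I" using J by (rule trig_poly.char)
    show ?case using q
    proof induction
      case (char K \<eta>)
      then show ?case using assms(6) J by blast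
    next
      case (add p q)
      note i = int_pq[OF cJ add.hyps(1)] int_pq[OF cJ add.hyps(2)]
      show ?case using tendsto_add[OF add.IH] integrable_trig_poly[OF add.hyps(1)] integrable_trig_poly[OF add.hyps(2)] i
        by (simp add: distrib_left)
    next
      case (scale p a)
      show ?case using tendsto_mult[OF tendsto_const[of a] scale.IH] by (simp add: mult.left_commute)
    qed
  next
    case (add p' q')
    note i = int_pq[OF add.hyps(1) q] int_pq[OF add.hyps(2) q]
    show ?case using tendsto_add[OF add.IH] integrable_trig_poly[OF add.hyps(1)] integrable_trig_poly[OF add.hyps(2)] i
      by (simp add: distrib_right)
  next
    case (scale p a)
    show ?case using tendsto_mult[OF tendsto_const[of a] scale.IH] by (simp add: mult.assoc)
  qed
  have tr: "(\<integral>\<omega>. g (V \<omega>) \<partial>P) = (\<integral>x. g x \<partial>Q)" if "V \<in> measurable P Q" "distr P Q V = Q" "g \<in> borel_measurable Q"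
    for V and g :: "_ \<Rightarrow> real"
    using integral_distr[OF that(1,3)] that(2) by simp
  show ?thesis
  proof (rule tendstoI)
    fix e :: real assume e: "e > 0"
    obtain p where p: "p \<in> trig_poly I" "(\<integral>x. norm (indicator C x - p x) \<partial>Q) < e / 6"
      using trig_approximable_indicator[OF C] e unfolding trig_approximable_def by (meson divide_pos_pos zero_less_numeral)
    obtain B where B: "B > 0" "\<And>x. norm (p x) \<le> B" using trig_poly_bounded[OF p(1)] by blast
    \<comment> \<open>The approximant of D must be finer by the factor B: the error is split as (c -
      p) d + p (d - q), and p is bounded only by B.\<close>
    obtain q where q: "q \<in> trig_poly I" "(\<integral>x. norm (indicator D x - q x) \<partial>Q) < e / 6 / B"
      using trig_approximable_indicator[OF D] e B(1) unfolding trig_approximable_def by (meson divide_pos_pos zero_less_numeral)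
    obtain B' where B': "B' > 0" "\<And>x. norm (q x) \<le> B'" using trig_poly_bounded[OF q(1)] by blast
    note [measurable] = trig_poly_Q[OF p(1)] trig_poly_Q[OF q(1)]
    let ?c = "indicator C :: _ \<Rightarrow> complex" and ?d = "indicator D :: _ \<Rightarrow> complex"
    have e1: "norm ((\<integral>\<omega>. ?c (Y \<omega>) * ?d (Z n \<omega>) \<partial>P) - (\<integral>\<omega>. p (Y \<omega>) * q (Z n \<omega>) \<partial>P)) \<le> e / 3" for n
    proof -
      have ic: "integrable P (\<lambda>\<omega>. ?c (Y \<omega>) * ?d (Z n \<omega>))"
        by (rule int_P[of _ 1]) (auto simp: indicator_def)
      have i1: "integrable P (\<lambda>\<omega>. norm (?c (Y \<omega>) - p (Y \<omega>)))"
        by (intro integrable_norm Bochner_Integration.integrable_diff int_P[of _ 1] int_P[of _ B])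
          (auto simp: B indicator_def)
      have i2: "integrable P (\<lambda>\<omega>. norm (?d (Z n \<omega>) - q (Z n \<omega>)))"
        by (intro integrable_norm Bochner_Integration.integrable_diff int_P[of _ 1] int_P[of _ B'])
          (auto simp: B' indicator_def)
      have "norm ((\<integral>\<omega>. ?c (Y \<omega>) * ?d (Z n \<omega>) \<partial>P) - (\<integral>\<omega>. p (Y \<omega>) * q (Z n \<omega>) \<partial>P))
          = norm (\<integral>\<omega>. ?c (Y \<omega>) * ?d (Z n \<omega>) - p (Y \<omega>) * q (Z n \<omega>) \<partial>P)"
        by (subst Bochner_Integration.integral_diff[OF ic int_pq[OF p(1) q(1)]]) simp
      also have "\<dots> \<le> (\<integral>\<omega>. norm (?c (Y \<omega>) * ?d (Z n \<omega>) - p (Y \<omega>) * q (Z n \<omega>)) \<partial>P)"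
        by (rule integral_norm_bound)
      also have "\<dots> \<le> (\<integral>\<omega>. norm (?c (Y \<omega>) - p (Y \<omega>)) + B * norm (?d (Z n \<omega>) - q (Z n \<omega>)) \<partial>P)"
      proof (rule integral_mono)
        show "integrable P (\<lambda>\<omega>. norm (?c (Y \<omega>) * ?d (Z n \<omega>) - p (Y \<omega>) * q (Z n \<omega>)))"
          by (intro integrable_norm Bochner_Integration.integrable_diff ic int_pq p q)
        show "integrable P (\<lambda>\<omega>. norm (?c (Y \<omega>) - p (Y \<omega>)) + B * norm (?d (Z n \<omega>) - q (Z n \<omega>)))"
          using i1 i2 by auto
        fix \<omega>
        have "?c (Y \<omega>) * ?d (Z n \<omega>) - p (Y \<omega>) * q (Z n \<omega>)
            = (?c (Y \<omega>) - p (Y \<omega>)) * ?d (Z n \<omega>) + p (Y \<omega>) * (?d (Z n \<omega>) - q (Z n \<omega>))"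
          by (simp add: algebra_simps)
        also have "norm \<dots> \<le> norm (?c (Y \<omega>) - p (Y \<omega>)) * norm (?d (Z n \<omega>)) + norm (p (Y \<omega>)) * norm (?d (Z n \<omega>) - q (Z n \<omega>))"
          unfolding norm_mult[symmetric] by (rule norm_triangle_ineq)
        also have "\<dots> \<le> norm (?c (Y \<omega>) - p (Y \<omega>)) * 1 + B * norm (?d (Z n \<omega>) - q (Z n \<omega>))"
          by (intro add_mono mult_left_mono mult_right_mono B) (auto simp: indicator_def)
        finally show "norm (?c (Y \<omega>) * ?d (Z n \<omega>) - p (Y \<omega>) * q (Z n \<omega>))
          \<le> norm (?c (Y \<omega>) - p (Y \<omega>)) + B * norm (?d (Z n \<omega>) - q (Z n \<omega>))" by simp
      qed
      also have "\<dots> = (\<integral>\<omega>. norm (?c (Y \<omega>) - p (Y \<omega>)) \<partial>P) + B * (\<integral>\<omega>. norm (?d (Z n \<omega>) - q (Z n \<omega>)) \<partial>P)"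
        using i1 i2 by simp
      also have "\<dots> = (\<integral>x. norm (?c x - p x) \<partial>Q) + B * (\<integral>x. norm (?d x - q x) \<partial>Q)"
        using tr[OF Y dY, of "\<lambda>x. norm (?c x - p x)"] tr[OF Z dZ, of "\<lambda>x. norm (?d x - q x)" n] by simp
      also have "\<dots> \<le> e / 6 + B * (e / 6 / B)"
        using p(2) q(2) B(1) by (intro add_mono mult_left_mono) auto
      also have "\<dots> = e / 3" using B(1) by simp
      finally show ?thesis .
    qed
    have e2: "norm ((\<integral>x. ?c x \<partial>Q) * (\<integral>x. ?d x \<partial>Q) - (\<integral>x. p x \<partial>Q) * (\<integral>x. q x \<partial>Q)) \<le> e / 3"
    proof -
      have i: "integrable Q ?c" "integrable Q ?d" by (auto intro!: integrable_bounded[of _ 1] simp: indicator_def)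
      note ip = integrable_trig_poly[OF p(1)] integrable_trig_poly[OF q(1)]
      have d1: "norm ((\<integral>x. ?c x \<partial>Q) - (\<integral>x. p x \<partial>Q)) \<le> e / 6"
        using integral_norm_bound[of Q "\<lambda>x. ?c x - p x"] p(2) i ip by simp
      have d2: "norm ((\<integral>x. ?d x \<partial>Q) - (\<integral>x. q x \<partial>Q)) \<le> e / 6 / B"
        using integral_norm_bound[of Q "\<lambda>x. ?d x - q x"] q(2) i ip by simp
      have d3: "norm (\<integral>x. p x \<partial>Q) \<le> B"
      proof -
        have "norm (\<integral>x. p x \<partial>Q) \<le> (\<integral>x. norm (p x) \<partial>Q)" by (rule integral_norm_bound)
        also have "\<dots> \<le> (\<integral>x. B \<partial>Q)" using ip B by (intro integral_mono) auto
        finally show ?thesis by (simp add: prob_space)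
      qed
      have d4: "norm (\<integral>x. ?d x \<partial>Q) \<le> 1"
      proof -
        have "norm (\<integral>x. ?d x \<partial>Q) \<le> (\<integral>x. norm (?d x) \<partial>Q)" by (rule integral_norm_bound)
        also have "\<dots> \<le> (\<integral>x. 1 \<partial>Q)" by (intro integral_mono integrable_norm i(2)) (auto simp: indicator_def)
        finally show ?thesis by (simp add: prob_space)
      qed
      have "(\<integral>x. ?c x \<partial>Q) * (\<integral>x. ?d x \<partial>Q) - (\<integral>x. p x \<partial>Q) * (\<integral>x. q x \<partial>Q)
        = ((\<integral>x. ?c x \<partial>Q) - (\<integral>x. p x \<partial>Q)) * (\<integral>x. ?d x \<partial>Q) + (\<integral>x. p x \<partial>Q) * ((\<integral>x. ?d x \<partial>Q) - (\<integral>x. q x \<partial>Q))"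
        by (simp add: algebra_simps)
      also have "norm \<dots> \<le> norm ((\<integral>x. ?c x \<partial>Q) - (\<integral>x. p x \<partial>Q)) * norm (\<integral>x. ?d x \<partial>Q) + norm (\<integral>x. p x \<partial>Q) * norm ((\<integral>x. ?d x \<partial>Q) - (\<integral>x. q x \<partial>Q))"
        unfolding norm_mult[symmetric] by (rule norm_triangle_ineq)
      also have "\<dots> \<le> e / 6 * 1 + B * (e / 6 / B)"
        using e B(1) by (intro add_mono mult_mono d1 d2 d3 d4) auto
      also have "\<dots> = e / 3" using B(1) by simp
      finally show ?thesis .
    qed
    have eqP: "(\<integral>\<omega>. ?c (Y \<omega>) * ?d (Z n \<omega>) \<partial>P) = of_real (measure P {\<omega> \<in> space P. Y \<omega> \<in> C \<and> Z n \<omega> \<in> D})" for n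
    proof -
      have "(\<integral>\<omega>. ?c (Y \<omega>) * ?d (Z n \<omega>) \<partial>P) = (\<integral>\<omega>. indicator {\<omega> \<in> space P. Y \<omega> \<in> C \<and> Z n \<omega> \<in> D} \<omega> \<partial>P)"
        by (rule Bochner_Integration.integral_cong) (auto simp: indicator_def)
      also have "\<dots> = of_real (measure P ({\<omega> \<in> space P. Y \<omega> \<in> C \<and> Z n \<omega> \<in> D} \<inter> space P))"
        by (rule integral_indicator_complex)
      finally show ?thesis by (simp add: Int_def conj_ac)
    qed
    have eqQ: "(\<integral>x. ?c x \<partial>Q) * (\<integral>x. ?d x \<partial>Q) = of_real (measure Q C * measure Q D)"
      using sets.sets_into_space[OF C] sets.sets_into_space[OF D] by (simp add: Int_absorb2 integral_indicator_complex)
    have "eventually (\<lambda>n. dist (\<integral>\<omega>. p (Y \<omega>) * q (Z n \<omega>) \<partial>P) ((\<integral>x. p x \<partial>Q) * (\<integral>x. q x \<partial>Q)) < e / 3) sequentially"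
      using main[OF p(1) q(1)] e by (intro tendstoD) auto
    then show "eventually (\<lambda>n. dist (measure P {\<omega> \<in> space P. Y \<omega> \<in> C \<and> Z n \<omega> \<in> D}) (measure Q C * measure Q D) < e) sequentially"
    proof eventually_elim
      case (elim n)
      let ?a = "\<integral>\<omega>. ?c (Y \<omega>) * ?d (Z n \<omega>) \<partial>P" and ?b = "\<integral>\<omega>. p (Y \<omega>) * q (Z n \<omega>) \<partial>P"
        and ?a' = "(\<integral>x. ?c x \<partial>Q) * (\<integral>x. ?d x \<partial>Q)" and ?b' = "(\<integral>x. p x \<partial>Q) * (\<integral>x. q x \<partial>Q)"
      have "norm (?a - ?a') < e"
        using e1[of n] e2 elim norm_triangle_ineq[of "?a - ?b" "?b - ?b'"] norm_triangle_ineq4[of "?a - ?b'" "?a' - ?b'"]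
        by (simp add: dist_norm)
      then show ?case unfolding eqP eqQ by (simp add: dist_real_def flip: of_real_diff of_real_mult)
    qed
  qed
qed

end

section \<open>Inequalities\<close>

text \<open>Write the power as x + y times (x + y)^(p - 1) and use that the exponent p - 1 is not
  positive. The factor r records how far x + y exceeds y: r = 1 gives subadditivity, while r = 2,
  available when y is at most x, gives the strict gain behind the parallelogram defect.\<close>

lemma powr_add_le_scaled:
  fixes x y p r :: real
  assumes "0 < p" "p \<le> 1" "0 \<le> x" "0 < y" "0 < r" "r * y \<le> x + y" 
  shows "(x + y) powr p \<le> x powr p + r powr (p - 1) * y powr p"
proof -
  have "(x + y) powr p = (x + y) * (x + y) powr (p - 1)"
    using assms by (simp add: powr_mult_base)
  also have "\<dots> = x * (x + y) powr (p - 1) + y * (x + y) powr (p - 1)" by (simp add: distrib_right)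
  also have "\<dots> \<le> x powr p + y * (r * y) powr (p - 1)"
  proof (rule add_mono)
    show "x * (x + y) powr (p - 1) \<le> x powr p"
    proof (cases "x = 0")
      case False
      then have "x * (x + y) powr (p - 1) \<le> x * x powr (p - 1)"
        using assms by (intro mult_left_mono powr_mono2') auto
      then show ?thesis using assms by (simp add: powr_mult_base)
    qed simp
    show "y * (x + y) powr (p - 1) \<le> y * (r * y) powr (p - 1)"
      using assms by (intro mult_left_mono powr_mono2') auto
  qed
  also have "y * (r * y) powr (p - 1) = r powr (p - 1) * y powr p"
    using assms by (simp add: powr_mult mult.left_commute powr_mult_base)
  finally show ?thesis .
qed

lemma powr_add_le:
  fixes x y p :: real
  assumes "0 < p" "p \<le> 1" "0 \<le> x" "0 \<le> y"
  shows "(x + y) powr p \<le> x powr p + y powr p"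
proof (cases "y = 0")
  case False
  then show ?thesis using powr_add_le_scaled[of p x y 1] assms by simp
qed simp

lemma abs_add_powr_le:
  fixes a b p :: real
  assumes "0 < p" "p \<le> 1"
  shows "\<bar>a + b\<bar> powr p \<le> \<bar>a\<bar> powr p + \<bar>b\<bar> powr p"
proof -
  have "\<bar>a + b\<bar> powr p \<le> (\<bar>a\<bar> + \<bar>b\<bar>) powr p" using assms by (intro powr_mono2) auto
  also have "\<dots> \<le> \<bar>a\<bar> powr p + \<bar>b\<bar> powr p" using assms by (intro powr_add_le) auto
  finally show ?thesis .
qed

lemma abs_powr_diff_le:
  fixes a b p :: real
  assumes "0 < p" "p \<le> 1"
  shows "\<bar>\<bar>a\<bar> powr p - \<bar>b\<bar> powr p\<bar> \<le> \<bar>a - b\<bar> powr p"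
  using abs_add_powr_le[OF assms, of "a - b" b] abs_add_powr_le[OF assms, of "b - a" a]
  unfolding abs_le_iff[of "_ - _"] by (auto simp: abs_minus_commute)

lemma abs_sum_powr_le:
  fixes a :: "'k \<Rightarrow> real"
  assumes "0 < p" "p \<le> 1"
  shows "\<bar>\<Sum>k\<in>A. a k\<bar> powr p \<le> (\<Sum>k\<in>A. \<bar>a k\<bar> powr p)"
proof (induction A rule: infinite_finite_induct)
  case (insert k A)
  then show ?case using abs_add_powr_le[OF assms, of "a k" "sum a A"] by simp
qed (use assms in auto)

lemma abs_powr_half_square:
  fixes a \<alpha> :: real
  shows "(\<bar>a\<bar> powr (\<alpha> / 2))\<^sup>2 = \<bar>a\<bar> powr \<alpha>"
  by (simp add: power2_eq_square flip: powr_add)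

text \<open>Let S, A, B be the half powers of the sum and of the two terms. Subadditivity gives |S -
  A| \<le> B and S \<le> A + B. If B \<le> A, then S + A \<le> 3A, so the difference of squares
  costs 3AB and B^2 costs another AB: this is the constant 4.\<close>

lemma abs_add_powr_defect:
  fixes a b \<alpha> :: real
  assumes "0 < \<alpha>" "\<alpha> < 2"
  shows "\<bar>\<bar>a + b\<bar> powr \<alpha> - \<bar>a\<bar> powr \<alpha> - \<bar>b\<bar> powr \<alpha>\<bar> \<le> 4 * (\<bar>a\<bar> powr (\<alpha>/2) * \<bar>b\<bar> powr (\<alpha>/2))"
proof -
  have p: "0 < \<alpha>/2" "\<alpha>/2 \<le> 1" using assms by auto
  have *: "\<bar>S\<^sup>2 - A\<^sup>2 - B\<^sup>2\<bar> \<le> 4 * (A * B)"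
    if "\<bar>S - A\<bar> \<le> B" "S \<le> A + B" "B \<le> A" "0 \<le> B" "0 \<le> S" for S A B :: real
  proof -
    have "S\<^sup>2 - A\<^sup>2 = (S - A) * (S + A)" by (simp add: power2_eq_square algebra_simps)
    then have "\<bar>S\<^sup>2 - A\<^sup>2\<bar> = \<bar>S - A\<bar> * (S + A)" using that by (simp add: abs_mult)
    also have "\<dots> \<le> B * (3 * A)" using that by (intro mult_mono) auto
    finally have "\<bar>S\<^sup>2 - A\<^sup>2\<bar> \<le> 3 * (A * B)" by (simp add: algebra_simps)
    moreover have "B\<^sup>2 \<le> A * B" "0 \<le> B\<^sup>2" using that by (auto simp: power2_eq_square intro: mult_right_mono)
    ultimately show ?thesis by linarith
  qed
  let ?S = "\<bar>a + b\<bar> powr (\<alpha>/2)" and ?A = "\<bar>a\<bar> powr (\<alpha>/2)" and ?B = "\<bar>b\<bar> powr (\<alpha>/2)"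
  have d: "\<bar>?S - ?A\<bar> \<le> ?B" "\<bar>?S - ?B\<bar> \<le> ?A" "?S \<le> ?A + ?B"
    using abs_powr_diff_le[OF p, of "a + b" a] abs_powr_diff_le[OF p, of "a + b" b] abs_add_powr_le[OF p, of a b]
    by simp_all
  have "\<bar>?S\<^sup>2 - ?A\<^sup>2 - ?B\<^sup>2\<bar> \<le> 4 * (?A * ?B)"
  proof (cases "?B \<le> ?A")
    case True
    then show ?thesis by (rule *[OF d(1,3)]) simp_all
  next
    case False
    then have "?A \<le> ?B" by simp
    from *[OF d(2) _ this] d(3) have "\<bar>?S\<^sup>2 - ?B\<^sup>2 - ?A\<^sup>2\<bar> \<le> 4 * (?B * ?A)" by (simp only: add.commute powr_ge_zero)
    then show ?thesis by (simp only: mult.commute[of ?B ?A] diff_diff_eq add.commute[of "?B\<^sup>2"])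
  qed
  then show ?thesis by (simp only: abs_powr_half_square)
qed

text \<open>The weighted inequality of arithmetic and geometric means against the midpoint m, that
  is, the tangent bound at m: z^p m^(1-p) \<le> p z + (1-p) m. Adding it for z = x and z = y leaves
  2m on the right.\<close>

lemma powr_midpoint_concave:
  fixes x y p :: real
  assumes "0 < p" "p < 1" "0 \<le> x" "0 \<le> y"
  shows "x powr p + y powr p \<le> 2 * ((x + y) / 2) powr p"
proof (cases "x + y = 0")
  case True
  then show ?thesis using assms by (simp add: add_nonneg_eq_0_iff)
next
  case False
  define m where "m = (x + y) / 2"
  have m: "m > 0" using False assms by (auto simp: m_def)
  have *: "z powr p * m powr (1 - p) \<le> p * z + (1 - p) * m" if "z \<ge> 0" for z
  proof (cases "z = 0")
    case False
    then show ?thesis using Youngs_inequality_0[of p "1 - p" z m] assms m that by simp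
  qed (use assms m in auto)
  have "(x powr p + y powr p) * m powr (1 - p) \<le> p * (x + y) + 2 * (1 - p) * m"
    using *[OF assms(3)] *[OF assms(4)] by (simp add: algebra_simps)
  also have "\<dots> = 2 * m" by (simp add: m_def field_simps)
  also have "\<dots> = (2 * m powr p) * m powr (1 - p)" using m by (simp flip: powr_add)
  finally show ?thesis using m by (simp add: m_def)
qed

text \<open>With p = \<alpha>/2, concavity of the p-th power turns the parallelogram law for squares
  into a bound of the last two terms by 2 (a^2 + b^2)^p, and \<open>powr_add_le_scaled\<close> with
  r = 2 produces the minimum. The factor is positive because \<alpha> < 2; at \<alpha> = 2 the
  parallelogram law is an equality and nothing is gained.\<close>

lemma abs_powr_parallelogram_defect:
  fixes a b \<alpha> :: real
  assumes "0 < \<alpha>" "\<alpha> < 2"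
  shows "2 * (1 - 2 powr (\<alpha>/2 - 1)) * min (\<bar>a\<bar> powr \<alpha>) (\<bar>b\<bar> powr \<alpha>)
     \<le> 2 * \<bar>a\<bar> powr \<alpha> + 2 * \<bar>b\<bar> powr \<alpha> - \<bar>a + b\<bar> powr \<alpha> - \<bar>a - b\<bar> powr \<alpha>"
proof -
  define p where "p = \<alpha> / 2"
  have p: "0 < p" "p < 1" using assms by (auto simp: p_def)
  have sq: "\<bar>x\<bar> powr \<alpha> = (x\<^sup>2) powr p" for x :: real
  proof -
    have "(x\<^sup>2) powr p = (\<bar>x\<bar> powr 2) powr p" by (simp add: powr_numeral)
    also have "\<dots> = \<bar>x\<bar> powr \<alpha>" unfolding powr_powr p_def by simp
    finally show ?thesis by simp
  qed
  have conc: "(A + B) powr p \<le> A powr p + B powr p - (1 - 2 powr (p - 1)) * min (A powr p) (B powr p)"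
    if "0 \<le> A" "0 \<le> B" for A B :: real
  proof -
    have **: "(A + B) powr p \<le> A powr p + B powr p - (1 - 2 powr (p - 1)) * B powr p" if "0 \<le> B" "B \<le> A" for A B :: real
    proof (cases "B = 0")
      case False
      then show ?thesis using powr_add_le_scaled[of p A B 2] p that by (simp add: algebra_simps)
    qed (use that in auto)
    show ?thesis
    proof (cases "B \<le> A")
      case True
      then have "B powr p \<le> A powr p" using that p by (intro powr_mono2) auto
      then show ?thesis using **[OF that(2) True] by (simp add: min_def)
    next
      case False
      then have "A powr p \<le> B powr p" using that p by (intro powr_mono2) auto
      then show ?thesis using **[OF that(1), of B] False by (simp add: min_def add.commute)
    qed
  qed
  have "((a + b)\<^sup>2) powr p + ((a - b)\<^sup>2) powr p \<le> 2 * (((a + b)\<^sup>2 + (a - b)\<^sup>2) / 2) powr p"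
    by (rule powr_midpoint_concave[OF p]) auto
  also have "((a + b)\<^sup>2 + (a - b)\<^sup>2) / 2 = a\<^sup>2 + b\<^sup>2" by (simp add: power2_eq_square algebra_simps)
  finally show ?thesis using conc[of "a\<^sup>2" "b\<^sup>2"] unfolding sq p_def[symmetric] by (simp add: algebra_simps)
qed

lemma cauchy_schwarz_integral:
  fixes f g :: "'s \<Rightarrow> real"
  assumes [measurable]: "f \<in> borel_measurable M" "g \<in> borel_measurable M"
    and f: "integrable M (\<lambda>x. (f x)\<^sup>2)" and g: "integrable M (\<lambda>x. (g x)\<^sup>2)"
  shows "integrable M (\<lambda>x. f x * g x)"
    and "\<bar>\<integral>x. f x * g x \<partial>M\<bar> \<le> sqrt (\<integral>x. (f x)\<^sup>2 \<partial>M) * sqrt (\<integral>x. (g x)\<^sup>2 \<partial>M)"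
proof -
  show fg: "integrable M (\<lambda>x. f x * g x)"
  proof (rule Bochner_Integration.integrable_bound)
    show "integrable M (\<lambda>x. (f x)\<^sup>2 + (g x)\<^sup>2)" using f g by simp
    have "\<bar>a * b\<bar> \<le> a\<^sup>2 + b\<^sup>2" for a b :: real
      using sum_squares_bound[of "\<bar>a\<bar>" "\<bar>b\<bar>"] mult_nonneg_nonneg[of "\<bar>a\<bar>" "\<bar>b\<bar>"]
      unfolding abs_mult power2_abs by linarith
    then show "AE x in M. norm (f x * g x) \<le> norm ((f x)\<^sup>2 + (g x)\<^sup>2)" by (intro AE_I2) simp
  qed simp
  let ?F = "\<integral>x. (f x)\<^sup>2 \<partial>M" and ?G = "\<integral>x. (g x)\<^sup>2 \<partial>M" and ?S = "\<integral>x. f x * g x \<partial>M"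
  have q: "0 \<le> ?F - 2 * r * ?S + r\<^sup>2 * ?G" for r
  proof -
    have "0 \<le> (\<integral>x. (f x - r * g x)\<^sup>2 \<partial>M)" by simp
    also have "(\<integral>x. (f x - r * g x)\<^sup>2 \<partial>M) = (\<integral>x. (f x)\<^sup>2 - 2 * r * (f x * g x) + r\<^sup>2 * (g x)\<^sup>2 \<partial>M)"
      by (simp add: power2_eq_square algebra_simps)
    also have "\<dots> = ?F - 2 * r * ?S + r\<^sup>2 * ?G" using f g fg by simp
    finally show ?thesis .
  qed
  have "?S\<^sup>2 \<le> ?F * ?G"
  proof (cases "?G = 0")
    case True
    have "?S = 0"
    proof (rule ccontr)
      assume "?S \<noteq> 0"
      \<comment> \<open>If g has norm zero the quadratic is affine in r, and this r gives it the
        value -1.\<close>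
      then show False using q[of "(?F + 1) / (2 * ?S)"] True by simp
    qed
    then show ?thesis using True by simp
  next
    case False
    then have "?G > 0" by (simp add: order_less_le)
    then show ?thesis using q[of "?S / ?G"] by (simp add: field_simps power2_eq_square)
  qed
  then have "sqrt (?S\<^sup>2) \<le> sqrt (?F * ?G)" by (rule real_sqrt_le_mono)
  then show "\<bar>?S\<bar> \<le> sqrt ?F * sqrt ?G" by (simp add: real_sqrt_mult)
qed

section \<open>The spectral kernel\<close>

locale sas_field = nonsingular_flow \<mu> tc \<phi> + P: prob_space P
  for \<mu> :: "'s measure" and tc :: tcase and \<phi> :: "real ^ 'd \<Rightarrow> 's \<Rightarrow> 's" and P :: "'w measure" +
  fixes \<alpha> :: real and X :: "real ^ 'd \<Rightarrow> 'w \<Rightarrow> real" and f c :: "real ^ 'd \<Rightarrow> 's \<Rightarrow> real"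
  assumes alpha: "0 < \<alpha>" "\<alpha> < 2"
    and field_measurable: "measurable_field P tc X"
    and stationary: "stationary_field P tc X"
    and spectral: "sas_spectral_rep \<alpha> P tc X \<mu> f"
    and minimal: "minimal_rep tc \<mu> f"
    and cocycle: "sign_cocycle tc \<mu> \<phi> c"
    and form: "action_form \<alpha> tc \<mu> \<phi> c f"
begin

lemma X_measurable [measurable]: "t \<in> index_set tc \<Longrightarrow> X t \<in> borel_measurable P"
  using field_measurable by (simp add: measurable_field_def)

lemma f_measurable [measurable]: "t \<in> index_set tc \<Longrightarrow> f t \<in> borel_measurable \<mu>"
  using spectral by (simp add: sas_spectral_rep_def)

lemma f_integrable: "t \<in> index_set tc \<Longrightarrow> integrable \<mu> (\<lambda>x. \<bar>f t x\<bar> powr \<alpha>)"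
  using spectral by (simp add: sas_spectral_rep_def)

text \<open>Times are given as a family, possibly with repetitions, and coefficients of equal times
  are collected. Repetitions occur when a finite set of times is joined with a translate of another,
  or when a time t happens to be 0.\<close>

lemma characteristic_function:
  assumes K: "finite K" "\<And>k. k \<in> K \<Longrightarrow> \<tau> k \<in> index_set tc"
  shows "(CLINT \<omega>|P. cis (\<Sum>k\<in>K. a k * X (\<tau> k) \<omega>))
     = complex_of_real (exp (- (\<integral>x. \<bar>\<Sum>k\<in>K. a k * f (\<tau> k) x\<bar> powr \<alpha> \<partial>\<mu>)))"
proof -
  let ?\<theta> = "\<lambda>t. \<Sum>k\<in>{k \<in> K. \<tau> k = t}. a k"
  have eq: "(\<Sum>k\<in>K. a k * g (\<tau> k)) = (\<Sum>t\<in>\<tau> ` K. ?\<theta> t * g t)" for g :: "real ^ 'd \<Rightarrow> real"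
    by (subst sum.image_gen[OF K(1), of _ \<tau>]) (auto simp: sum_distrib_right intro!: sum.cong)
  have "finite (\<tau> ` K) \<and> \<tau> ` K \<subseteq> index_set tc" using K by auto
  then have "(CLINT \<omega>|P. cis (\<Sum>t\<in>\<tau> ` K. ?\<theta> t * X t \<omega>))
     = complex_of_real (exp (- (\<integral>x. \<bar>\<Sum>t\<in>\<tau> ` K. ?\<theta> t * f t x\<bar> powr \<alpha> \<partial>\<mu>)))"
    using conjunct2[OF spectral[unfolded sas_spectral_rep_def], rule_format, of "\<tau> ` K" ?\<theta>] by simp
  then show ?thesis by (simp only: eq[symmetric])
qed

text \<open>Stationarity equates the characteristic functions of the two linear combinations, and
  the exponential is injective.\<close>

lemma spectral_norm_shift:
  assumes K: "finite K" "\<And>k. k \<in> K \<Longrightarrow> \<tau> k \<in> index_set tc" and s: "s \<in> index_set tc"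
  shows "(\<integral>x. \<bar>\<Sum>k\<in>K. a k * f (\<tau> k + s) x\<bar> powr \<alpha> \<partial>\<mu>) = (\<integral>x. \<bar>\<Sum>k\<in>K. a k * f (\<tau> k) x\<bar> powr \<alpha> \<partial>\<mu>)"
proof -
  let ?J = "\<tau> ` K" and ?g = "\<lambda>x :: real ^ 'd \<Rightarrow> real. cis (\<Sum>k\<in>K. a k * x (\<tau> k))"
  have J: "finite ?J" "?J \<subseteq> index_set tc" using K by auto
  have "(\<lambda>x. \<Sum>k\<in>K. a k * x (\<tau> k)) \<in> borel_measurable (PiM ?J (\<lambda>_. borel :: real measure))"
    by (intro borel_measurable_sum borel_measurable_times borel_measurable_const measurable_component_singleton) auto
  then have g: "?g \<in> borel_measurable (PiM ?J (\<lambda>_. borel))"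
    by (rule measurable_compose) (intro borel_measurable_continuous_onI continuous_on_cis continuous_on_id)
  have m: "(\<lambda>\<omega>. restrict (\<lambda>t. X (t + r) \<omega>) ?J) \<in> measurable P (PiM ?J (\<lambda>_. borel))" if "r \<in> index_set tc" for r
    using that J by (intro measurable_restrict X_measurable index_set_add) auto
  have val: "(\<integral>x. ?g x \<partial>distr P (PiM ?J (\<lambda>_. borel)) (\<lambda>\<omega>. restrict (\<lambda>t. X (t + r) \<omega>) ?J))
      = complex_of_real (exp (- (\<integral>x. \<bar>\<Sum>k\<in>K. a k * f (\<tau> k + r) x\<bar> powr \<alpha> \<partial>\<mu>)))" if "r \<in> index_set tc" for r
  proof -
    have "(\<integral>x. ?g x \<partial>distr P (PiM ?J (\<lambda>_. borel)) (\<lambda>\<omega>. restrict (\<lambda>t. X (t + r) \<omega>) ?J))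
        = (CLINT \<omega>|P. cis (\<Sum>k\<in>K. a k * X (\<tau> k + r) \<omega>))"
      by (subst integral_distr[OF m[OF that] g]) (simp cong: sum.cong)
    also have "\<dots> = complex_of_real (exp (- (\<integral>x. \<bar>\<Sum>k\<in>K. a k * f (\<tau> k + r) x\<bar> powr \<alpha> \<partial>\<mu>)))"
      by (rule characteristic_function) (use K that in \<open>auto intro: index_set_add\<close>)
    finally show ?thesis .
  qed
  have "distr P (PiM ?J (\<lambda>_. borel)) (\<lambda>\<omega>. restrict (\<lambda>t. X (t + s) \<omega>) ?J)
      = distr P (PiM ?J (\<lambda>_. borel)) (\<lambda>\<omega>. restrict (\<lambda>t. X (t + 0) \<omega>) ?J)"
    using stationary J s unfolding stationary_field_def by simp
  with val[OF s] val[of 0] show ?thesis by (simp del: of_real_exp)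
qed

text \<open>The absolute value of the Mazur map from L^\<alpha> to L2.\<close>

definition v :: "real ^ 'd \<Rightarrow> 's \<Rightarrow> real" where
  "v t x = \<bar>f t x\<bar> powr (\<alpha> / 2)"

lemma v_measurable [measurable]: "t \<in> index_set tc \<Longrightarrow> v t \<in> borel_measurable \<mu>"
  unfolding v_def by measurable

lemma v_nonneg [simp]: "0 \<le> v t x" by (simp add: v_def)

lemma v_square: "(v t x)\<^sup>2 = \<bar>f t x\<bar> powr \<alpha>"
  by (simp add: v_def abs_powr_half_square)

lemma v_square_integrable: "t \<in> index_set tc \<Longrightarrow> integrable \<mu> (\<lambda>x. (v t x)\<^sup>2)"
  by (simp add: v_square f_integrable)

lemma v_integrable: "s \<in> index_set tc \<Longrightarrow> t \<in> index_set tc \<Longrightarrow> integrable \<mu> (\<lambda>x. v s x * v t x)"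
  by (intro cauchy_schwarz_integral(1) v_measurable v_square_integrable)

text \<open>The sign has modulus 1, and the exponents of the derivative combine as
  (1/\<alpha>)(\<alpha>/2) = 1/2.\<close>

lemma v_form:
  assumes t: "t \<in> index_set tc"
  shows "AE x in \<mu>. v t x = sqrt (enn2real (flow_deriv t x)) * v 0 (\<phi> t x)"
proof -
  have "AE x in \<mu>. f t x = c t x * enn2real (flow_deriv t x) powr (1 / \<alpha>) * f 0 (\<phi> t x)"
    using form t unfolding action_form_def flow_deriv_def by blast
  moreover have "\<And>x. x \<in> space \<mu> \<Longrightarrow> \<bar>c t x\<bar> = 1"
    using cocycle t unfolding sign_cocycle_def by fastforce
  ultimately show ?thesis
    using alpha by (auto simp: v_def abs_mult powr_mult powr_powr powr_half_sqrt elim!: AE_mp)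
qed

text \<open>The representation of s maps \<open>v (t - s)\<close> to \<open>v t\<close>, by the
  cocycle rule for the derivative and the group law of the flow.\<close>

lemma v_flow:
  assumes s: "s \<in> index_set tc" and t: "t \<in> index_set tc"
  shows "AE x in \<mu>. v t x = sqrt (enn2real (flow_deriv s x)) * v (t - s) (\<phi> s x)"
proof -
  have d: "t - s \<in> index_set tc" by (rule index_set_diff[OF t s])
  have "AE x in \<mu>. x \<in> space \<mu>" by simp
  with v_form[OF t] flow_deriv_cocycle[OF s t] AE_flow[OF s v_form[OF d]]
  show ?thesis
  proof eventually_elim
    case (elim x)
    have "v t x = sqrt (enn2real (flow_deriv s x * flow_deriv (t - s) (\<phi> s x))) * v 0 (\<phi> (t - s) (\<phi> s x))"
      using elim(1,2,4) flow_add[OF d s, of x] by simp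
    then show ?case using elim(3) by (simp add: enn2real_mult real_sqrt_mult)
  qed
qed

text \<open>Unitarity localised to a set. The indicator is carried along so that the identity later
  yields invariance of measures whose densities are products of such vectors, and not only of inner
  products.\<close>

lemma v_shift:
  assumes s: "s \<in> index_set tc" and a: "a \<in> index_set tc" and b: "b \<in> index_set tc" and A [measurable]: "A \<in> sets \<mu>"
  shows "(\<integral>x. indicator A (\<phi> s x) * (v a x * v b x) \<partial>\<mu>) = (\<integral>x. indicator A x * (v (a - s) x * v (b - s) x) \<partial>\<mu>)"
proof -
  note [measurable] = flow_measurable[OF s] v_measurable[OF a] v_measurable[OF b]
    v_measurable[OF index_set_diff[OF a s]] v_measurable[OF index_set_diff[OF b s]]
  let ?g = "\<lambda>x. indicator A x * (v (a - s) x * v (b - s) x)"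
  have "AE x in \<mu>. ennreal (indicator A (\<phi> s x) * (v a x * v b x)) = flow_deriv s x * ennreal (?g (\<phi> s x))"
    using v_flow[OF s a] v_flow[OF s b] flow_deriv_finite[OF s]
  proof eventually_elim
    case (elim x)
    let ?r = "enn2real (flow_deriv s x)"
    have "indicator A (\<phi> s x) * (v a x * v b x) = (sqrt ?r * sqrt ?r) * ?g (\<phi> s x)"
      using elim by (simp add: algebra_simps)
    also have "\<dots> = ?r * ?g (\<phi> s x)" by simp
    also have "ennreal \<dots> = ennreal ?r * ennreal (?g (\<phi> s x))"
      by (rule ennreal_mult) (auto simp: indicator_def)
    finally show ?case using elim(3) by (simp add: less_top)
  qed
  then have "(\<integral>\<^sup>+x. ennreal (indicator A (\<phi> s x) * (v a x * v b x)) \<partial>\<mu>) = (\<integral>\<^sup>+x. flow_deriv s x * ennreal (?g (\<phi> s x)) \<partial>\<mu>)"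
    by (rule nn_integral_cong_AE)
  also have "\<dots> = (\<integral>\<^sup>+x. ennreal (?g x) \<partial>\<mu>)"
    by (rule nn_integral_flow[OF s]) measurable
  finally show ?thesis
    by (subst (1 2) integral_eq_nn_integral) auto
qed

definition kernel :: "real ^ 'd \<Rightarrow> real" where
  "kernel t = (\<integral>x. v 0 x * v t x \<partial>\<mu>)"

lemma v_inner:
  assumes a: "a \<in> index_set tc" and b: "b \<in> index_set tc"
  shows "(\<integral>x. v a x * v b x \<partial>\<mu>) = kernel (b - a)"
proof -
  have "(\<integral>x. v a x * v b x \<partial>\<mu>) = (\<integral>x. indicator (space \<mu>) (\<phi> a x) * (v a x * v b x) \<partial>\<mu>)"
    by (rule Bochner_Integration.integral_cong) (auto simp: flow_space[OF a])
  also have "\<dots> = (\<integral>x. indicator (space \<mu>) x * (v (a - a) x * v (b - a) x) \<partial>\<mu>)"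
    by (rule v_shift[OF a a b]) simp
  also have "\<dots> = kernel (b - a)"
    unfolding kernel_def by (rule Bochner_Integration.integral_cong) auto
  finally show ?thesis .
qed

lemma kernel_minus: "t \<in> index_set tc \<Longrightarrow> kernel (- t) = kernel t"
  using v_inner[of t 0] by (simp add: kernel_def mult.commute)

lemma kernel_nonneg: "0 \<le> kernel t"
  unfolding kernel_def by simp

lemma v_norm: "t \<in> index_set tc \<Longrightarrow> (\<integral>x. (v t x)\<^sup>2 \<partial>\<mu>) = kernel 0"
  using v_inner[of t t] by (simp add: power2_eq_square)

lemma kernel_le: "t \<in> index_set tc \<Longrightarrow> kernel t \<le> kernel 0"
  using cauchy_schwarz_integral(2)[of "v 0" \<mu> "v t"] v_norm[of 0] v_norm[of t]
  by (simp add: v_square_integrable kernel_nonneg flip: kernel_def)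

lemma linear_combination_bound:
  "\<bar>\<Sum>k\<in>K. a k * f (\<tau> k) x\<bar> powr (\<alpha>/2) \<le> (\<Sum>k\<in>K. \<bar>a k\<bar> powr (\<alpha>/2) * v (\<tau> k) x)"
  using abs_sum_powr_le[of "\<alpha>/2" "\<lambda>k. a k * f (\<tau> k) x" K] alpha by (simp add: abs_mult powr_mult v_def)

lemma linear_combination_measurable:
  assumes "\<And>k. k \<in> K \<Longrightarrow> \<tau> k \<in> index_set tc"
  shows "(\<lambda>x. \<Sum>k\<in>K. a k * f (\<tau> k) x) \<in> borel_measurable \<mu>"
  using assms by (intro borel_measurable_sum borel_measurable_times borel_measurable_const f_measurable) auto

text \<open>Since \<alpha> may exceed 1, the power is bounded by the square of a sum of half powers,
  in which every product is integrable by Cauchy-Schwarz.\<close>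

lemma linear_combination_integrable:
  assumes K: "finite K" "\<And>k. k \<in> K \<Longrightarrow> \<tau> k \<in> index_set tc"
  shows "integrable \<mu> (\<lambda>x. \<bar>\<Sum>k\<in>K. a k * f (\<tau> k) x\<bar> powr \<alpha>)"
proof (rule Bochner_Integration.integrable_bound)
  show "integrable \<mu> (\<lambda>x. (\<Sum>k\<in>K. \<bar>a k\<bar> powr (\<alpha>/2) * v (\<tau> k) x)\<^sup>2)"
    unfolding power2_eq_square[of "sum _ _"] sum_product
  proof (intro Bochner_Integration.integrable_sum cauchy_schwarz_integral(1))
    fix k assume "k \<in> K"
    then have k: "\<tau> k \<in> index_set tc" by (rule K(2))
    show "(\<lambda>x. \<bar>a k\<bar> powr (\<alpha>/2) * v (\<tau> k) x) \<in> borel_measurable \<mu>"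
      "integrable \<mu> (\<lambda>x. (\<bar>a k\<bar> powr (\<alpha>/2) * v (\<tau> k) x)\<^sup>2)"
      using v_measurable[OF k] v_square_integrable[OF k] by (auto simp: power_mult_distrib)
    then show "(\<lambda>x. \<bar>a k\<bar> powr (\<alpha>/2) * v (\<tau> k) x) \<in> borel_measurable \<mu>"
      "integrable \<mu> (\<lambda>x. (\<bar>a k\<bar> powr (\<alpha>/2) * v (\<tau> k) x)\<^sup>2)" by -
  qed
  show "(\<lambda>x. \<bar>\<Sum>k\<in>K. a k * f (\<tau> k) x\<bar> powr \<alpha>) \<in> borel_measurable \<mu>"
    using linear_combination_measurable[OF K(2)] by measurable
  show "AE x in \<mu>. norm (\<bar>\<Sum>k\<in>K. a k * f (\<tau> k) x\<bar> powr \<alpha>) \<le> norm ((\<Sum>k\<in>K. \<bar>a k\<bar> powr (\<alpha>/2) * v (\<tau> k) x)\<^sup>2)"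
    using power_mono[OF linear_combination_bound, where n = 2] by (intro AE_I2) (simp add: abs_powr_half_square)
qed

text \<open>The pointwise estimate \<open>abs_add_powr_defect\<close> is integrated. Its right side
  expands bilinearly into inner products of \<open>v (\<tau> k)\<close> and
  \<open>v (\<sigma> l)\<close>, hence into values of \<open>kernel\<close>.\<close>

lemma spectral_norm_defect:
  assumes K: "finite K" "\<And>k. k \<in> K \<Longrightarrow> \<tau> k \<in> index_set tc"
    and L: "finite L" "\<And>l. l \<in> L \<Longrightarrow> \<sigma> l \<in> index_set tc"
    and g_def: "g = (\<lambda>x. \<Sum>k\<in>K. a k * f (\<tau> k) x)" and h_def: "h = (\<lambda>x. \<Sum>l\<in>L. b l * f (\<sigma> l) x)"
  shows "\<bar>(\<integral>x. \<bar>g x + h x\<bar> powr \<alpha> \<partial>\<mu>) - (\<integral>x. \<bar>g x\<bar> powr \<alpha> \<partial>\<mu>) - (\<integral>x. \<bar>h x\<bar> powr \<alpha> \<partial>\<mu>)\<bar>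
    \<le> 4 * (\<Sum>k\<in>K. \<Sum>l\<in>L. \<bar>a k\<bar> powr (\<alpha>/2) * \<bar>b l\<bar> powr (\<alpha>/2) * kernel (\<sigma> l - \<tau> k))"
proof -
  have p: "0 < \<alpha> / 2" "\<alpha> / 2 \<le> 1" using alpha by auto
  have [measurable]: "g \<in> borel_measurable \<mu>" "h \<in> borel_measurable \<mu>"
    unfolding g_def h_def by (intro linear_combination_measurable K L; assumption)+
  define u where "u x = (\<Sum>k\<in>K. \<Sum>l\<in>L. \<bar>a k\<bar> powr (\<alpha>/2) * \<bar>b l\<bar> powr (\<alpha>/2) * (v (\<tau> k) x * v (\<sigma> l) x))" for x
  have u_int: "integrable \<mu> u"
    unfolding u_def using K L by (intro Bochner_Integration.integrable_sum integrable_mult_right v_integrable) auto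
  have u_val: "(\<integral>x. u x \<partial>\<mu>) = (\<Sum>k\<in>K. \<Sum>l\<in>L. \<bar>a k\<bar> powr (\<alpha>/2) * \<bar>b l\<bar> powr (\<alpha>/2) * kernel (\<sigma> l - \<tau> k))"
    unfolding u_def using K L by (simp add: v_integrable v_inner)
  have gh: "\<bar>g x\<bar> powr (\<alpha>/2) * \<bar>h x\<bar> powr (\<alpha>/2) \<le> u x" for x
  proof -
    have "\<bar>g x\<bar> powr (\<alpha>/2) * \<bar>h x\<bar> powr (\<alpha>/2)
        \<le> (\<Sum>k\<in>K. \<bar>a k\<bar> powr (\<alpha>/2) * v (\<tau> k) x) * (\<Sum>l\<in>L. \<bar>b l\<bar> powr (\<alpha>/2) * v (\<sigma> l) x)"
      unfolding g_def h_def by (intro mult_mono linear_combination_bound sum_nonneg) auto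
    also have "\<dots> = u x" unfolding u_def sum_product by (simp add: mult_ac)
    finally show ?thesis .
  qed
  have ig: "integrable \<mu> (\<lambda>x. \<bar>g x\<bar> powr \<alpha>)" unfolding g_def by (rule linear_combination_integrable[OF K])
  have ih: "integrable \<mu> (\<lambda>x. \<bar>h x\<bar> powr \<alpha>)" unfolding h_def by (rule linear_combination_integrable[OF L])
  have pw: "\<bar>\<bar>g x + h x\<bar> powr \<alpha> - \<bar>g x\<bar> powr \<alpha> - \<bar>h x\<bar> powr \<alpha>\<bar> \<le> 4 * u x" for x
    using abs_add_powr_defect[OF alpha, of "g x" "h x"] gh[of x] by linarith
  have ix: "integrable \<mu> (\<lambda>x. \<bar>g x + h x\<bar> powr \<alpha>)"
  proof (rule Bochner_Integration.integrable_bound)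
    show "integrable \<mu> (\<lambda>x. \<bar>g x\<bar> powr \<alpha> + \<bar>h x\<bar> powr \<alpha> + 4 * u x)" using ig ih u_int by auto
    show "AE x in \<mu>. norm (\<bar>g x + h x\<bar> powr \<alpha>) \<le> norm (\<bar>g x\<bar> powr \<alpha> + \<bar>h x\<bar> powr \<alpha> + 4 * u x)"
    proof (rule AE_I2)
      fix x show "norm (\<bar>g x + h x\<bar> powr \<alpha>) \<le> norm (\<bar>g x\<bar> powr \<alpha> + \<bar>h x\<bar> powr \<alpha> + 4 * u x)"
        using pw[of x] powr_ge_zero[of "\<bar>g x + h x\<bar>" \<alpha>] unfolding real_norm_def by linarith
    qed
  qed measurable
  have "(\<integral>x. \<bar>g x + h x\<bar> powr \<alpha> \<partial>\<mu>) - (\<integral>x. \<bar>g x\<bar> powr \<alpha> \<partial>\<mu>) - (\<integral>x. \<bar>h x\<bar> powr \<alpha> \<partial>\<mu>)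
      = (\<integral>x. \<bar>g x + h x\<bar> powr \<alpha> - \<bar>g x\<bar> powr \<alpha> - \<bar>h x\<bar> powr \<alpha> \<partial>\<mu>)"
    using ix ig ih by simp
  also have "\<bar>\<dots>\<bar> \<le> (\<integral>x. \<bar>\<bar>g x + h x\<bar> powr \<alpha> - \<bar>g x\<bar> powr \<alpha> - \<bar>h x\<bar> powr \<alpha>\<bar> \<partial>\<mu>)" by (rule integral_abs_bound)
  also have "\<dots> \<le> (\<integral>x. 4 * u x \<partial>\<mu>)"
    using ix ig ih u_int by (intro integral_mono pw) auto
  also have "\<dots> = 4 * (\<integral>x. u x \<partial>\<mu>)" by simp
  finally show ?thesis unfolding u_val .
qed

text \<open>Each member s \<mapsto> \<beta> s of the family stands for the orbit of a convex combination of the v t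
  under the Koopman representation on L2; only midpoints are needed for the
  minimal-norm argument.\<close>

inductive_set orbit_means :: "(real ^ 'd \<Rightarrow> 's \<Rightarrow> real) set" where
  single: "t \<in> index_set tc \<Longrightarrow> (\<lambda>s. v (t + s)) \<in> orbit_means"
| midpoint: "\<beta> \<in> orbit_means \<Longrightarrow> \<gamma> \<in> orbit_means \<Longrightarrow> (\<lambda>s x. (\<beta> s x + \<gamma> s x) / 2) \<in> orbit_means"

lemma orbit_means_basic:
  assumes "\<beta> \<in> orbit_means" "s \<in> index_set tc"
  shows "\<beta> s \<in> borel_measurable \<mu> \<and> (\<forall>x. 0 \<le> \<beta> s x) \<and> integrable \<mu> (\<lambda>x. (\<beta> s x)\<^sup>2)"
  using assms(1)
proof induction
  case (single t)
  then show ?case using assms(2) by (auto intro: v_measurable v_square_integrable index_set_add)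
next
  case (midpoint \<beta> \<gamma>)
  then have "integrable \<mu> (\<lambda>x. \<beta> s x * \<gamma> s x)" by (intro cauchy_schwarz_integral(1)) auto
  with midpoint have "integrable \<mu> (\<lambda>x. ((\<beta> s x)\<^sup>2 + 2 * (\<beta> s x * \<gamma> s x) + (\<gamma> s x)\<^sup>2) / 4)"
    by (intro integrable_divide Bochner_Integration.integrable_add integrable_mult_right) auto
  moreover have "((\<beta> s x + \<gamma> s x) / 2)\<^sup>2 = ((\<beta> s x)\<^sup>2 + 2 * (\<beta> s x * \<gamma> s x) + (\<gamma> s x)\<^sup>2) / 4" for x
    by (simp add: power2_eq_square algebra_simps)
  ultimately have "integrable \<mu> (\<lambda>x. ((\<beta> s x + \<gamma> s x) / 2)\<^sup>2)" by (simp only:)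
  then show ?case using midpoint.IH by auto
qed

text \<open>This is what makes a translate of a near-minimiser a competitor in the same
  minimisation.\<close>

lemma orbit_means_translate:
  assumes "\<beta> \<in> orbit_means" "r \<in> index_set tc"
  shows "(\<lambda>s. \<beta> (r + s)) \<in> orbit_means"
  using assms(1)
proof induction
  case (single t)
  then show ?case using orbit_means.single[OF index_set_add[OF single assms(2)]] by (simp add: add.assoc)
next
  case (midpoint \<beta> \<gamma>)
  then show ?case using orbit_means.midpoint[OF midpoint.IH] by simp
qed

lemma orbit_means_integrable:
  assumes "\<beta> \<in> orbit_means" "\<gamma> \<in> orbit_means" "s \<in> index_set tc" "r \<in> index_set tc"
  shows "integrable \<mu> (\<lambda>x. \<beta> s x * \<gamma> r x)"
  using orbit_means_basic[OF assms(1,3)] orbit_means_basic[OF assms(2,4)] by (intro cauchy_schwarz_integral(1)) auto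

text \<open>Both sides are bilinear in the two members of the family, so the identity
  \<open>v_shift\<close> for single vectors extends by induction in each argument.\<close>

lemma orbit_means_shift:
  assumes "\<beta> \<in> orbit_means" "\<gamma> \<in> orbit_means" and r: "r \<in> index_set tc" and s: "s \<in> index_set tc" and A [measurable]: "A \<in> sets \<mu>"
  shows "(\<integral>x. indicator A (\<phi> s x) * (\<beta> r x * \<gamma> r x) \<partial>\<mu>) = (\<integral>x. indicator A x * (\<beta> (r - s) x * \<gamma> (r - s) x) \<partial>\<mu>)"
proof -
  have int1: "integrable \<mu> (\<lambda>x. indicator B x * (\<beta> r x * \<gamma> r x))"
    if "\<beta> \<in> orbit_means" "\<gamma> \<in> orbit_means" "r \<in> index_set tc" "B \<in> sets \<mu>" for \<beta> \<gamma> r B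
    using integrable_mult_indicator[OF that(4) orbit_means_integrable[OF that(1,2,3,3)]] by simp
  have int2: "integrable \<mu> (\<lambda>x. indicator A (\<phi> s x) * (\<beta> r x * \<gamma> r x))"
    if "\<beta> \<in> orbit_means" "\<gamma> \<in> orbit_means" for \<beta> \<gamma>
  proof -
    have "integrable \<mu> (\<lambda>x. indicator (\<phi> s -` A \<inter> space \<mu>) x * (\<beta> r x * \<gamma> r x))"
      by (intro int1 that r measurable_sets[OF flow_measurable[OF s] A])
    then show ?thesis
      by (subst Bochner_Integration.integrable_cong[where N = \<mu> and g = "\<lambda>x. indicator (\<phi> s -` A \<inter> space \<mu>) x * (\<beta> r x * \<gamma> r x)"])
        (auto simp: indicator_def)
  qed
  note int1' = int1[OF _ _ index_set_diff[OF r s] A]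
  have base: "(\<integral>x. indicator A (\<phi> s x) * (v (t + r) x * \<gamma> r x) \<partial>\<mu>)
      = (\<integral>x. indicator A x * (v (t + (r - s)) x * \<gamma> (r - s) x) \<partial>\<mu>)" if t: "t \<in> index_set tc" for t
    using assms(2)
  proof induction
    case (single u)
    show ?case using v_shift[OF s index_set_add[OF t r] index_set_add[OF single r] A] by (simp add: add_diff_eq)
  next
    case (midpoint \<gamma> \<delta>)
    note T = orbit_means.single[OF t]
    show ?case
      using midpoint.IH int2[OF T midpoint.hyps(1)] int2[OF T midpoint.hyps(2)]
        int1'[OF T midpoint.hyps(1)] int1'[OF T midpoint.hyps(2)]
      by (simp add: distrib_left add_divide_distrib)
  qed
  show ?thesis using assms(1)
  proof induction
    case (single t)
    then show ?case by (rule base)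
  next
    case (midpoint \<beta> \<delta>)
    show ?case
      using midpoint.IH int2[OF midpoint.hyps(1) assms(2)] int2[OF midpoint.hyps(2) assms(2)]
        int1'[OF midpoint.hyps(1) assms(2)] int1'[OF midpoint.hyps(2) assms(2)]
      by (simp add: distrib_left distrib_right add_divide_distrib)
  qed
qed

lemma orbit_means_norm:
  assumes "\<beta> \<in> orbit_means" "s \<in> index_set tc"
  shows "(\<integral>x. (\<beta> s x)\<^sup>2 \<partial>\<mu>) = (\<integral>x. (\<beta> 0 x)\<^sup>2 \<partial>\<mu>)"
proof -
  have "(\<integral>x. (\<beta> s x)\<^sup>2 \<partial>\<mu>) = (\<integral>x. indicator (space \<mu>) (\<phi> s x) * (\<beta> s x * \<beta> s x) \<partial>\<mu>)"
    by (rule Bochner_Integration.integral_cong) (auto simp: flow_space assms power2_eq_square)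
  also have "\<dots> = (\<integral>x. indicator (space \<mu>) x * (\<beta> (s - s) x * \<beta> (s - s) x) \<partial>\<mu>)"
    by (rule orbit_means_shift[OF assms(1,1,2,2)]) simp
  also have "\<dots> = (\<integral>x. (\<beta> 0 x)\<^sup>2 \<partial>\<mu>)"
    by (rule Bochner_Integration.integral_cong) (auto simp: power2_eq_square)
  finally show ?thesis .
qed

end

section \<open>Stochastic continuity\<close>

lemma translation_box_sets:
  "{t \<in> cball 0 1. (t + s \<in> box a b) \<noteq> (t \<in> box a b)} \<in> sets (borel :: (real ^ 'd) measure)"
proof -
  have "{t \<in> cball 0 1. (t + s \<in> box a b) \<noteq> (t \<in> box a b)}
      = cball 0 1 \<inter> (((\<lambda>t. t + s) -` box a b - box a b) \<union> (box a b - (\<lambda>t. t + s) -` box a b))" by auto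
  moreover have "open ((\<lambda>t. t + s) -` box a b)"
    by (rule open_vimage) (auto intro!: continuous_intros)
  ultimately show ?thesis by simp
qed

text \<open>Off the boundary of the box, which is a null set, small translations eventually do not
  change membership. The restriction to the unit ball supplies the dominating function.\<close>

lemma translation_box_tendsto:
  fixes s :: "nat \<Rightarrow> real ^ 'd"
  assumes s: "s \<longlonglongrightarrow> 0"
  shows "(\<lambda>n. measure lborel {t \<in> cball 0 1. (t + s n \<in> box a b) \<noteq> (t \<in> box a b)}) \<longlonglongrightarrow> 0"
proof -
  let ?S = "\<lambda>n. {t \<in> cball 0 1. (t + s n \<in> box a b) \<noteq> (t \<in> box a b)}"
  note [measurable] = translation_box_sets
  have "(\<lambda>n. \<integral>t. (indicator (?S n) t :: real) \<partial>lborel) \<longlonglongrightarrow> (\<integral>t. 0 \<partial>(lborel :: (real ^ 'd) measure))"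
  proof (rule integral_dominated_convergence[where w = "indicator (cball 0 1)"])
    show "integrable lborel (indicator (cball 0 1 :: (real ^ 'd) set) :: _ \<Rightarrow> real)"
      by (intro integrable_real_indicator emeasure_lborel_cball_finite) auto
    have "AE t in lborel. t \<notin> cbox a b - box a b"
      using null_sets_cbox_Diff_box AE_not_in by blast
    then show "AE t in lborel. (\<lambda>n. indicator (?S n) t :: real) \<longlonglongrightarrow> 0"
    proof eventually_elim
      case (elim t)
      have lim: "(\<lambda>n. t + s n) \<longlonglongrightarrow> t" using tendsto_add[OF tendsto_const s] by simp
      have "eventually (\<lambda>n. (t + s n \<in> box a b) = (t \<in> box a b)) sequentially"
      proof (cases "t \<in> box a b")
        case True
        then show ?thesis using topological_tendstoD[OF lim open_box True] by (auto elim: eventually_mono)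
      next
        case False
        then have "t \<in> - cbox a b" using elim by auto
        from topological_tendstoD[OF lim _ this] have "eventually (\<lambda>n. t + s n \<in> - cbox a b) sequentially"
          by (simp add: closed_cbox open_Compl)
        then show ?thesis using False box_subset_cbox[of a b] by (auto elim!: eventually_mono)
      qed
      then have "eventually (\<lambda>n. indicator (?S n) t = (0 :: real)) sequentially"
        by (rule eventually_mono) (auto simp: indicator_def)
      then show ?case by (rule tendsto_eventually)
    qed
  qed (auto simp: indicator_def)
  then show ?thesis by simp
qed

lemma lborel_pair_translation:
  assumes P: "prob_space P"
  shows "distr (lborel \<Otimes>\<^sub>M P) (lborel \<Otimes>\<^sub>M P) (\<lambda>(t, \<omega>). (t + s, \<omega>)) = (lborel :: (real ^ 'd) measure) \<Otimes>\<^sub>M P"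
proof -
  interpret P: prob_space P by fact
  have 1: "distr lborel lborel (\<lambda>t. t + s) = (lborel :: (real ^ 'd) measure)"
    using distr_shift_index_measure[of s RealCase] by (simp add: index_measure_def index_set_def)
  have 2: "distr P P (\<lambda>\<omega>. \<omega>) = P" by simp
  have 3: "sigma_finite_measure (distr P P (\<lambda>\<omega>. \<omega>))" unfolding 2 by unfold_locales
  show ?thesis using pair_measure_distr[of "\<lambda>t. t + s" lborel lborel "\<lambda>\<omega>. \<omega>" P P, OF _ _ 3] 1 2 by simp
qed

text \<open>A Dynkin argument starting from products of boxes and events.\<close>

lemma translation_continuity:
  fixes s :: "nat \<Rightarrow> real ^ 'd" and C :: "((real ^ 'd) \<times> 'w) set"
  assumes P: "prob_space P" and s: "s \<longlonglongrightarrow> 0" and s1: "\<And>n. norm (s n) \<le> 1"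
    and C: "C \<in> sets (lborel \<Otimes>\<^sub>M P)"
  shows "(\<lambda>n. measure (lborel \<Otimes>\<^sub>M P) {z \<in> space (lborel \<Otimes>\<^sub>M P). fst z \<in> cball 0 1 \<and> ((fst z + s n, snd z) \<in> C) \<noteq> (z \<in> C)}) \<longlonglongrightarrow> 0"
proof -
  interpret Pr: prob_space P by fact
  interpret pair_sigma_finite "lborel :: (real ^ 'd) measure" P by unfold_locales
  let ?M = "(lborel :: (real ^ 'd) measure) \<Otimes>\<^sub>M P"
  let ?G = "\<lambda>n C. {z \<in> space ?M. fst z \<in> cball 0 1 \<and> ((fst z + s n, snd z) \<in> C) \<noteq> (z \<in> C)}"
  \<comment> \<open>Points of the unit ball translated by \<open>s n\<close> stay in the ball of
    radius 2, so only this part of C matters.\<close>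
  let ?W = "\<lambda>C. C \<inter> (cball 0 2 \<times> space P)"
  have tm [measurable]: "(\<lambda>z. (fst z + s n, snd z)) \<in> measurable ?M ?M" for n by measurable
  have Gm: "?G n C \<in> sets ?M" if C: "C \<in> sets ?M" for n C
  proof -
    let ?A = "(\<lambda>z. (fst z + s n, snd z)) -` C \<inter> space ?M"
    have "?A \<in> sets ?M" by (rule measurable_sets[OF tm C])
    moreover have "cball 0 1 \<times> space P \<in> sets ?M" by simp
    moreover have "?G n C = (cball 0 1 \<times> space P) \<inter> ((?A - C) \<union> (C - ?A))"
      using sets.sets_into_space[OF C] by (auto simp: space_pair_measure)
    ultimately show ?thesis using C by (simp add: sets.Int sets.Un sets.Diff)
  qed
  have Wm: "?W C \<in> sets ?M" if "C \<in> sets ?M" for C using that by simp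
  have finW: "emeasure ?M (cball (0 :: real ^ 'd) r \<times> space P) < \<infinity>" for r
    using emeasure_lborel_cball_finite[of "0 :: real ^ 'd" r] Pr.emeasure_pair_measure_Times[of "cball (0 :: real ^ 'd) r" lborel "space P"]
    by (simp add: Pr.emeasure_space_1)
  have fmW: "?W C \<in> fmeasurable ?M" if "C \<in> sets ?M" for C
    by (rule fmeasurableI2[OF fmeasurableI[OF _ finW[of 2]]]) (use that in auto)
  have fmG: "?G n C \<in> fmeasurable ?M" if "C \<in> sets ?M" for n C
    by (rule fmeasurableI2[OF fmeasurableI[OF _ finW[of 1]]]) (use that in \<open>auto simp: space_pair_measure\<close>)
  \<comment> \<open>A bound independent of n: the set is covered by the part of C over the larger
    ball and its translate, which have equal measure. It becomes the summable majorant in the case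
    of countable disjoint unions.\<close>
  have bound: "measure ?M (?G n C) \<le> 2 * measure ?M (?W C)" if C: "C \<in> sets ?M" for n C
  proof -
    let ?T = "{z \<in> space ?M. (fst z + s n, snd z) \<in> ?W C}"
    have T: "?T = (\<lambda>(t, \<omega>). (t + s n, \<omega>)) -` ?W C \<inter> space ?M" by auto
    have m2: "(\<lambda>(t, \<omega>). (t + s n, \<omega>)) \<in> measurable ?M ?M" by measurable
    have Tm: "?T \<in> sets ?M" unfolding T by (rule measurable_sets[OF m2 Wm[OF C]])
    have eT: "emeasure ?M ?T = emeasure ?M (?W C)"
      using emeasure_distr[OF m2 Wm[OF C]] lborel_pair_translation[OF P, of "s n"] unfolding T by simp
    then have fT: "?T \<in> fmeasurable ?M" using fmW[OF C] Tm by (auto simp: fmeasurable_def)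
    have sub: "?G n C \<subseteq> ?T \<union> ?W C"
    proof
      fix z assume z: "z \<in> ?G n C"
      have "norm (fst z + s n) \<le> 2" using z s1[of n] norm_triangle_ineq[of "fst z" "s n"] by auto
      moreover have "norm (fst z) \<le> 2" using z by auto
      ultimately show "z \<in> ?T \<union> ?W C" using z sets.sets_into_space[OF C] by (cases z) (auto simp: space_pair_measure)
    qed
    have "measure ?M (?G n C) \<le> measure ?M (?T \<union> ?W C)"
      by (rule measure_mono_fmeasurable[OF sub Gm[OF C] fmeasurable.Un[OF fT fmW[OF C]]])
    also have "\<dots> \<le> measure ?M ?T + measure ?M (?W C)"
      by (rule measure_Un_le) (use Tm Wm[OF C] in auto)
    finally show ?thesis using eT by (simp add: measure_def)
  qed
  have gen: "sets ?M = sigma_sets (UNIV \<times> space P) {a \<times> b | a b. a \<in> range (\<lambda>(a, b). box a b) \<and> b \<in> sets P}"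
  proof -
    have "sets ?M = sets (sigma (space lborel \<times> space P) {a \<times> b | a b. a \<in> range (\<lambda>(a, b). box a b) \<and> b \<in> sets P})"
    proof (rule sets_pair_eq)
      show "sets lborel = sigma_sets (space lborel) (range (\<lambda>(a, b). box a b :: (real ^ 'd) set))"
        by (subst sets_lborel, subst borel_eq_box) auto
      show "countable (range (\<lambda>n :: nat. box (\<Sum>i\<in>Basis. - real n *\<^sub>R i) (\<Sum>i\<in>Basis. real n *\<^sub>R i :: real ^ 'd)))" by simp
      show "\<Union> (range (\<lambda>n :: nat. box (\<Sum>i\<in>Basis. - real n *\<^sub>R i) (\<Sum>i\<in>Basis. real n *\<^sub>R i :: real ^ 'd))) = space lborel"
        using UN_box_eq_UNIV by (simp add: sum_negf scaleR_sum_right)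
      show "sets P = sigma_sets (space P) (sets P)" by (simp add: sets.sigma_sets_eq)
      show "countable {space P}" "{space P} \<subseteq> sets P" "\<Union> {space P} = space P" by auto
    qed (auto dest: sets.sets_into_space)
    also have "\<dots> = sigma_sets (UNIV \<times> space P) {a \<times> b | a b. a \<in> range (\<lambda>(a, b). box a b) \<and> b \<in> sets P}"
      by (subst sets_measure_of) (auto dest: sets.sets_into_space)
    finally show ?thesis .
  qed
  have stable: "Int_stable {a \<times> b | a b. a \<in> range (\<lambda>(a, b). box a b :: (real ^ 'd) set) \<and> b \<in> sets P}"
  proof (rule Int_stableI, safe)
    fix a b a' b' :: "real ^ 'd" and B B' assume B: "B \<in> sets P" "B' \<in> sets P"
    have "(box a b \<times> B) \<inter> (box a' b' \<times> B') = (box a b \<inter> box a' b') \<times> (B \<inter> B')" by auto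
    then show "\<exists>aa ba. (box a b \<times> B) \<inter> (box a' b' \<times> B') = aa \<times> ba \<and> aa \<in> range (\<lambda>(a, b). box a b) \<and> ba \<in> sets P"
      unfolding box_Int_box using B by blast
  qed
  have pow: "{a \<times> b | a b. a \<in> range (\<lambda>(a, b). box a b :: (real ^ 'd) set) \<and> b \<in> sets P} \<subseteq> Pow (UNIV \<times> space P)"
    by (auto dest: sets.sets_into_space)
  have "C \<in> sigma_sets (UNIV \<times> space P) {a \<times> b | a b. a \<in> range (\<lambda>(a, b). box a b) \<and> b \<in> sets P}"
    using C gen by simp
  with stable pow show ?thesis
  proof (induction rule: sigma_sets_induct_disjoint)
    case (basic A)
    then obtain a b B where A: "A = box a b \<times> B" "B \<in> sets P" by auto
    let ?S = "\<lambda>n. {t \<in> cball 0 1. (t + s n \<in> box a b) \<noteq> (t \<in> box a b)}"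
    show ?case
    proof (rule tendsto_sandwich[OF _ _ tendsto_const translation_box_tendsto[OF s, of a b]])
      show "eventually (\<lambda>n. measure ?M (?G n A) \<le> measure lborel (?S n)) sequentially"
      proof (rule always_eventually, rule allI)
        fix n
        have Sm: "?S n \<in> sets lborel" using translation_box_sets by simp
        have eq: "emeasure ?M (?S n \<times> space P) = emeasure lborel (?S n)"
          using Pr.emeasure_pair_measure_Times[OF Sm sets.top[of P]] by (simp add: Pr.emeasure_space_1)
        have "?S n \<times> space P \<in> fmeasurable ?M"
          by (rule fmeasurableI2[OF fmeasurableI[OF _ finW[of 1]]]) (use Sm in auto)
        then have "measure ?M (?G n A) \<le> measure ?M (?S n \<times> space P)"
          by (intro measure_mono_fmeasurable Gm) (use A in \<open>auto simp: space_pair_measure\<close>)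
        also have "\<dots> = measure lborel (?S n)" by (simp only: measure_def eq)
        finally show "measure ?M (?G n A) \<le> measure lborel (?S n)" .
      qed
    qed auto
  next
    case empty
    show ?case by simp
  next
    case (compl A)
    have "?G n (UNIV \<times> space P - A) = ?G n A" for n by (auto simp: space_pair_measure)
    then show ?case using compl by simp
  next
    case (union A)
    have A: "A i \<in> sets ?M" for i using union(2) gen by auto
    have fW: "(\<Union>i. ?W (A i)) \<in> fmeasurable ?M"
      by (rule fmeasurableI2[OF fmeasurableI[OF _ finW[of 2]]]) (use A in auto)
    have sumW: "summable (\<lambda>i. measure ?M (?W (A i)))"
    proof -
      have "(\<lambda>i. measure ?M (?W (A i))) sums measure ?M (\<Union>i. ?W (A i))"
        using fW A union(1) by (intro measure_UNION) (auto simp: disjoint_family_on_def fmeasurable_def less_top)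
      then show ?thesis by (rule sums_summable)
    qed
    have sumG: "summable (\<lambda>i. measure ?M (?G n (A i)))" for n
      by (rule summable_comparison_test'[OF summable_mult[OF sumW, of 2], of 0]) (use bound[OF A] in auto)
    \<comment> \<open>The theorem of Tannery exchanges the limit in n with the sum over the disjoint
      pieces.\<close>
    have lim: "(\<lambda>n. \<Sum>i. measure ?M (?G n (A i))) \<longlonglongrightarrow> (\<Sum>i. 0)"
    proof (rule tannerys_theorem[THEN conjunct2, THEN conjunct2])
      show "eventually (\<lambda>(i, n). norm (measure ?M (?G n (A i))) \<le> 2 * measure ?M (?W (A i))) (at_top \<times>\<^sub>F sequentially)"
        using bound[OF A] by (intro always_eventually) auto
      show "summable (\<lambda>i. 2 * measure ?M (?W (A i)))" by (rule summable_mult[OF sumW])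
    qed (use union(3) in auto)
    have le: "measure ?M (?G n (\<Union>i. A i)) \<le> (\<Sum>i. measure ?M (?G n (A i)))" for n
    proof -
      have "measure ?M (?G n (\<Union>i. A i)) \<le> measure ?M (\<Union>i. ?G n (A i))"
      proof (rule measure_mono_fmeasurable)
        show "(\<Union>i. ?G n (A i)) \<in> fmeasurable ?M"
          by (rule fmeasurableI2[OF fmeasurableI[OF _ finW[of 1]]]) (use Gm[OF A] in \<open>auto simp: space_pair_measure\<close>)
      qed (use Gm[of "\<Union>i. A i"] A in auto)
      also have "\<dots> \<le> (\<Sum>i. measure ?M (?G n (A i)))"
      proof (rule measure_subadditive_countably)
        show "range (\<lambda>i. ?G n (A i)) \<subseteq> sets ?M" using Gm[OF A] by blast
        have "emeasure ?M (?G n (A i)) = ennreal (measure ?M (?G n (A i)))" for i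
          using fmG[OF A, of n i] by (intro emeasure_eq_ennreal_measure) (auto simp: fmeasurable_def)
        then have "(\<Sum>i. emeasure ?M (?G n (A i))) = ennreal (\<Sum>i. measure ?M (?G n (A i)))"
          using suminf_ennreal2[OF _ sumG[of n]] by (simp only: measure_nonneg simp_thms)
        then show "(\<Sum>i. emeasure ?M (?G n (A i))) \<noteq> \<infinity>" by (simp only: infinity_ennreal_def ennreal_neq_top simp_thms)
      qed
      finally show ?thesis .
    qed
    show ?case
    proof (rule tendsto_sandwich[OF _ _ tendsto_const lim[unfolded suminf_zero]])
      show "eventually (\<lambda>n. 0 \<le> measure ?M (?G n (\<Union>i. A i))) sequentially"
        by (rule always_eventually, rule allI, rule measure_nonneg)
      show "eventually (\<lambda>n. measure ?M (?G n (\<Union>i. A i)) \<le> (\<Sum>i. measure ?M (?G n (A i)))) sequentially"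
        by (rule always_eventually, rule allI, rule le)
    qed
  qed
qed

text \<open>By stationarity the probability of a change between the times t and t + s n does not
  depend on t. It therefore equals the product measure of the set of changes over the unit ball
  divided by the volume of that ball, and this measure tends to 0 by continuity of
  translations.\<close>

lemma stochastic_continuity:
  fixes X :: "real ^ 'd \<Rightarrow> 'w \<Rightarrow> real"
  assumes P: "prob_space P" and X: "measurable_field P RealCase X" and st: "stationary_field P RealCase X"
    and s: "s \<longlonglongrightarrow> 0" and s1: "\<And>n. norm (s n) \<le> 1" and B [measurable]: "B \<in> sets borel"
  shows "(\<lambda>n. measure P {\<omega> \<in> space P. (X (s n) \<omega> \<in> B) \<noteq> (X 0 \<omega> \<in> B)}) \<longlonglongrightarrow> 0"
proof -
  interpret P: prob_space P by fact
  let ?M = "(lborel :: (real ^ 'd) measure) \<Otimes>\<^sub>M P"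
  have Xt [measurable]: "X t \<in> borel_measurable P" for t using X by (simp add: measurable_field_def index_set_def)
  have Xj [measurable]: "(\<lambda>(t, \<omega>). X t \<omega>) \<in> borel_measurable ?M" using X by (simp add: measurable_field_def)
  define C where "C = (\<lambda>(t, \<omega>). X t \<omega>) -` B \<inter> space ?M"
  have C: "C \<in> sets ?M" unfolding C_def by measurable
  define G where "G n = {z \<in> space ?M. fst z \<in> cball 0 1 \<and> ((fst z + s n, snd z) \<in> C) \<noteq> (z \<in> C)}" for n
  let ?q = "\<lambda>n. emeasure P {\<omega> \<in> space P. (X (s n) \<omega> \<in> B) \<noteq> (X 0 \<omega> \<in> B)}"
  have pair: "emeasure P {\<omega> \<in> space P. (X (t + s n) \<omega> \<in> B) \<noteq> (X t \<omega> \<in> B)} = ?q n" for t n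
  proof -
    let ?J = "{0, s n}" and ?N = "PiM {0, s n} (\<lambda>_. borel :: real measure)"
    let ?E = "{x \<in> space ?N. (x (s n) \<in> B) \<noteq> (x 0 \<in> B)}"
    have E: "?E \<in> sets ?N"
    proof -
      have [measurable]: "(\<lambda>x. x (s n)) \<in> borel_measurable ?N" "(\<lambda>x. x 0) \<in> borel_measurable ?N"
        by (auto intro!: measurable_component_singleton)
      have "{x \<in> space ?N. x (s n) \<in> B} \<in> sets ?N" "{x \<in> space ?N. x 0 \<in> B} \<in> sets ?N" by measurable
      moreover have "?E = ({x \<in> space ?N. x (s n) \<in> B} - {x \<in> space ?N. x 0 \<in> B}) \<union> ({x \<in> space ?N. x 0 \<in> B} - {x \<in> space ?N. x (s n) \<in> B})" by auto
      ultimately show ?thesis by (simp only: sets.Un sets.Diff)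
    qed
    have m: "(\<lambda>\<omega>. restrict (\<lambda>r. X (r + t) \<omega>) ?J) \<in> measurable P ?N" for t by (intro measurable_restrict Xt)
    have e: "emeasure (distr P ?N (\<lambda>\<omega>. restrict (\<lambda>r. X (r + t) \<omega>) ?J)) ?E
        = emeasure P {\<omega> \<in> space P. (X (s n + t) \<omega> \<in> B) \<noteq> (X (0 + t) \<omega> \<in> B)}" for t
    proof -
      have "(\<lambda>\<omega>. restrict (\<lambda>r. X (r + t) \<omega>) ?J) -` ?E \<inter> space P = {\<omega> \<in> space P. (X (s n + t) \<omega> \<in> B) \<noteq> (X (0 + t) \<omega> \<in> B)}"
        by (auto simp: space_PiM)
      then show ?thesis by (simp only: emeasure_distr[OF m E])
    qed
    have "distr P ?N (\<lambda>\<omega>. restrict (\<lambda>r. X (r + t) \<omega>) ?J) = distr P ?N (\<lambda>\<omega>. restrict (\<lambda>r. X r \<omega>) ?J)"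
      using st[unfolded stationary_field_def, rule_format, of ?J t] by (simp add: index_set_def)
    then show ?thesis using e[of t] e[of 0] by (simp add: add.commute)
  qed
  have Gm: "G n \<in> sets ?M" for n
  proof -
    have tm: "(\<lambda>z. (fst z + s n, snd z)) \<in> measurable ?M ?M" by measurable
    let ?A = "(\<lambda>z. (fst z + s n, snd z)) -` C \<inter> space ?M"
    have "?A \<in> sets ?M" by (rule measurable_sets[OF tm C])
    moreover have "cball 0 1 \<times> space P \<in> sets ?M" by simp
    moreover have "G n = (cball 0 1 \<times> space P) \<inter> ((?A - C) \<union> (C - ?A))"
      using sets.sets_into_space[OF C] unfolding G_def by (auto simp: space_pair_measure)
    ultimately show ?thesis using C by (simp add: sets.Int sets.Un sets.Diff)
  qed
  have meas_G: "emeasure ?M (G n) = ?q n * emeasure lborel (cball (0 :: real ^ 'd) 1)" for n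
  proof -
    have "Pair t -` G n = (if t \<in> cball 0 1 then {\<omega> \<in> space P. (X (t + s n) \<omega> \<in> B) \<noteq> (X t \<omega> \<in> B)} else {})" for t
      by (auto simp: G_def C_def space_pair_measure)
    then have "emeasure P (Pair t -` G n) = ?q n * indicator (cball 0 1) t" for t
      using pair[of t n] by (simp add: indicator_def)
    then show ?thesis using P.emeasure_pair_measure_alt[OF Gm] by (simp add: nn_integral_cmult_indicator)
  qed
  define V where "V = measure lborel (cball (0 :: real ^ 'd) 1)"
  have V: "V > 0" unfolding V_def by (rule content_cball_pos) simp
  have "measure ?M (G n) = measure P {\<omega> \<in> space P. (X (s n) \<omega> \<in> B) \<noteq> (X 0 \<omega> \<in> B)} * V" for n
    unfolding measure_def[of ?M] meas_G by (simp add: enn2real_mult measure_def V_def)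
  moreover have "(\<lambda>n. measure ?M (G n)) \<longlonglongrightarrow> 0"
    unfolding G_def by (rule translation_continuity[OF P s s1 C])
  ultimately have "(\<lambda>n. measure P {\<omega> \<in> space P. (X (s n) \<omega> \<in> B) \<noteq> (X 0 \<omega> \<in> B)} * V / V) \<longlonglongrightarrow> 0 / V"
    using V by (intro tendsto_divide) auto
  then show ?thesis using V by simp
qed

text \<open>Values are sorted into cells of width 1/c. Outside a small event, X 0 lies in one of
  finitely many cells and X (s n) lies in the same cell, so the increment is at most 1/c.\<close>

lemma char_increment_tendsto:
  fixes X :: "real ^ 'd \<Rightarrow> 'w \<Rightarrow> real"
  assumes P: "prob_space P" and X: "measurable_field P RealCase X" and st: "stationary_field P RealCase X"
    and s: "s \<longlonglongrightarrow> 0" and s1: "\<And>n. norm (s n) \<le> 1"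
  shows "(\<lambda>n. CLINT \<omega>|P. cis (X (s n) \<omega> - X 0 \<omega>)) \<longlonglongrightarrow> 1"
proof (rule tendstoI)
  interpret P: prob_space P by fact
  have Xt [measurable]: "X t \<in> borel_measurable P" for t using X by (simp add: measurable_field_def index_set_def)
  fix e :: real assume e: "e > 0"
  obtain m :: nat where m: "1 / real (Suc m) < e / 2" using nat_approx_posE[of "e/2"] e by auto
  define c where "c = real (Suc m)"
  have c: "c > 0" "1 / c < e / 2" using m by (auto simp: c_def)
  define B where "B k = {x :: real. \<lfloor>c * x\<rfloor> = k}" for k
  have Bm: "B k \<in> sets borel" for k
  proof -
    have "{x \<in> space borel. \<lfloor>c * x\<rfloor> = k} \<in> sets (borel :: real measure)" by measurable
    then show ?thesis by (simp add: B_def)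
  qed
  define F where "F L = {\<omega> \<in> space P. \<bar>X 0 \<omega>\<bar> \<ge> real L}" for L
  have Fm [measurable]: "F L \<in> sets P" for L unfolding F_def by measurable
  have "(\<lambda>L. P.prob (F L)) \<longlonglongrightarrow> P.prob (\<Inter>L. F L)"
    by (rule P.finite_Lim_measure_decseq) (auto simp: F_def decseq_def)
  moreover have "(\<Inter>L. F L) = {}"
  proof -
    have "\<omega> \<notin> (\<Inter>L. F L)" for \<omega>
      using reals_Archimedean2[of "\<bar>X 0 \<omega>\<bar>"] by (auto simp: F_def not_le)
    then show ?thesis by blast
  qed
  ultimately have "(\<lambda>L. P.prob (F L)) \<longlonglongrightarrow> 0" by simp
  \<comment> \<open>With another e/8 for the finitely many cells, the exceptional event has
    probability below e/4. It enters with the factor 2, next to 1/c < e/2.\<close>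
  from order_tendstoD(2)[OF this, of "e/8"] e obtain L where L: "P.prob (F L) < e / 8"
    by (auto simp: eventually_sequentially)
  define K where "K = {\<lfloor>c * (- real L)\<rfloor>..\<lfloor>c * real L\<rfloor>}"
  define D where "D k n = {\<omega> \<in> space P. (X (s n) \<omega> \<in> B k) \<noteq> (X 0 \<omega> \<in> B k)}" for k n
  have Dm [measurable]: "D k n \<in> sets P" for k n
  proof -
    have "{\<omega> \<in> space P. X t \<omega> \<in> B k} \<in> sets P" for t using Bm by measurable
    moreover have "D k n = ({\<omega> \<in> space P. X (s n) \<omega> \<in> B k} - {\<omega> \<in> space P. X 0 \<omega> \<in> B k}) \<union> ({\<omega> \<in> space P. X 0 \<omega> \<in> B k} - {\<omega> \<in> space P. X (s n) \<omega> \<in> B k})"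
      by (auto simp: D_def)
    ultimately show ?thesis by (simp only: sets.Un sets.Diff)
  qed
  define U where "U n = F L \<union> (\<Union>k\<in>K. D k n)" for n
  have Um [measurable]: "U n \<in> sets P" for n unfolding U_def by (auto simp: K_def)
  have Ubound: "P.prob (U n) \<le> P.prob (F L) + (\<Sum>k\<in>K. P.prob (D k n))" for n
  proof -
    have "P.prob (U n) \<le> P.prob (F L) + P.prob (\<Union>k\<in>K. D k n)"
      unfolding U_def by (rule measure_Un_le) (auto simp: K_def)
    also have "P.prob (\<Union>k\<in>K. D k n) \<le> (\<Sum>k\<in>K. P.prob (D k n))"
      by (rule P.finite_measure_subadditive_finite) (auto simp: K_def)
    finally show ?thesis by simp
  qed
  have close: "\<bar>X (s n) \<omega> - X 0 \<omega>\<bar> \<le> 1 / c" if "\<omega> \<in> space P" "\<omega> \<notin> U n" for \<omega> n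
  proof -
    let ?k = "\<lfloor>c * X 0 \<omega>\<rfloor>"
    have "\<bar>X 0 \<omega>\<bar> < real L" using that by (auto simp: U_def F_def)
    then have "c * (- real L) \<le> c * X 0 \<omega>" "c * X 0 \<omega> \<le> c * real L" using c(1) by (intro mult_left_mono; linarith)+
    then have "?k \<in> K" unfolding K_def by (intro atLeastAtMost_iff[THEN iffD2] conjI floor_mono)
    then have "\<omega> \<notin> D ?k n" using that by (auto simp: U_def)
    then have "\<lfloor>c * X (s n) \<omega>\<rfloor> = ?k" using that(1) by (auto simp: D_def B_def)
    then have "\<bar>c * X (s n) \<omega> - c * X 0 \<omega>\<bar> \<le> 1" by linarith
    then have "c * \<bar>X (s n) \<omega> - X 0 \<omega>\<bar> \<le> 1" using c(1) by (simp add: abs_mult flip: right_diff_distrib)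
    then show ?thesis using c(1) by (simp add: field_simps)
  qed
  have est: "norm ((CLINT \<omega>|P. cis (X (s n) \<omega> - X 0 \<omega>)) - 1) \<le> 1 / c + 2 * P.prob (U n)" for n
  proof -
    have i: "integrable P (\<lambda>\<omega>. cis (X (s n) \<omega> - X 0 \<omega>))"
    proof (rule P.integrable_const_bound[of _ 1])
      have "cis \<in> borel_measurable borel" by (intro borel_measurable_continuous_onI continuous_on_cis continuous_on_id)
      then show "(\<lambda>\<omega>. cis (X (s n) \<omega> - X 0 \<omega>)) \<in> borel_measurable P"
        by (rule measurable_compose[rotated]) measurable
    qed auto
    have "(CLINT \<omega>|P. cis (X (s n) \<omega> - X 0 \<omega>)) - 1 = (CLINT \<omega>|P. cis (X (s n) \<omega> - X 0 \<omega>) - 1)"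
      using i by (simp add: P.prob_space)
    also have "norm \<dots> \<le> (\<integral>\<omega>. norm (cis (X (s n) \<omega> - X 0 \<omega>) - 1) \<partial>P)" by (rule integral_norm_bound)
    also have "\<dots> \<le> (\<integral>\<omega>. 1 / c + 2 * indicator (U n) \<omega> \<partial>P)"
    proof (rule integral_mono)
      show "integrable P (\<lambda>\<omega>. norm (cis (X (s n) \<omega> - X 0 \<omega>) - 1))" using i by simp
      show "integrable P (\<lambda>\<omega>. 1 / c + 2 * indicator (U n) \<omega>)"
        by (intro Bochner_Integration.integrable_add integrable_mult_right integrable_real_indicator) (auto simp: P.emeasure_eq_measure)
      fix \<omega> assume \<omega>: "\<omega> \<in> space P"
      show "norm (cis (X (s n) \<omega> - X 0 \<omega>) - 1) \<le> 1 / c + 2 * indicator (U n) \<omega>"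
      proof (cases "\<omega> \<in> U n")
        case True
        then show ?thesis using norm_triangle_ineq4[of "cis (X (s n) \<omega> - X 0 \<omega>)" 1] c(1) by (simp add: add_increasing)
      next
        case False
        have "norm (cis u - 1) \<le> \<bar>u\<bar>" for u
          using iexp_approx1[of u 0] by (simp add: cis_conv_exp)
        from this[of "X (s n) \<omega> - X 0 \<omega>"] show ?thesis using close[OF \<omega> False] False by simp
      qed
    qed
    also have "\<dots> = 1 / c + 2 * P.prob (U n)"
      using sets.sets_into_space[OF Um] by (subst Bochner_Integration.integral_add) (auto simp: P.prob_space P.emeasure_eq_measure Int_absorb2)
    finally show ?thesis .
  qed
  have "(\<lambda>n. \<Sum>k\<in>K. P.prob (D k n)) \<longlonglongrightarrow> (\<Sum>k\<in>K. 0)"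
    unfolding D_def by (intro tendsto_sum stochastic_continuity[OF P X st s s1 Bm])
  then have "eventually (\<lambda>n. (\<Sum>k\<in>K. P.prob (D k n)) < e / 8) sequentially"
    using e by (intro order_tendstoD(2)) auto
  then show "eventually (\<lambda>n. dist (CLINT \<omega>|P. cis (X (s n) \<omega> - X 0 \<omega>)) 1 < e) sequentially"
  proof eventually_elim
    case (elim n)
    show ?case unfolding dist_norm using est[of n] Ubound[of n] L elim c(2) by linarith
  qed
qed

section \<open>The mean ergodic argument\<close>

text \<open>The limit is taken along a subsequence converging almost everywhere, and the Fatou lemma
  transfers the Cauchy bound to it.\<close>

lemma L1_complete:
  fixes w :: "nat \<Rightarrow> 's \<Rightarrow> real"
  assumes w: "\<And>n. integrable M (w n)"
    and cauchy: "\<And>e. e > 0 \<Longrightarrow> \<exists>N. \<forall>i\<ge>N. \<forall>j\<ge>N. (\<integral>x. \<bar>w i x - w j x\<bar> \<partial>M) < e"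
  obtains u where "integrable M u" "(\<lambda>n. \<integral>x. \<bar>w n x - u x\<bar> \<partial>M) \<longlonglongrightarrow> 0"
proof -
  obtain r where r: "strict_mono r" and C: "AE x in M. Cauchy (\<lambda>i. w (r i) x)"
    by (rule cauchy_L1_AE_cauchy_subseq[of M w]) (use assms in auto)
  have [measurable]: "w n \<in> borel_measurable M" for n using w by auto
  define u where "u x = lim (\<lambda>i. w (r i) x)" for x
  have um [measurable]: "u \<in> borel_measurable M" unfolding u_def by measurable
  have lim: "AE x in M. (\<lambda>i. w (r i) x) \<longlonglongrightarrow> u x"
    using C by eventually_elim (auto simp: u_def Cauchy_convergent_iff convergent_LIMSEQ_iff)
  have est: "(\<integral>\<^sup>+x. ennreal \<bar>w n x - u x\<bar> \<partial>M) \<le> ennreal e"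
    if "\<And>j. j \<ge> N \<Longrightarrow> (\<integral>x. \<bar>w n x - w j x\<bar> \<partial>M) \<le> e" for n N e
  proof -
    have "(\<integral>\<^sup>+x. ennreal \<bar>w n x - u x\<bar> \<partial>M) = (\<integral>\<^sup>+x. liminf (\<lambda>i. ennreal \<bar>w n x - w (r i) x\<bar>) \<partial>M)"
    proof (rule nn_integral_cong_AE)
      show "AE x in M. ennreal \<bar>w n x - u x\<bar> = liminf (\<lambda>i. ennreal \<bar>w n x - w (r i) x\<bar>)"
        using lim
      proof eventually_elim
        case (elim x)
        have "(\<lambda>i. ennreal \<bar>w n x - w (r i) x\<bar>) \<longlonglongrightarrow> ennreal \<bar>w n x - u x\<bar>"
          by (intro tendsto_ennrealI tendsto_rabs tendsto_diff tendsto_const elim)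
        then show ?case by (rule lim_imp_Liminf[OF sequentially_bot, symmetric])
      qed
    qed
    also have "\<dots> \<le> liminf (\<lambda>i. \<integral>\<^sup>+x. ennreal \<bar>w n x - w (r i) x\<bar> \<partial>M)"
      by (rule nn_integral_liminf) measurable
    also have "\<dots> \<le> liminf (\<lambda>i. ennreal e)"
    proof (rule Liminf_mono)
      show "eventually (\<lambda>i. (\<integral>\<^sup>+x. ennreal \<bar>w n x - w (r i) x\<bar> \<partial>M) \<le> ennreal e) sequentially"
        using eventually_ge_at_top[of N]
      proof eventually_elim
        case (elim i)
        have "r i \<ge> N" using elim seq_suble[OF r, of i] by linarith
        then show ?case using that w by (subst nn_integral_eq_integral) (auto intro!: ennreal_leI)
      qed
    qed
    also have "\<dots> = ennreal e" by (simp add: Liminf_const)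
    finally show ?thesis .
  qed
  have int_diff: "integrable M (\<lambda>x. \<bar>w n x - u x\<bar>) \<and> (\<integral>x. \<bar>w n x - u x\<bar> \<partial>M) \<le> e"
    if "\<And>j. j \<ge> N \<Longrightarrow> (\<integral>x. \<bar>w n x - w j x\<bar> \<partial>M) \<le> e" "e \<ge> 0" for n N e
  proof -
    have fin: "(\<integral>\<^sup>+x. ennreal \<bar>w n x - u x\<bar> \<partial>M) \<le> ennreal e" by (rule est[OF that(1)])
    then have "integrable M (\<lambda>x. \<bar>w n x - u x\<bar>)"
      by (intro integrableI_nonneg) (auto intro: le_less_trans)
    moreover from this fin have "(\<integral>x. \<bar>w n x - u x\<bar> \<partial>M) \<le> e"
      using that(2) by (subst (asm) nn_integral_eq_integral) auto
    ultimately show ?thesis by simp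
  qed
  have ev: "\<exists>N. \<forall>n\<ge>N. integrable M (\<lambda>x. \<bar>w n x - u x\<bar>) \<and> (\<integral>x. \<bar>w n x - u x\<bar> \<partial>M) \<le> e" if e: "e > 0" for e
  proof -
    obtain N where N: "\<And>i j. i \<ge> N \<Longrightarrow> j \<ge> N \<Longrightarrow> (\<integral>x. \<bar>w i x - w j x\<bar> \<partial>M) < e" using cauchy[OF e] by auto
    have "integrable M (\<lambda>x. \<bar>w n x - u x\<bar>) \<and> (\<integral>x. \<bar>w n x - u x\<bar> \<partial>M) \<le> e" if "n \<ge> N" for n
      by (rule int_diff[of N]) (use N[OF that] e in \<open>auto intro: less_imp_le\<close>)
    then show ?thesis by blast
  qed
  show thesis
  proof
    obtain n where "integrable M (\<lambda>x. \<bar>w n x - u x\<bar>)" using ev[of 1] by auto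
    then have "integrable M (\<lambda>x. w n x - u x)" by (subst (asm) integrable_abs_iff) auto
    then have "integrable M (\<lambda>x. w n x - (w n x - u x))" by (rule Bochner_Integration.integrable_diff[OF w])
    then show "integrable M u" by simp
    show "(\<lambda>n. \<integral>x. \<bar>w n x - u x\<bar> \<partial>M) \<longlonglongrightarrow> 0"
    proof (rule LIMSEQ_I)
      fix e :: real assume "e > 0"
      then obtain N where "\<forall>n\<ge>N. (\<integral>x. \<bar>w n x - u x\<bar> \<partial>M) \<le> e / 2" using ev[of "e/2"] by auto
      then show "\<exists>N. \<forall>n\<ge>N. norm ((\<integral>x. \<bar>w n x - u x\<bar> \<partial>M) - 0) < e"
        using \<open>e > 0\<close> by (intro exI[of _ N]) (auto intro: le_less_trans)
    qed
  qed
qed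

lemma countable_lattice: "countable (lattice :: (real ^ 'd) set)"
proof -
  have "lattice \<subseteq> (\<Union>n :: nat. box_B IntCase (real (Suc n)) :: (real ^ 'd) set)"
  proof
    fix t :: "real ^ 'd" assume t: "t \<in> lattice"
    obtain n :: nat where n: "sup_norm t < real n" using reals_Archimedean2 by blast
    have "- real (Suc n) < t $ i \<and> t $ i \<le> real (Suc n)" for i
      using component_le_sup_norm[of t i] n by auto
    then show "t \<in> (\<Union>n :: nat. box_B IntCase (real (Suc n)))" using t by (auto simp: box_B_def index_set_def)
  qed
  moreover have "countable (\<Union>n :: nat. box_B IntCase (real (Suc n)) :: (real ^ 'd) set)"
    by (rule countable_UN) (auto intro!: countable_finite card_int_box(1) simp del: of_nat_Suc)
  ultimately show ?thesis by (rule countable_subset)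
qed

section \<open>Continuity of the kernel and the minimal-norm argument\<close>

context sas_field
begin

text \<open>The characteristic function of X s - X 0 at frequency 1 is the exponential of minus this
  norm, so stochastic continuity forces the norm to 0.\<close>

lemma increment_norm_small:
  assumes tc: "tc = RealCase" and e: "e > 0"
  shows "\<exists>d>0. \<forall>s. norm s < d \<longrightarrow> (\<integral>x. \<bar>f s x - f 0 x\<bar> powr \<alpha> \<partial>\<mu>) < e"
proof (rule ccontr)
  assume "\<not> ?thesis"
  then have "\<forall>n. \<exists>s. norm s < 1 / real (Suc n) \<and> e \<le> (\<integral>x. \<bar>f s x - f 0 x\<bar> powr \<alpha> \<partial>\<mu>)"
    by (metis not_less of_nat_0_less_iff zero_less_Suc zero_less_divide_1_iff)
  then obtain s where s: "\<And>n. norm (s n) < 1 / real (Suc n)" "\<And>n. e \<le> (\<integral>x. \<bar>f (s n) x - f 0 x\<bar> powr \<alpha> \<partial>\<mu>)" by metis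
  have I: "t \<in> index_set tc" for t using tc by (simp add: index_set_def)
  have lim: "s \<longlonglongrightarrow> 0"
    by (rule Lim_null_comparison[OF _ LIMSEQ_Suc[OF lim_1_over_n]]) (rule always_eventually, rule allI, rule less_imp_le, rule s(1))
  have "norm (s n) \<le> 1" for n
  proof -
    have "1 / real (Suc n) \<le> 1" by simp
    then show ?thesis using s(1)[of n] by linarith
  qed
  then have "(\<lambda>n. CLINT \<omega>|P. cis (X (s n) \<omega> - X 0 \<omega>)) \<longlonglongrightarrow> 1"
    using field_measurable stationary tc P.prob_space_axioms lim by (intro char_increment_tendsto) auto
  moreover have "(CLINT \<omega>|P. cis (X (s n) \<omega> - X 0 \<omega>)) = complex_of_real (exp (- (\<integral>x. \<bar>f (s n) x - f 0 x\<bar> powr \<alpha> \<partial>\<mu>)))" for n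
    using characteristic_function[of UNIV "\<lambda>b. if b then s n else 0" "\<lambda>b. if b then 1 else -1", OF finite I]
    by (simp add: UNIV_bool algebra_simps)
  ultimately have "(\<lambda>n. complex_of_real (exp (- (\<integral>x. \<bar>f (s n) x - f 0 x\<bar> powr \<alpha> \<partial>\<mu>)))) \<longlonglongrightarrow> complex_of_real 1"
    by (simp del: of_real_exp)
  then have "(\<lambda>n. exp (- (\<integral>x. \<bar>f (s n) x - f 0 x\<bar> powr \<alpha> \<partial>\<mu>))) \<longlonglongrightarrow> 1"
    by (simp only: tendsto_of_real_iff)
  moreover have "exp (- (\<integral>x. \<bar>f (s n) x - f 0 x\<bar> powr \<alpha> \<partial>\<mu>)) \<le> exp (- e)" for n using s(2)[of n] by simp
  ultimately have "1 \<le> exp (- e)" by (intro LIMSEQ_le_const2) auto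
  then show False using e by simp
qed

text \<open>The difference of two half powers is at most the half power of the difference. So
  continuity of f in L^\<alpha> passes to continuity of v in L2, and stationarity makes it uniform
  in t.\<close>

lemma kernel_uniformly_continuous:
  assumes tc: "tc = RealCase" and e: "e > 0"
  shows "\<exists>d>0. \<forall>s t. norm s < d \<longrightarrow> \<bar>kernel (t + s) - kernel t\<bar> \<le> e"
proof -
  have I: "t \<in> index_set tc" for t using tc by (simp add: index_set_def)
  \<comment> \<open>Chosen so that \<open>sqrt (kernel 0) * sqrt e'\<close> is at most e; the added
    1 covers the case \<open>kernel 0 = 0\<close>.\<close>
  define e' where "e' = (e / (sqrt (kernel 0) + 1))\<^sup>2"
  have k0: "sqrt (kernel 0) + 1 > 0" using kernel_nonneg[of 0] by (simp add: add_nonneg_pos)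
  have "e' > 0" unfolding e'_def using e k0 by simp
  then obtain d where d: "d > 0" "\<And>s. norm s < d \<Longrightarrow> (\<integral>x. \<bar>f s x - f 0 x\<bar> powr \<alpha> \<partial>\<mu>) < e'"
    using increment_norm_small[OF tc] by blast
  have "\<bar>kernel (t + s) - kernel t\<bar> \<le> e" if s: "norm s < d" for s t
  proof -
    have p: "0 < \<alpha> / 2" "\<alpha> / 2 \<le> 1" using alpha by auto
    note [measurable] = v_measurable[OF I]
    have eqf: "(\<integral>x. \<bar>f (t + s) x - f t x\<bar> powr \<alpha> \<partial>\<mu>) = (\<integral>x. \<bar>f s x - f 0 x\<bar> powr \<alpha> \<partial>\<mu>)"
      using spectral_norm_shift[of UNIV "\<lambda>b. if b then s else 0" t "\<lambda>b. if b then 1 else -1", OF finite I I]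
      by (simp add: UNIV_bool algebra_simps)
    have fint: "integrable \<mu> (\<lambda>x. \<bar>f (t + s) x - f t x\<bar> powr \<alpha>)"
      using linear_combination_integrable[of UNIV "\<lambda>b. if b then t + s else t" "\<lambda>b. if b then 1 else -1", OF finite I]
      by (simp add: UNIV_bool algebra_simps)
    have pw: "(v (t + s) x - v t x)\<^sup>2 \<le> \<bar>f (t + s) x - f t x\<bar> powr \<alpha>" for x
      using power_mono[OF abs_powr_diff_le[OF p, of "f (t + s) x" "f t x"], of 2]
      by (simp add: v_def abs_powr_half_square)
    have vint: "integrable \<mu> (\<lambda>x. (v (t + s) x - v t x)\<^sup>2)"
      by (rule Bochner_Integration.integrable_bound[OF fint]) (use pw in auto)
    have "(\<integral>x. (v (t + s) x - v t x)\<^sup>2 \<partial>\<mu>) \<le> e'"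
      using integral_mono[OF vint fint pw] d(2)[OF s] eqf by simp
    then have "sqrt (\<integral>x. (v (t + s) x - v t x)\<^sup>2 \<partial>\<mu>) \<le> sqrt e'" by simp
    also have "sqrt e' = e / (sqrt (kernel 0) + 1)" unfolding e'_def using e k0 by simp
    finally have sq: "sqrt (\<integral>x. (v (t + s) x - v t x)\<^sup>2 \<partial>\<mu>) \<le> e / (sqrt (kernel 0) + 1)" .
    have "kernel (t + s) - kernel t = (\<integral>x. v 0 x * (v (t + s) x - v t x) \<partial>\<mu>)"
      unfolding kernel_def using v_integrable[OF I I] by (simp add: right_diff_distrib)
    also have "\<bar>\<dots>\<bar> \<le> sqrt (\<integral>x. (v 0 x)\<^sup>2 \<partial>\<mu>) * sqrt (\<integral>x. (v (t + s) x - v t x)\<^sup>2 \<partial>\<mu>)"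
      by (rule cauchy_schwarz_integral(2)) (use vint v_square_integrable[OF I] in auto)
    also have "\<dots> \<le> sqrt (kernel 0) * (e / (sqrt (kernel 0) + 1))"
      using sq v_norm[OF I, of 0] kernel_nonneg[of 0] by (intro mult_mono) auto
    also have "\<dots> \<le> e" using e k0 by (simp add: field_simps)
    finally show ?thesis .
  qed
  with d(1) show ?thesis by blast
qed

text \<open>Over the reals measurability comes from continuity, because f is assumed measurable only
  for each fixed time.\<close>

lemma kernel_bounded_measurable: "bounded_measurable tc kernel"
proof (rule bounded_measurableI)
  show "\<bar>kernel t\<bar> \<le> kernel 0" if "t \<in> index_set tc" for t
    using kernel_nonneg[of t] kernel_le[OF that] by simp
  show "kernel \<in> borel_measurable (index_measure tc)"
  proof (cases tc)
    case IntCase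
    then show ?thesis by (simp add: index_measure_def)
  next
    case RealCase
    have "continuous_on UNIV kernel"
      unfolding continuous_on_iff
    proof (intro ballI allI impI)
      fix t :: "real ^ 'd" and e :: real assume "e > 0"
      then obtain d where d: "d > 0" "\<And>s t. norm s < d \<Longrightarrow> \<bar>kernel (t + s) - kernel t\<bar> \<le> e / 2"
        using kernel_uniformly_continuous[OF RealCase, of "e/2"] by auto
      have "dist (kernel u) (kernel t) < e" if "dist u t < d" for u
        using d(2)[of "u - t" t] that \<open>e > 0\<close> by (simp add: dist_norm)
      with d(1) show "\<exists>d>0. \<forall>u\<in>UNIV. dist u t < d \<longrightarrow> dist (kernel u) (kernel t) < e" by blast
    qed
    then show ?thesis by (intro borel_measurable_index_measure borel_measurable_continuous_onI)
  qed
qed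

text \<open>On the lattice all shifts are listed; over the reals a countable dense set suffices,
  since uniform continuity makes the approximation uniform in t.\<close>

lemma kernel_countable_shifts:
  obtains s :: "nat \<Rightarrow> real ^ 'd" where "\<And>k. s k \<in> index_set tc"
    "\<And>r e. r \<in> index_set tc \<Longrightarrow> e > 0 \<Longrightarrow> \<exists>k. \<forall>t. \<bar>kernel (t + r) - kernel (t + s k)\<bar> \<le> e"
proof (cases tc)
  case IntCase
  have ne: "(lattice :: (real ^ 'd) set) \<noteq> {}" using index_set_zero[of IntCase] by (auto simp: index_set_def)
  show thesis
  proof
    show "from_nat_into lattice k \<in> (index_set tc :: (real ^ 'd) set)" for k
      using from_nat_into[OF ne] IntCase by (simp add: index_set_def)
    fix r :: "real ^ 'd" and e :: real assume r: "r \<in> index_set tc" "e > 0"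
    then obtain k where "from_nat_into lattice k = r"
      using from_nat_into_surj[OF countable_lattice, of r] IntCase by (auto simp: index_set_def)
    then show "\<exists>k. \<forall>t. \<bar>kernel (t + r) - kernel (t + from_nat_into lattice k)\<bar> \<le> e"
      using r(2) by (intro exI[of _ k]) simp
  qed
next
  case RealCase
  obtain D :: "(real ^ 'd) set" where D: "countable D" "\<And>Y. open Y \<Longrightarrow> Y \<noteq> {} \<Longrightarrow> \<exists>d\<in>D. d \<in> Y"
    using countable_dense_exists by blast
  have ne: "D \<noteq> {}" using D(2)[of UNIV] by auto
  show thesis
  proof
    show "from_nat_into D k \<in> index_set tc" for k using RealCase by (simp add: index_set_def)
    fix r :: "real ^ 'd" and e :: real assume "e > 0"
    then obtain d where d: "d > 0" "\<And>s t. norm s < d \<Longrightarrow> \<bar>kernel (t + s) - kernel t\<bar> \<le> e"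
      using kernel_uniformly_continuous[OF RealCase] by blast
    obtain y where y: "y \<in> D" "y \<in> ball r d" using D(2)[of "ball r d"] d(1) by auto
    obtain k where k: "from_nat_into D k = y" using from_nat_into_surj[OF D(1) y(1)] by auto
    have "\<bar>kernel (t + r) - kernel (t + y)\<bar> \<le> e" for t
      using d(2)[of "r - y" "t + y"] y(2) by (simp add: dist_norm algebra_simps)
    then show "\<exists>k. \<forall>t. \<bar>kernel (t + r) - kernel (t + from_nat_into D k)\<bar> \<le> e"
      using k by (intro exI[of _ k]) simp
  qed
qed

text \<open>The squared L2 norm, read off at time 0 because it is the same at all times of the
  orbit.\<close>

definition mean_norm :: "(real ^ 'd \<Rightarrow> 's \<Rightarrow> real) \<Rightarrow> real" where
  "mean_norm \<beta> = (\<integral>x. (\<beta> 0 x)\<^sup>2 \<partial>\<mu>)"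

lemma mean_norm_nonneg: "0 \<le> mean_norm \<beta>" by (simp add: mean_norm_def)

lemma mean_norm_translate:
  assumes "\<beta> \<in> orbit_means" "r \<in> index_set tc"
  shows "mean_norm (\<lambda>s. \<beta> (r + s)) = mean_norm \<beta>"
  using orbit_means_norm[OF assms] by (simp add: mean_norm_def)

lemma orbit_means_parallelogram:
  assumes b: "\<beta> \<in> orbit_means" and g: "\<gamma> \<in> orbit_means"
  shows "(\<integral>x. (\<beta> 0 x - \<gamma> 0 x)\<^sup>2 \<partial>\<mu>) + 4 * mean_norm (\<lambda>s x. (\<beta> s x + \<gamma> s x) / 2) = 2 * mean_norm \<beta> + 2 * mean_norm \<gamma>"
    and "integrable \<mu> (\<lambda>x. (\<beta> 0 x - \<gamma> 0 x)\<^sup>2)"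
proof -
  note B = orbit_means_basic[OF b index_set_zero] and G = orbit_means_basic[OF g index_set_zero]
  have i: "integrable \<mu> (\<lambda>x. (\<beta> 0 x)\<^sup>2)" "integrable \<mu> (\<lambda>x. (\<gamma> 0 x)\<^sup>2)" "integrable \<mu> (\<lambda>x. \<beta> 0 x * \<gamma> 0 x)"
    using B G orbit_means_integrable[OF b g index_set_zero index_set_zero] by auto
  have d: "(\<beta> 0 x - \<gamma> 0 x)\<^sup>2 = (\<beta> 0 x)\<^sup>2 - 2 * (\<beta> 0 x * \<gamma> 0 x) + (\<gamma> 0 x)\<^sup>2" for x
    by (simp add: power2_eq_square algebra_simps)
  have s: "((\<beta> 0 x + \<gamma> 0 x) / 2)\<^sup>2 = ((\<beta> 0 x)\<^sup>2 + 2 * (\<beta> 0 x * \<gamma> 0 x) + (\<gamma> 0 x)\<^sup>2) / 4" for x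
    by (simp add: power2_eq_square algebra_simps)
  show "integrable \<mu> (\<lambda>x. (\<beta> 0 x - \<gamma> 0 x)\<^sup>2)" unfolding d using i by simp
  have "(\<integral>x. (\<beta> 0 x - \<gamma> 0 x)\<^sup>2 \<partial>\<mu>) = mean_norm \<beta> - 2 * (\<integral>x. \<beta> 0 x * \<gamma> 0 x \<partial>\<mu>) + mean_norm \<gamma>"
    unfolding d mean_norm_def using i by simp
  moreover have "4 * mean_norm (\<lambda>s x. (\<beta> s x + \<gamma> s x) / 2) = mean_norm \<beta> + 2 * (\<integral>x. \<beta> 0 x * \<gamma> 0 x \<partial>\<mu>) + mean_norm \<gamma>"
    unfolding mean_norm_def s using i by simp
  ultimately show "(\<integral>x. (\<beta> 0 x - \<gamma> 0 x)\<^sup>2 \<partial>\<mu>) + 4 * mean_norm (\<lambda>s x. (\<beta> s x + \<gamma> s x) / 2) = 2 * mean_norm \<beta> + 2 * mean_norm \<gamma>"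
    by simp
qed

text \<open>The midpoint is again a member, so its norm is at least m, and the parallelogram law
  bounds the squared distance by 4e. Factoring the difference of squares and applying Cauchy-Schwarz
  passes from L2 distance to L1 distance of the squares, which are the densities of
  interest.\<close>

lemma orbit_means_square_diff:
  assumes b: "\<beta> \<in> orbit_means" and g: "\<gamma> \<in> orbit_means"
    and m: "\<And>\<delta>. \<delta> \<in> orbit_means \<Longrightarrow> m \<le> mean_norm \<delta>"
    and bd: "mean_norm \<beta> \<le> m + e" "mean_norm \<gamma> \<le> m + e" "e \<le> 1"
  shows "(\<integral>x. \<bar>(\<beta> 0 x)\<^sup>2 - (\<gamma> 0 x)\<^sup>2\<bar> \<partial>\<mu>) \<le> sqrt (4 * e) * sqrt (4 * (m + 1))"
proof -
  note B = orbit_means_basic[OF b index_set_zero] and G = orbit_means_basic[OF g index_set_zero]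
  note mid = orbit_means.midpoint[OF b g]
  note pl = orbit_means_parallelogram[OF b g]
  have [measurable]: "\<beta> 0 \<in> borel_measurable \<mu>" "\<gamma> 0 \<in> borel_measurable \<mu>" using B G by auto
  have d2: "(\<integral>x. \<bar>\<beta> 0 x - \<gamma> 0 x\<bar>\<^sup>2 \<partial>\<mu>) \<le> 4 * e" using pl(1) m[OF mid] bd by simp
  have sq4: "(\<beta> 0 x + \<gamma> 0 x)\<^sup>2 = 4 * ((\<beta> 0 x + \<gamma> 0 x) / 2)\<^sup>2" for x by (simp add: power2_eq_square)
  have si: "integrable \<mu> (\<lambda>x. (\<beta> 0 x + \<gamma> 0 x)\<^sup>2)"
    unfolding sq4 using orbit_means_basic[OF mid index_set_zero] by simp
  have s2: "(\<integral>x. (\<beta> 0 x + \<gamma> 0 x)\<^sup>2 \<partial>\<mu>) \<le> 4 * (m + 1)"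
  proof -
    have "(\<integral>x. (\<beta> 0 x + \<gamma> 0 x)\<^sup>2 \<partial>\<mu>) = 4 * mean_norm (\<lambda>s x. (\<beta> s x + \<gamma> s x) / 2)"
      unfolding sq4 mean_norm_def by simp
    moreover have "0 \<le> (\<integral>x. (\<beta> 0 x - \<gamma> 0 x)\<^sup>2 \<partial>\<mu>)" by simp
    moreover define D S where "D = (\<integral>x. (\<beta> 0 x - \<gamma> 0 x)\<^sup>2 \<partial>\<mu>)" and "S = mean_norm (\<lambda>s x. (\<beta> s x + \<gamma> s x) / 2)"
    ultimately have "(\<integral>x. (\<beta> 0 x + \<gamma> 0 x)\<^sup>2 \<partial>\<mu>) = 4 * S" "0 \<le> D" "D + 4 * S = 2 * mean_norm \<beta> + 2 * mean_norm \<gamma>"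
      using pl(1) by simp_all
    then show ?thesis using bd by argo
  qed
  have "(\<integral>x. \<bar>(\<beta> 0 x)\<^sup>2 - (\<gamma> 0 x)\<^sup>2\<bar> \<partial>\<mu>) = (\<integral>x. \<bar>\<beta> 0 x - \<gamma> 0 x\<bar> * (\<beta> 0 x + \<gamma> 0 x) \<partial>\<mu>)"
  proof (rule Bochner_Integration.integral_cong[OF refl])
    fix x
    have "(\<beta> 0 x)\<^sup>2 - (\<gamma> 0 x)\<^sup>2 = (\<beta> 0 x - \<gamma> 0 x) * (\<beta> 0 x + \<gamma> 0 x)" by (simp add: power2_eq_square algebra_simps)
    moreover have "0 \<le> \<beta> 0 x + \<gamma> 0 x" using B G by simp
    ultimately show "\<bar>(\<beta> 0 x)\<^sup>2 - (\<gamma> 0 x)\<^sup>2\<bar> = \<bar>\<beta> 0 x - \<gamma> 0 x\<bar> * (\<beta> 0 x + \<gamma> 0 x)" by (simp add: abs_mult)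
  qed
  also have "\<dots> \<le> sqrt (\<integral>x. \<bar>\<beta> 0 x - \<gamma> 0 x\<bar>\<^sup>2 \<partial>\<mu>) * sqrt (\<integral>x. (\<beta> 0 x + \<gamma> 0 x)\<^sup>2 \<partial>\<mu>)"
    by (rule order_trans[OF abs_ge_self cauchy_schwarz_integral(2)]) (use si pl(2) in auto)
  also have "\<dots> \<le> sqrt (4 * e) * sqrt (4 * (m + 1))"
  proof (intro mult_mono real_sqrt_le_mono d2 s2)
    have "0 \<le> (\<integral>x. \<bar>\<beta> 0 x - \<gamma> 0 x\<bar>\<^sup>2 \<partial>\<mu>)" by simp
    from order_trans[OF this d2] show "0 \<le> sqrt (4 * e)" by (rule real_sqrt_ge_zero)
  qed simp
  finally show ?thesis .
qed

text \<open>If the infimum m of the norms were positive, the squares of a minimising sequence would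
  converge in L1 to a density u. A translate of a near-minimiser is a near-minimiser too, hence
  close to it, so u is the density of a finite invariant measure, and its mass is at least
  m.\<close>

lemma null_imp_small_mean:
  assumes null: "\<And>\<nu>. invariant_finite_ac tc \<mu> \<phi> \<nu> \<Longrightarrow> emeasure \<nu> (space \<mu>) = 0" and e: "e > 0"
  shows "\<exists>\<beta>\<in>orbit_means. mean_norm \<beta> < e"
proof (rule ccontr)
  assume "\<not> ?thesis"
  then have ge_e: "\<And>\<beta>. \<beta> \<in> orbit_means \<Longrightarrow> e \<le> mean_norm \<beta>" by (auto simp: not_less)
  have ne: "orbit_means \<noteq> {}" using orbit_means.single[OF index_set_zero] by blast
  define m where "m = (INF \<beta>\<in>orbit_means. mean_norm \<beta>)"
  have bdd: "bdd_below (mean_norm ` orbit_means)" by (rule bdd_belowI[of _ 0]) (auto simp: mean_norm_nonneg)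
  have m_le: "m \<le> mean_norm \<beta>" if "\<beta> \<in> orbit_means" for \<beta> unfolding m_def by (rule cINF_lower[OF bdd that])
  have "e \<le> m" unfolding m_def by (rule cINF_greatest[OF ne]) (rule ge_e)
  then have m_pos: "m > 0" using e by simp
  have "\<exists>\<beta>\<in>orbit_means. mean_norm \<beta> < m + 1 / real (Suc n)" for n
    using cINF_less_iff[OF ne bdd, of "m + 1 / real (Suc n)"] unfolding m_def[symmetric] by simp
  then obtain \<beta> where \<beta>: "\<And>n. \<beta> n \<in> orbit_means" "\<And>n. mean_norm (\<beta> n) < m + 1 / real (Suc n)" by metis
  have eps_lim: "(\<lambda>n. sqrt (4 * (1 / real (Suc n))) * sqrt (4 * (m + 1))) \<longlonglongrightarrow> 0" by real_asymp
  define w where "w n x = (\<beta> n 0 x)\<^sup>2" for n x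
  have w_int: "integrable \<mu> (w n)" for n
    unfolding w_def using orbit_means_basic[OF \<beta>(1) index_set_zero, of n] by simp
  note [measurable] = borel_measurable_integrable[OF w_int]
  have close: "(\<integral>x. \<bar>w i x - w j x\<bar> \<partial>\<mu>) \<le> sqrt (4 * (1 / real (Suc n))) * sqrt (4 * (m + 1))" if "n \<le> i" "n \<le> j" for i j n
  proof -
    have "mean_norm (\<beta> k) \<le> m + 1 / real (Suc n)" if "n \<le> k" for k
    proof -
      have "1 / real (Suc k) \<le> 1 / real (Suc n)" using that by (simp add: frac_le)
      then show ?thesis using \<beta>(2)[of k] by linarith
    qed
    then show ?thesis unfolding w_def using that by (intro orbit_means_square_diff \<beta> m_le) auto
  qed
  have "\<exists>N. \<forall>i\<ge>N. \<forall>j\<ge>N. (\<integral>x. \<bar>w i x - w j x\<bar> \<partial>\<mu>) < e" if "e > 0" for e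
  proof -
    from order_tendstoD(2)[OF eps_lim that] obtain N where "sqrt (4 * (1 / real (Suc N))) * sqrt (4 * (m + 1)) < e"
      by (auto simp: eventually_sequentially)
    then show ?thesis using close[of N] by (intro exI[of _ N]) (auto intro: le_less_trans)
  qed
  then obtain u0 where u0: "integrable \<mu> u0" "(\<lambda>n. \<integral>x. \<bar>w n x - u0 x\<bar> \<partial>\<mu>) \<longlonglongrightarrow> 0"
    using L1_complete[of \<mu> w, OF w_int] by blast
  \<comment> \<open>The L1 limit is clipped at 0 to be nonnegative everywhere. This does not
    increase its distance to the nonnegative \<open>w n\<close>.\<close>
  define u where "u x = max 0 (u0 x)" for x
  have u_int: "integrable \<mu> u" unfolding u_def using u0(1) by (intro integrable_max) auto
  note [measurable] = borel_measurable_integrable[OF u_int]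
  have u_nonneg: "0 \<le> u x" for x by (simp add: u_def)
  have u_lim: "(\<lambda>n. \<integral>x. \<bar>w n x - u x\<bar> \<partial>\<mu>) \<longlonglongrightarrow> 0"
  proof (rule tendsto_sandwich[OF _ _ tendsto_const u0(2)])
    show "eventually (\<lambda>n. (\<integral>x. \<bar>w n x - u x\<bar> \<partial>\<mu>) \<le> (\<integral>x. \<bar>w n x - u0 x\<bar> \<partial>\<mu>)) sequentially"
    proof (rule always_eventually, rule allI)
      fix n
      have "\<bar>w n x - u x\<bar> \<le> \<bar>w n x - u0 x\<bar>" for x
        using zero_le_power2[of "\<beta> n 0 x"] by (auto simp: u_def w_def max_def)
      then show "(\<integral>x. \<bar>w n x - u x\<bar> \<partial>\<mu>) \<le> (\<integral>x. \<bar>w n x - u0 x\<bar> \<partial>\<mu>)"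
        using w_int u_int u0(1) by (intro integral_mono) auto
    qed
  qed auto
  have lim: "(\<lambda>n. \<integral>x. indicator A x * w n x \<partial>\<mu>) \<longlonglongrightarrow> (\<integral>x. indicator A x * u x \<partial>\<mu>)" if A [measurable]: "A \<in> sets \<mu>" for A
  proof (rule LIM_zero_cancel, rule Lim_null_comparison[OF _ u_lim])
    show "eventually (\<lambda>n. norm ((\<integral>x. indicator A x * w n x \<partial>\<mu>) - (\<integral>x. indicator A x * u x \<partial>\<mu>)) \<le> (\<integral>x. \<bar>w n x - u x\<bar> \<partial>\<mu>)) sequentially"
    proof (rule always_eventually, rule allI)
      fix n
      have i: "integrable \<mu> (\<lambda>x. indicator A x * w n x)" "integrable \<mu> (\<lambda>x. indicator A x * u x)"
        using integrable_mult_indicator[OF A w_int] integrable_mult_indicator[OF A u_int] by auto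
      have "(\<integral>x. indicator A x * w n x \<partial>\<mu>) - (\<integral>x. indicator A x * u x \<partial>\<mu>) = (\<integral>x. indicator A x * w n x - indicator A x * u x \<partial>\<mu>)"
        using i by simp
      also have "norm \<dots> \<le> (\<integral>x. norm (indicator A x * w n x - indicator A x * u x) \<partial>\<mu>)" by (rule integral_norm_bound)
      also have "\<dots> \<le> (\<integral>x. \<bar>w n x - u x\<bar> \<partial>\<mu>)"
        using i w_int u_int by (intro integral_mono) (auto simp: indicator_def)
      finally show "norm ((\<integral>x. indicator A x * w n x \<partial>\<mu>) - (\<integral>x. indicator A x * u x \<partial>\<mu>)) \<le> (\<integral>x. \<bar>w n x - u x\<bar> \<partial>\<mu>)" .
    qed
  qed
  have inv: "(\<integral>x. indicator (\<phi> t -` A \<inter> space \<mu>) x * u x \<partial>\<mu>) = (\<integral>x. indicator A x * u x \<partial>\<mu>)"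
    if t: "t \<in> index_set tc" and A: "A \<in> sets \<mu>" for t A
  proof -
    have mt: "- t \<in> index_set tc" using t by (rule index_set_minus)
    have pre: "\<phi> t -` A \<inter> space \<mu> \<in> sets \<mu>" by (rule measurable_sets[OF flow_measurable[OF t] A])
    have step: "(\<integral>x. indicator (\<phi> t -` A \<inter> space \<mu>) x * w n x \<partial>\<mu>) = (\<integral>x. indicator A x * (\<beta> n (- t) x)\<^sup>2 \<partial>\<mu>)" for n
    proof -
      have "(\<integral>x. indicator (\<phi> t -` A \<inter> space \<mu>) x * w n x \<partial>\<mu>) = (\<integral>x. indicator A (\<phi> t x) * (\<beta> n 0 x * \<beta> n 0 x) \<partial>\<mu>)"
        by (rule Bochner_Integration.integral_cong) (auto simp: indicator_def w_def power2_eq_square)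
      also have "\<dots> = (\<integral>x. indicator A x * (\<beta> n (0 - t) x * \<beta> n (0 - t) x) \<partial>\<mu>)"
        by (rule orbit_means_shift[OF \<beta>(1) \<beta>(1) index_set_zero t A])
      finally show ?thesis by (simp add: power2_eq_square)
    qed
    \<comment> \<open>\<open>\<beta> n\<close> and its translate by -t have the same norm, below m +
      1/(n + 1), so their squares are close in L1.\<close>
    have "(\<lambda>n. (\<integral>x. indicator A x * (\<beta> n (- t) x)\<^sup>2 \<partial>\<mu>) - (\<integral>x. indicator A x * w n x \<partial>\<mu>)) \<longlonglongrightarrow> 0"
    proof (rule Lim_null_comparison[OF _ eps_lim], rule always_eventually, rule allI)
      fix n
      note tr = orbit_means_translate[OF \<beta>(1) mt, of n]
      have i0: "integrable \<mu> (\<lambda>x. (\<beta> n (- t) x)\<^sup>2)" using orbit_means_basic[OF \<beta>(1) mt, of n] by simp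
      have i: "integrable \<mu> (\<lambda>x. indicator A x * w n x)" "integrable \<mu> (\<lambda>x. indicator A x * (\<beta> n (- t) x)\<^sup>2)"
        using integrable_mult_indicator[OF A w_int] integrable_mult_indicator[OF A i0] by auto
      have "(\<integral>x. indicator A x * (\<beta> n (- t) x)\<^sup>2 \<partial>\<mu>) - (\<integral>x. indicator A x * w n x \<partial>\<mu>)
          = (\<integral>x. indicator A x * (\<beta> n (- t) x)\<^sup>2 - indicator A x * w n x \<partial>\<mu>)" using i by simp
      also have "norm \<dots> \<le> (\<integral>x. norm (indicator A x * (\<beta> n (- t) x)\<^sup>2 - indicator A x * w n x) \<partial>\<mu>)" by (rule integral_norm_bound)
      also have "\<dots> \<le> (\<integral>x. \<bar>(\<beta> n (- t) x)\<^sup>2 - w n x\<bar> \<partial>\<mu>)"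
        using i i0 w_int[of n] by (intro integral_mono) (auto simp: indicator_def)
      also have "\<dots> = (\<integral>x. \<bar>((\<lambda>s. \<beta> n (- t + s)) 0 x)\<^sup>2 - (\<beta> n 0 x)\<^sup>2\<bar> \<partial>\<mu>)" by (simp add: w_def)
      also have "\<dots> \<le> sqrt (4 * (1 / real (Suc n))) * sqrt (4 * (m + 1))"
        using \<beta>(2)[of n] mean_norm_translate[OF \<beta>(1) mt, of n]
        by (intro orbit_means_square_diff tr \<beta>(1) m_le) auto
      finally show "norm ((\<integral>x. indicator A x * (\<beta> n (- t) x)\<^sup>2 \<partial>\<mu>) - (\<integral>x. indicator A x * w n x \<partial>\<mu>))
          \<le> sqrt (4 * (1 / real (Suc n))) * sqrt (4 * (m + 1))" .
    qed
    from tendsto_add[OF this lim[OF A]]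
    have "(\<lambda>n. \<integral>x. indicator (\<phi> t -` A \<inter> space \<mu>) x * w n x \<partial>\<mu>) \<longlonglongrightarrow> (\<integral>x. indicator A x * u x \<partial>\<mu>)"
      by (simp add: step)
    with lim[OF pre] show ?thesis by (rule LIMSEQ_unique)
  qed
  define \<nu> where "\<nu> = density \<mu> (\<lambda>x. ennreal (u x))"
  have em: "emeasure \<nu> A = ennreal (\<integral>x. indicator A x * u x \<partial>\<mu>)" if A: "A \<in> sets \<mu>" for A
  proof -
    have i: "integrable \<mu> (\<lambda>x. indicator A x * u x)" using integrable_mult_indicator[OF A u_int] by simp
    have "emeasure \<nu> A = (\<integral>\<^sup>+x. ennreal (u x) * indicator A x \<partial>\<mu>)"
      unfolding \<nu>_def using A by (simp add: emeasure_density)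
    also have "\<dots> = (\<integral>\<^sup>+x. ennreal (indicator A x * u x) \<partial>\<mu>)"
      by (rule nn_integral_cong) (auto simp: indicator_def)
    also have "\<dots> = ennreal (\<integral>x. indicator A x * u x \<partial>\<mu>)"
      using i u_nonneg by (intro nn_integral_eq_integral) auto
    finally show ?thesis .
  qed
  have "finite_measure \<nu>" by (rule finite_measureI) (use em[OF sets.top] in \<open>simp add: \<nu>_def\<close>)
  moreover have "absolutely_continuous \<mu> \<nu>" unfolding \<nu>_def by (rule absolutely_continuousI_density) simp
  moreover have "emeasure \<nu> (\<phi> t -` A \<inter> space \<mu>) = emeasure \<nu> A" if "t \<in> index_set tc" "A \<in> sets \<mu>" for t A
    using em[OF that(2)] em[OF measurable_sets[OF flow_measurable[OF that(1)] that(2)]] inv[OF that] by simp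
  ultimately have "invariant_finite_ac tc \<mu> \<phi> \<nu>" by (simp add: invariant_finite_ac_def \<nu>_def)
  then have z: "ennreal (\<integral>x. indicator (space \<mu>) x * u x \<partial>\<mu>) = 0" using null em[OF sets.top] by simp
  \<comment> \<open>No mass is lost in the limit: the integral of every \<open>w n\<close> is the
    norm of a member of the family, and L1 convergence preserves the bound.\<close>
  have "m \<le> (\<integral>x. indicator (space \<mu>) x * w n x \<partial>\<mu>)" for n
  proof -
    have "(\<integral>x. indicator (space \<mu>) x * w n x \<partial>\<mu>) = mean_norm (\<beta> n)"
      unfolding mean_norm_def w_def by (rule Bochner_Integration.integral_cong) auto
    then show ?thesis using m_le[OF \<beta>(1)] by simp
  qed
  then have "m \<le> (\<integral>x. indicator (space \<mu>) x * u x \<partial>\<mu>)"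
    using LIMSEQ_le_const[OF lim[OF sets.top]] by blast
  with z m_pos show False by (simp add: ennreal_eq_0_iff)
qed

text \<open>A time shift affects box averages only through an enlargement of the box, so up to a
  volume ratio the average of \<open>kernel\<close> is bounded by that of the inner product with any
  member of the family. The bound is claimed for all large r so that both halves of a midpoint can
  use the same r.\<close>

lemma orbit_means_avg:
  assumes "\<beta> \<in> orbit_means"
  shows "bounded_measurable tc (\<lambda>t. \<integral>x. v 0 x * \<beta> t x \<partial>\<mu>) \<and>
    (\<exists>R\<ge>0. \<forall>r\<ge>R. \<forall>T>0. avg tc T kernel
       \<le> vol_C TYPE('d) (T + r) / vol_C TYPE('d) T * avg tc (T + r) (\<lambda>t. \<integral>x. v 0 x * \<beta> t x \<partial>\<mu>))"
  using assms
proof induction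
  case (single a)
  have eq: "(\<lambda>t. \<integral>x. v 0 x * v (a + t) x \<partial>\<mu>) = (\<lambda>t. kernel (t + a))" by (simp add: kernel_def add.commute)
  have bm: "bounded_measurable tc (\<lambda>t. kernel (t + a))"
    by (rule bounded_measurable_shift[OF kernel_bounded_measurable single])
  have "avg tc T kernel \<le> vol_C TYPE('d) (T + r) / vol_C TYPE('d) T * avg tc (T + r) (\<lambda>t. kernel (t + a))"
    if "sup_norm a \<le> r" "T > 0" for r T
    using avg_shift_le[OF bm kernel_nonneg index_set_minus[OF single], of r T] that by (simp add: sup_norm_minus)
  then show ?case unfolding eq using bm sup_norm_nonneg[of a] by blast
next
  case (midpoint \<beta> \<gamma>)
  let ?b = "\<lambda>t. \<integral>x. v 0 x * \<beta> t x \<partial>\<mu>" and ?g = "\<lambda>t. \<integral>x. v 0 x * \<gamma> t x \<partial>\<mu>"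
    and ?m = "\<lambda>t. \<integral>x. v 0 x * ((\<beta> t x + \<gamma> t x) / 2) \<partial>\<mu>"
  have i: "integrable \<mu> (\<lambda>x. v 0 x * \<delta> t x)" if "\<delta> \<in> orbit_means" "t \<in> index_set tc" for \<delta> t
    using orbit_means_integrable[OF orbit_means.single[OF index_set_zero] that(1) index_set_zero that(2)] by simp
  have eq: "?m t = (1/2) * (?b t + ?g t)" if "t \<in> index_set tc" for t
    using i[OF midpoint.hyps(1) that] i[OF midpoint.hyps(2) that] by (simp add: distrib_left add_divide_distrib)
  have bm: "bounded_measurable tc (\<lambda>t. (1/2) * (?b t + ?g t))"
    using midpoint.IH by (intro bounded_measurable_mult bounded_measurable_const bounded_measurable_add) auto
  have bm': "bounded_measurable tc ?m"
  proof -
    have "?m \<in> borel_measurable (index_measure tc) \<longleftrightarrow> (\<lambda>t. (1/2) * (?b t + ?g t)) \<in> borel_measurable (index_measure tc)"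
      by (rule measurable_cong) (use eq in auto)
    then show ?thesis using bm eq unfolding bounded_measurable_def by simp
  qed
  obtain R1 R2 where R: "R1 \<ge> 0" "R2 \<ge> 0"
    "\<And>r T. r \<ge> R1 \<Longrightarrow> T > 0 \<Longrightarrow> avg tc T kernel \<le> vol_C TYPE('d) (T + r) / vol_C TYPE('d) T * avg tc (T + r) ?b"
    "\<And>r T. r \<ge> R2 \<Longrightarrow> T > 0 \<Longrightarrow> avg tc T kernel \<le> vol_C TYPE('d) (T + r) / vol_C TYPE('d) T * avg tc (T + r) ?g"
    using midpoint.IH by blast
  have "avg tc T kernel \<le> vol_C TYPE('d) (T + r) / vol_C TYPE('d) T * avg tc (T + r) ?m"
    if "r \<ge> max R1 R2" "T > 0" for r T
  proof -
    have Tr: "T + r > 0" using that R(1) by simp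
    have "avg tc (T + r) ?m = avg tc (T + r) (\<lambda>t. (1/2) * (?b t + ?g t))"
      unfolding avg_def using eq by (intro arg_cong[where f = "\<lambda>z. _ * z"] Bochner_Integration.integral_cong) (auto simp: indicator_def box_B_index)
    also have "\<dots> = (1/2) * (avg tc (T + r) ?b + avg tc (T + r) ?g)"
      unfolding avg_cmult using midpoint.IH Tr by (simp add: avg_add)
    finally have eqn: "vol_C TYPE('d) (T + r) / vol_C TYPE('d) T * avg tc (T + r) ?m
       = (1/2) * (vol_C TYPE('d) (T + r) / vol_C TYPE('d) T * avg tc (T + r) ?b + vol_C TYPE('d) (T + r) / vol_C TYPE('d) T * avg tc (T + r) ?g)"
      by (simp add: algebra_simps)
    have "R1 \<le> r" "R2 \<le> r" using that by auto
    moreover have "a \<le> 1/2 * (x + y)" if "a \<le> x" "a \<le> y" for a x y :: real using that by argo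
    ultimately show ?thesis unfolding eqn using R(3,4) that(2) by blast
  qed
  then show ?case using bm' R(1) by (intro conjI exI[of _ "max R1 R2"]) auto
qed

text \<open>The inner product of \<open>v 0\<close> with a member of small norm is small at every
  time, by Cauchy-Schwarz and constancy of the norm along the orbit; hence so are its
  averages.\<close>

lemma null_imp_avg_kernel:
  assumes null: "\<And>\<nu>. invariant_finite_ac tc \<mu> \<phi> \<nu> \<Longrightarrow> emeasure \<nu> (space \<mu>) = 0"
  shows "((\<lambda>T. avg tc T kernel) \<longlongrightarrow> 0) at_top"
proof (rule tendstoI)
  fix e :: real assume e: "e > 0"
  define e' where "e' = (e / 4 / (sqrt (kernel 0) + 1))\<^sup>2"
  have k0: "sqrt (kernel 0) + 1 > 0" using kernel_nonneg[of 0] by (simp add: add_nonneg_pos)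
  have "e' > 0" unfolding e'_def using e k0 by simp
  then obtain \<beta> where \<beta>: "\<beta> \<in> orbit_means" "mean_norm \<beta> < e'" using null_imp_small_mean[OF null] by blast
  let ?b = "\<lambda>t. \<integral>x. v 0 x * \<beta> t x \<partial>\<mu>"
  have small: "?b t \<le> e / 4" if t: "t \<in> index_set tc" for t
  proof -
    have "?b t \<le> sqrt (\<integral>x. (v 0 x)\<^sup>2 \<partial>\<mu>) * sqrt (\<integral>x. (\<beta> t x)\<^sup>2 \<partial>\<mu>)"
      using orbit_means_basic[OF \<beta>(1) t]
      by (intro order_trans[OF abs_ge_self cauchy_schwarz_integral(2)]) (auto intro: v_square_integrable)
    also have "\<dots> \<le> sqrt (kernel 0) * sqrt e'"
      using v_norm[OF index_set_zero] orbit_means_norm[OF \<beta>(1) t] \<beta>(2) kernel_nonneg[of 0]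
      by (intro mult_mono) (auto simp: mean_norm_def)
    also have "sqrt e' = e / 4 / (sqrt (kernel 0) + 1)" unfolding e'_def using e k0 by simp
    also have "sqrt (kernel 0) * (e / 4 / (sqrt (kernel 0) + 1)) \<le> e / 4" using e k0 by (simp add: field_simps)
    finally show ?thesis .
  qed
  obtain R where R: "R \<ge> 0" "\<And>T. T > 0 \<Longrightarrow> avg tc T kernel \<le> vol_C TYPE('d) (T + R) / vol_C TYPE('d) T * avg tc (T + R) ?b"
    and bm: "bounded_measurable tc ?b"
    using orbit_means_avg[OF \<beta>(1)] by blast
  have "((\<lambda>T. avg tc (T + R) (\<lambda>t :: real ^ 'd. e / 4)) \<longlongrightarrow> e / 4) at_top"
    by (rule filterlim_compose[OF avg_const_tendsto]) real_asymp
  from tendsto_mult[OF vol_C_ratio_tendsto[of R] this]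
  have "((\<lambda>T. vol_C TYPE('d) (T + R) / vol_C TYPE('d) T * avg tc (T + R) (\<lambda>t :: real ^ 'd. e / 4)) \<longlongrightarrow> e / 4) at_top" by simp
  then have "eventually (\<lambda>T. vol_C TYPE('d) (T + R) / vol_C TYPE('d) T * avg tc (T + R) (\<lambda>t :: real ^ 'd. e / 4) < e) at_top"
    by (rule order_tendstoD(2)) (use e in simp)
  then show "eventually (\<lambda>T. dist (avg tc T kernel) 0 < e) at_top"
    using eventually_gt_at_top[of 0]
  proof eventually_elim
    case (elim T)
    have "avg tc T kernel \<le> vol_C TYPE('d) (T + R) / vol_C TYPE('d) T * avg tc (T + R) ?b" by (rule R(2)[OF elim(2)])
    also have "\<dots> \<le> vol_C TYPE('d) (T + R) / vol_C TYPE('d) T * avg tc (T + R) (\<lambda>t :: real ^ 'd. e / 4)"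
      using elim R(1) by (intro mult_left_mono avg_mono bm bounded_measurable_const small) (auto simp: vol_C_def box_B_index)
    finally show ?case using elim(1) avg_nonneg[of tc kernel T] elim(2) kernel_nonneg by simp
  qed
qed

end

section \<open>Weak mixing\<close>

context sas_field
begin

abbreviation path_space :: "(real ^ 'd \<Rightarrow> real) measure" where
  "path_space \<equiv> PiM (index_set tc) (\<lambda>_. borel)"

abbreviation shifted_path :: "real ^ 'd \<Rightarrow> 'w \<Rightarrow> real ^ 'd \<Rightarrow> real" where
  "shifted_path t \<equiv> path tc (\<lambda>s. X (s - t))"

lemma shifted_path_measurable: "t \<in> index_set tc \<Longrightarrow> shifted_path t \<in> measurable P path_space"
  unfolding path_def by (intro measurable_restrict X_measurable index_set_diff)

lemma shifted_path_apply:
  assumes "s \<in> index_set tc"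
  shows "shifted_path t \<omega> s = X (s - t) \<omega>" "path tc X \<omega> s = X s \<omega>"
  using assms by (simp_all add: path_def)

text \<open>Written with \<open>shifted_path 0\<close> so that the unshifted path is covered by the
  same statements as the shifted ones.\<close>

definition path_distr :: "(real ^ 'd \<Rightarrow> real) measure" where
  "path_distr = distr P path_space (shifted_path 0)"

text \<open>Finite-dimensional distributions determine a law on the product space, and those of the
  path shifted by t are covered by stationarity at -t.\<close>

lemma distr_shifted_path:
  assumes t: "t \<in> index_set tc"
  shows "distr P path_space (shifted_path t) = path_distr"
  unfolding path_distr_def
proof (rule measure_eqI_PiM_infinite)
  show "finite_measure (distr P path_space (shifted_path t))"
    by (intro prob_space.finite_measure P.prob_space_distr shifted_path_measurable t)
  fix A and J :: "(real ^ 'd) set" assume J: "finite J" "J \<subseteq> index_set tc" and A: "\<And>i. i \<in> J \<Longrightarrow> A i \<in> sets (borel :: real measure)"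
  let ?M = "\<lambda>_ :: real ^ 'd. borel :: real measure"
  have AJ: "Pi\<^sub>E J A \<in> sets (PiM J ?M)" using A J(1) by (intro sets_PiM_I_finite) auto
  have val: "emeasure (distr P path_space (shifted_path r)) (prod_emb (index_set tc) ?M J (Pi\<^sub>E J A))
     = emeasure (distr P (PiM J ?M) (\<lambda>\<omega>. restrict (\<lambda>s. X (s + - r) \<omega>) J)) (Pi\<^sub>E J A)" if r: "r \<in> index_set tc" for r
  proof -
    have m: "(\<lambda>\<omega>. restrict (\<lambda>s. X (s + - r) \<omega>) J) \<in> measurable P (PiM J ?M)"
      using J(2) r by (intro measurable_restrict X_measurable index_set_add index_set_minus) auto
    have "shifted_path r -` prod_emb (index_set tc) ?M J (Pi\<^sub>E J A) \<inter> space P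
       = (\<lambda>\<omega>. restrict (\<lambda>s. X (s + - r) \<omega>) J) -` Pi\<^sub>E J A \<inter> space P"
      using J(2) by (auto simp: prod_emb_def path_def PiE_iff subset_iff)
    moreover have "prod_emb (index_set tc) ?M J (Pi\<^sub>E J A) \<in> sets path_space"
      using J A by (intro sets_PiM_I) auto
    ultimately show ?thesis
      by (simp only: emeasure_distr[OF shifted_path_measurable[OF r]] emeasure_distr[OF m AJ])
  qed
  have "distr P (PiM J ?M) (\<lambda>\<omega>. restrict (\<lambda>s. X (s + - t) \<omega>) J) = distr P (PiM J ?M) (\<lambda>\<omega>. restrict (\<lambda>s. X s \<omega>) J)"
    using stationary[unfolded stationary_field_def, rule_format, of J "- t"] J index_set_minus[OF t] by blast
  then show "emeasure (distr P path_space (shifted_path t)) (prod_emb (index_set tc) ?M J (Pi\<^sub>E J A))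
     = emeasure (distr P path_space (shifted_path 0)) (prod_emb (index_set tc) ?M J (Pi\<^sub>E J A))"
    using val[OF t] val[OF index_set_zero] by simp
qed simp_all

lemma path_prob_eq: "C \<in> path_sets tc \<Longrightarrow> path_prob P tc X C = measure path_distr C"
  unfolding path_distr_def path_prob_def path_sets_def
  using shifted_path_measurable[OF index_set_zero]
  by (subst measure_distr) (auto simp: vimage_def Int_def conj_commute)

text \<open>Over the reals the shifted path is jointly measurable in time and chance, coordinate by
  coordinate, and the probability of a section of a measurable set is measurable in t.\<close>

lemma joint_prob_bounded_measurable:
  assumes C: "C \<in> path_sets tc" and D: "D \<in> path_sets tc"
  shows "bounded_measurable tc (joint_prob P tc X C D)"
proof (rule bounded_measurableI[of _ _ 1])
  show "\<bar>joint_prob P tc X C D t\<bar> \<le> 1" for t by (simp add: joint_prob_def)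
  show "joint_prob P tc X C D \<in> borel_measurable (index_measure tc)"
  proof (cases tc)
    case IntCase
    then show ?thesis by (simp add: index_measure_def)
  next
    case RealCase
    let ?M = "(lborel :: (real ^ 'd) measure) \<Otimes>\<^sub>M P"
    have Xj: "(\<lambda>(t, \<omega>). X t \<omega>) \<in> borel_measurable ?M"
      using field_measurable RealCase by (simp add: measurable_field_def)
    have "(\<lambda>z. X (s - fst z) (snd z)) \<in> borel_measurable ?M" for s
    proof -
      have "(\<lambda>z. (s - fst z, snd z)) \<in> measurable ?M ?M" by measurable
      from measurable_compose[OF this Xj] show ?thesis by simp
    qed
    then have m1: "(\<lambda>z. shifted_path (fst z) (snd z)) \<in> measurable ?M path_space"
      unfolding path_def by (intro measurable_restrict)
    have m2: "(\<lambda>z. shifted_path 0 (snd z)) \<in> measurable ?M path_space"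
      by (rule measurable_compose[OF measurable_snd shifted_path_measurable[OF index_set_zero]])
    let ?E = "((\<lambda>z. shifted_path 0 (snd z)) -` C \<inter> space ?M) \<inter> ((\<lambda>z. shifted_path (fst z) (snd z)) -` D \<inter> space ?M)"
    have E: "?E \<in> sets ?M"
      using C D unfolding path_sets_def by (intro sets.Int measurable_sets[OF m1] measurable_sets[OF m2])
    have "(\<lambda>t. enn2real (emeasure P (Pair t -` ?E))) \<in> borel_measurable lborel"
      by (intro measurable_compose[OF P.measurable_emeasure_Pair[OF E]]) simp
    moreover have "joint_prob P tc X C D t = enn2real (emeasure P (Pair t -` ?E))" for t
      unfolding joint_prob_def measure_def
      by (intro arg_cong[where f = enn2real] arg_cong[where f = "emeasure P"]) (auto simp: space_pair_measure)
    ultimately have "(\<lambda>t. joint_prob P tc X C D t) \<in> borel_measurable lborel" by (simp only:)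
    then show ?thesis using RealCase by (simp add: index_measure_def)
  qed
qed

text \<open>The joint characteristic function has the norm of \<open>g + h n\<close> as exponent,
  and the norm of \<open>h n\<close> does not depend on n. The exponent is additive up to \<delta>
  n, which is bounded by finitely many values of \<open>kernel\<close> at
  \<open>tn n + (k - l)\<close>.\<close>

lemma exp_limit_of_kernel:
  assumes ker: "\<And>r. r \<in> index_set tc \<Longrightarrow> (\<lambda>n. kernel (tn n + r)) \<longlonglongrightarrow> 0"
    and tn: "\<And>n :: nat. tn n \<in> index_set tc"
    and J: "finite J" "J \<subseteq> index_set tc" and K: "finite K" "K \<subseteq> index_set tc"
  shows "(\<lambda>n. \<integral>\<omega>. cis (\<Sum>s\<in>J. \<theta> s * shifted_path 0 \<omega> s) * cis (\<Sum>s\<in>K. \<eta> s * shifted_path (tn n) \<omega> s) \<partial>P)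
    \<longlonglongrightarrow> (\<integral>x. cis (\<Sum>s\<in>J. \<theta> s * x s) \<partial>path_distr) * (\<integral>x. cis (\<Sum>s\<in>K. \<eta> s * x s) \<partial>path_distr)"
proof -
  define g where "g x = (\<Sum>s\<in>J. \<theta> s * f s x)" for x
  define h where "h n x = (\<Sum>s\<in>K. \<eta> s * f (s - tn n) x)" for n x
  define h0 where "h0 x = (\<Sum>s\<in>K. \<eta> s * f s x)" for x
  let ?N = "\<lambda>g. \<integral>x. \<bar>g x\<bar> powr \<alpha> \<partial>\<mu>"
  have hN: "?N (h n) = ?N h0" for n
    unfolding h_def h0_def using spectral_norm_shift[of K "\<lambda>s. s" "- tn n" \<eta>] K index_set_minus[OF tn] by auto
  have Qval: "(\<integral>x. cis (\<Sum>s\<in>L. \<zeta> s * x s) \<partial>path_distr) = complex_of_real (exp (- ?N (\<lambda>x. \<Sum>s\<in>L. \<zeta> s * f s x)))"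
    if L: "finite L" "L \<subseteq> index_set tc" for L and \<zeta> :: "real ^ 'd \<Rightarrow> real"
  proof -
    have m: "(\<lambda>x. cis (\<Sum>s\<in>L. \<zeta> s * x s)) \<in> borel_measurable path_space"
      using trig_poly_measurable[OF trig_poly.char[OF L]] .
    have "(\<integral>x. cis (\<Sum>s\<in>L. \<zeta> s * x s) \<partial>path_distr) = (CLINT \<omega>|P. cis (\<Sum>s\<in>L. \<zeta> s * X s \<omega>))"
      unfolding path_distr_def using L
      by (subst integral_distr[OF shifted_path_measurable[OF index_set_zero] m])
        (auto intro!: Bochner_Integration.integral_cong arg_cong[where f = cis] sum.cong simp: shifted_path_apply subset_iff)
    also have "\<dots> = complex_of_real (exp (- ?N (\<lambda>x. \<Sum>s\<in>L. \<zeta> s * f s x)))"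
      by (rule characteristic_function) (use L in auto)
    finally show ?thesis .
  qed
  have joint: "(\<integral>\<omega>. cis (\<Sum>s\<in>J. \<theta> s * shifted_path 0 \<omega> s) * cis (\<Sum>s\<in>K. \<eta> s * shifted_path (tn n) \<omega> s) \<partial>P)
      = complex_of_real (exp (- ?N (\<lambda>x. g x + h n x)))" for n
  proof -
    \<comment> \<open>A disjoint sum indexes the joint combination, since J and the translate of K
      may share times.\<close>
    let ?\<tau> = "case_sum (\<lambda>s. s) (\<lambda>s. s - tn n)" and ?a = "case_sum \<theta> \<eta>"
    have "(\<integral>\<omega>. cis (\<Sum>s\<in>J. \<theta> s * shifted_path 0 \<omega> s) * cis (\<Sum>s\<in>K. \<eta> s * shifted_path (tn n) \<omega> s) \<partial>P)
        = (CLINT \<omega>|P. cis (\<Sum>k\<in>J <+> K. ?a k * X (?\<tau> k) \<omega>))"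
      using J K by (auto simp: cis_mult sum.Plus shifted_path_apply subset_iff
          intro!: Bochner_Integration.integral_cong arg_cong[where f = cis] arg_cong2[where f = "(+)"] sum.cong)
    also have "\<dots> = complex_of_real (exp (- ?N (\<lambda>x. \<Sum>k\<in>J <+> K. ?a k * f (?\<tau> k) x)))"
      by (rule characteristic_function) (use J K tn in \<open>auto intro!: index_set_diff\<close>)
    also have "(\<lambda>x. \<Sum>k\<in>J <+> K. ?a k * f (?\<tau> k) x) = (\<lambda>x. g x + h n x)"
      using J K by (auto simp: g_def h_def sum.Plus)
    finally show ?thesis .
  qed
  define \<delta> where "\<delta> n = ?N (\<lambda>x. g x + h n x) - ?N g - ?N (h n)" for n
  have \<delta>: "\<delta> \<longlonglongrightarrow> 0"
  proof (rule Lim_null_comparison)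
    show "eventually (\<lambda>n. norm (\<delta> n) \<le> 4 * (\<Sum>k\<in>J. \<Sum>l\<in>K. \<bar>\<theta> k\<bar> powr (\<alpha>/2) * \<bar>\<eta> l\<bar> powr (\<alpha>/2) * kernel (tn n + (k - l)))) sequentially"
    proof (rule always_eventually, rule allI)
      fix n
      have "\<bar>\<delta> n\<bar> \<le> 4 * (\<Sum>k\<in>J. \<Sum>l\<in>K. \<bar>\<theta> k\<bar> powr (\<alpha>/2) * \<bar>\<eta> l\<bar> powr (\<alpha>/2) * kernel ((l - tn n) - k))"
        unfolding \<delta>_def
      proof (rule spectral_norm_defect)
        show "g = (\<lambda>x. \<Sum>s\<in>J. \<theta> s * f s x)" by (rule ext) (rule g_def)
        show "h n = (\<lambda>x. \<Sum>s\<in>K. \<eta> s * f (s - tn n) x)" by (rule ext) (rule h_def)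
      qed (use J K tn in \<open>auto intro!: index_set_diff\<close>)
      also have "\<dots> = 4 * (\<Sum>k\<in>J. \<Sum>l\<in>K. \<bar>\<theta> k\<bar> powr (\<alpha>/2) * \<bar>\<eta> l\<bar> powr (\<alpha>/2) * kernel (tn n + (k - l)))"
      proof -
        \<comment> \<open>Evenness of \<open>kernel\<close> gives the escaping time a positive sign,
          as in the hypothesis \<open>ker\<close>.\<close>
        have "kernel ((l - tn n) - k) = kernel (tn n + (k - l))" if "k \<in> J" "l \<in> K" for k l
        proof -
          have "tn n + (k - l) \<in> index_set tc" using that J K tn by (intro index_set_add index_set_diff) auto
          from kernel_minus[OF this] show ?thesis by (simp add: algebra_simps)
        qed
        then show ?thesis by (simp cong: sum.cong)
      qed
      finally show "norm (\<delta> n) \<le> 4 * (\<Sum>k\<in>J. \<Sum>l\<in>K. \<bar>\<theta> k\<bar> powr (\<alpha>/2) * \<bar>\<eta> l\<bar> powr (\<alpha>/2) * kernel (tn n + (k - l)))" by simp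
    qed
    have "(\<lambda>n. 4 * (\<Sum>k\<in>J. \<Sum>l\<in>K. \<bar>\<theta> k\<bar> powr (\<alpha>/2) * \<bar>\<eta> l\<bar> powr (\<alpha>/2) * kernel (tn n + (k - l))))
        \<longlonglongrightarrow> 4 * (\<Sum>k\<in>J. \<Sum>l\<in>K. \<bar>\<theta> k\<bar> powr (\<alpha>/2) * \<bar>\<eta> l\<bar> powr (\<alpha>/2) * 0)"
      using J K by (intro tendsto_mult tendsto_sum tendsto_const ker index_set_diff) auto
    then show "(\<lambda>n. 4 * (\<Sum>k\<in>J. \<Sum>l\<in>K. \<bar>\<theta> k\<bar> powr (\<alpha>/2) * \<bar>\<eta> l\<bar> powr (\<alpha>/2) * kernel (tn n + (k - l)))) \<longlonglongrightarrow> 0" by simp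
  qed
  have "(\<lambda>n. complex_of_real (exp (- (?N g + ?N h0 + \<delta> n)))) \<longlonglongrightarrow> complex_of_real (exp (- (?N g + ?N h0 + 0)))"
    by (intro tendsto_of_real tendsto_exp tendsto_minus tendsto_add tendsto_const \<delta>)
  moreover have "?N g + ?N h0 + \<delta> n = ?N (\<lambda>x. g x + h n x)" for n by (simp add: \<delta>_def hN)
  moreover have "complex_of_real (exp (- (?N g + ?N h0 + 0))) = complex_of_real (exp (- ?N g)) * complex_of_real (exp (- ?N h0))"
    by (simp add: exp_add exp_diff exp_minus field_simps)
  ultimately show ?thesis
    unfolding joint Qval[OF J] Qval[OF K] g_def[symmetric] h0_def[symmetric] by simp
qed

text \<open>One set D has to make \<open>kernel (tn n + r)\<close> small for every r. It comes from
  the weighted series over the countable family of shifts, and uniform approximation extends it to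
  all r.\<close>

lemma avg_kernel_imp_weakly_mixing:
  assumes lim: "((\<lambda>T. avg tc T kernel) \<longlongrightarrow> 0) at_top"
  shows "weakly_mixing_field P tc X"
proof -
  obtain s :: "nat \<Rightarrow> real ^ 'd" where s: "\<And>k. s k \<in> index_set tc"
    "\<And>r e. r \<in> index_set tc \<Longrightarrow> e > 0 \<Longrightarrow> \<exists>k. \<forall>t. \<bar>kernel (t + r) - kernel (t + s k)\<bar> \<le> e"
  proof (rule kernel_countable_shifts)
    fix s :: "nat \<Rightarrow> real ^ 'd"
    assume "\<And>k. s k \<in> index_set tc"
      "\<And>r e. r \<in> index_set tc \<Longrightarrow> e > 0 \<Longrightarrow> \<exists>k. \<forall>t. \<bar>kernel (t + r) - kernel (t + s k)\<bar> \<le> e"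
    then show thesis by (rule that)
  qed
  define H where "H t = (\<Sum>k. (1/2) ^ k * kernel (t + s k))" for t
  have series: "bounded_measurable tc H" "((\<lambda>T. avg tc T H) \<longlongrightarrow> 0) at_top"
    "\<And>t k. t \<in> index_set tc \<Longrightarrow> (1/2) ^ k * kernel (t + s k) \<le> H t" "\<And>t. t \<in> index_set tc \<Longrightarrow> 0 \<le> H t"
    unfolding H_def
    by (rule avg_zero_series[where B = "kernel 0" and s = s and K = kernel];
        (assumption | rule kernel_bounded_measurable kernel_nonneg kernel_le s(1) lim)+)+
  obtain D where D: "D \<subseteq> index_set tc" "D \<in> sets (index_measure tc)"
    "((\<lambda>T. avg tc T (indicator (index_set tc - D))) \<longlongrightarrow> 0) at_top"
    "\<And>t. (\<And>n. t n \<in> D) \<Longrightarrow> filterlim (\<lambda>n :: nat. sup_norm (t n)) at_top sequentially \<Longrightarrow> (\<lambda>n. H (t n)) \<longlonglongrightarrow> 0"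
  proof (rule density_one_set[OF series(1,4,2)])
    fix D :: "(real ^ 'd) set"
    assume "D \<subseteq> index_set tc" "D \<in> sets (index_measure tc)"
      "((\<lambda>T. avg tc T (indicator (index_set tc - D))) \<longlongrightarrow> 0) at_top"
      "\<And>t. (\<And>n. t n \<in> D) \<Longrightarrow> filterlim (\<lambda>n :: nat. sup_norm (t n)) at_top sequentially \<Longrightarrow> (\<lambda>n. H (t n)) \<longlonglongrightarrow> 0"
    then show thesis by (rule that)
  qed
  interpret Q: path_law path_distr "index_set tc"
  proof (intro path_law.intro path_law_axioms.intro)
    show "prob_space path_distr" unfolding path_distr_def
      by (rule P.prob_space_distr[OF shifted_path_measurable[OF index_set_zero]])
    show "sets path_distr = sets path_space" by (simp add: path_distr_def)
  qed
  have cong: "measurable P path_distr = measurable P path_space"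
    by (rule measurable_cong_sets) (auto simp: path_distr_def)
  have "(\<lambda>n. joint_prob P tc X A B (tn n)) \<longlonglongrightarrow> path_prob P tc X A * path_prob P tc X B"
    if A: "A \<in> path_sets tc" and B: "B \<in> path_sets tc" and tn: "\<And>n. tn n \<in> D"
      and inf: "filterlim (\<lambda>n. sup_norm (tn n)) at_top sequentially" for A B tn
  proof -
    have tI: "tn n \<in> index_set tc" for n using tn D(1) by auto
    have Hlim: "(\<lambda>n. H (tn n)) \<longlonglongrightarrow> 0" using D(4)[OF tn inf] .
    have klim: "(\<lambda>n. kernel (tn n + s k)) \<longlonglongrightarrow> 0" for k
    proof (rule tendsto_sandwich[OF _ _ tendsto_const])
      show "eventually (\<lambda>n. 0 \<le> kernel (tn n + s k)) sequentially" by (simp add: kernel_nonneg)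
      \<comment> \<open>Undoing the weight of the k-th shift costs the factor \<open>2 ^ k\<close>,
        harmless because k is fixed.\<close>
      show "eventually (\<lambda>n. kernel (tn n + s k) \<le> 2 ^ k * H (tn n)) sequentially"
      proof (rule always_eventually, rule allI)
        fix n
        have "(1/2) ^ k * kernel (tn n + s k) \<le> H (tn n)" by (rule series(3)[OF tI])
        then have "2 ^ k * ((1/2) ^ k * kernel (tn n + s k)) \<le> 2 ^ k * H (tn n)" by (intro mult_left_mono) auto
        moreover have "2 ^ k * ((1/2) ^ k * kernel (tn n + s k)) = kernel (tn n + s k)"
          by (simp flip: mult.assoc power_mult_distrib)
        ultimately show "kernel (tn n + s k) \<le> 2 ^ k * H (tn n)" by simp
      qed
      show "(\<lambda>n. 2 ^ k * H (tn n)) \<longlonglongrightarrow> 0" using tendsto_mult[OF tendsto_const Hlim, of "2 ^ k"] by simp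
    qed
    have ker: "(\<lambda>n. kernel (tn n + r)) \<longlonglongrightarrow> 0" if r: "r \<in> index_set tc" for r
    proof (rule LIMSEQ_I)
      fix e :: real assume e: "e > 0"
      obtain k where k: "\<And>t. \<bar>kernel (t + r) - kernel (t + s k)\<bar> \<le> e / 2" using s(2)[OF r, of "e/2"] e by auto
      obtain N where N: "\<And>n. n \<ge> N \<Longrightarrow> norm (kernel (tn n + s k) - 0) < e / 2"
        using LIMSEQ_D[OF klim[of k], of "e/2"] e by auto
      have "norm (kernel (tn n + r) - 0) < e" if "n \<ge> N" for n
        using k[of "tn n"] N[OF that] unfolding real_norm_def diff_0_right by linarith
      then show "\<exists>N. \<forall>n\<ge>N. norm (kernel (tn n + r) - 0) < e" by blast
    qed
    have "(\<lambda>n. measure P {\<omega> \<in> space P. shifted_path 0 \<omega> \<in> A \<and> shifted_path (tn n) \<omega> \<in> B})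
        \<longlonglongrightarrow> measure path_distr A * measure path_distr B"
    proof (rule Q.independence_limit[OF P.prob_space_axioms])
      show "shifted_path 0 \<in> measurable P path_distr" "shifted_path (tn n) \<in> measurable P path_distr" for n
        unfolding cong by (intro shifted_path_measurable index_set_zero tI)+
      have d: "distr P path_distr Z = distr P path_space Z" for Z by (rule distr_cong) (auto simp: path_distr_def)
      show "distr P path_distr (shifted_path 0) = path_distr" "distr P path_distr (shifted_path (tn n)) = path_distr" for n
        unfolding d by (intro distr_shifted_path index_set_zero tI)+
      show "A \<in> sets path_distr" "B \<in> sets path_distr" using A B by (auto simp: path_distr_def path_sets_def)
    qed (rule exp_limit_of_kernel[OF ker tI])
    then show ?thesis by (simp add: joint_prob_def path_prob_eq A B)
  qed
  then show ?thesis unfolding weakly_mixing_field_def sup_norm_def[symmetric] using D(1-3) by blast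
qed

text \<open>The average splits into an exceptional set of density zero, a fixed box of vanishing
  relative volume, and the remaining times, where the joint probability is uniformly close to the
  product.\<close>

lemma weakly_mixing_imp_ergodic:
  assumes "weakly_mixing_field P tc X"
  shows "ergodic_field P tc X"
  unfolding ergodic_field_def
proof (intro ballI)
  fix A B :: "(real ^ 'd \<Rightarrow> real) set" assume A: "A \<in> path_sets tc" and B: "B \<in> path_sets tc"
  obtain D where D: "D \<subseteq> index_set tc" "D \<in> sets (index_measure tc)"
    and D0: "((\<lambda>T. avg tc T (indicator (index_set tc - D))) \<longlongrightarrow> 0) at_top"
    and mix: "\<And>tn. (\<And>n :: nat. tn n \<in> D) \<Longrightarrow> filterlim (\<lambda>n. sup_norm (tn n)) at_top sequentially \<Longrightarrow>
        (\<lambda>n. joint_prob P tc X A B (tn n)) \<longlonglongrightarrow> path_prob P tc X A * path_prob P tc X B"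
    using assms A B unfolding weakly_mixing_field_def sup_norm_def[symmetric] by blast
  define L where "L = path_prob P tc X A * path_prob P tc X B"
  let ?J = "joint_prob P tc X A B"
  note bJ = joint_prob_bounded_measurable[OF A B]
  have bE: "bounded_measurable tc (indicator (index_set tc - D))"
    by (rule bounded_measurable_indicator) (use sets.compl_sets[OF D(2)] in simp)
  have L01: "0 \<le> L" "L \<le> 1" unfolding L_def path_prob_def by (auto intro: mult_le_one)
  have J01: "0 \<le> ?J t" "?J t \<le> 1" for t by (auto simp: joint_prob_def)
  have "((\<lambda>T. avg tc T (\<lambda>t. ?J t - L)) \<longlongrightarrow> 0) at_top"
  proof (rule tendstoI)
    fix e :: real assume e: "e > 0"
    \<comment> \<open>The sequential definition becomes a uniform statement: otherwise a bad time of
      norm at least n for each n would form a sequence contradicting the limit.\<close>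
    have "\<exists>R. \<forall>t\<in>D. sup_norm t \<ge> R \<longrightarrow> \<bar>?J t - L\<bar> < e / 4"
    proof (rule ccontr)
      assume "\<not> ?thesis"
      then have "\<forall>n :: nat. \<exists>t\<in>D. sup_norm t \<ge> real n \<and> \<not> \<bar>?J t - L\<bar> < e / 4" by blast
      then obtain tn where tn: "\<And>n :: nat. tn n \<in> D" "\<And>n. sup_norm (tn n) \<ge> real n" "\<And>n. \<not> \<bar>?J (tn n) - L\<bar> < e / 4" by metis
      have "filterlim (\<lambda>n. sup_norm (tn n)) at_top sequentially"
        by (rule filterlim_at_top_mono[OF filterlim_real_sequentially]) (simp add: tn(2))
      from LIMSEQ_D[OF mix[OF tn(1) this, folded L_def], of "e/4"] e tn(3) show False by auto
    qed
    then obtain R where R: "\<And>t. t \<in> D \<Longrightarrow> sup_norm t \<ge> R \<Longrightarrow> \<bar>?J t - L\<bar> < e / 4" by blast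
    define R' where "R' = max R 1"
    let ?b = "indicator (box_B tc (R' + 1)) :: real ^ 'd \<Rightarrow> real"
    have bb: "bounded_measurable tc ?b" by (intro bounded_measurable_indicator box_B_sets)
    have b0: "((\<lambda>T. avg tc T ?b) \<longlongrightarrow> 0) at_top"
    proof (rule tendsto_sandwich[OF _ _ tendsto_const])
      let ?m = "measure (index_measure tc) (box_B tc (R' + 1) :: (real ^ 'd) set)"
      show "eventually (\<lambda>T. 0 \<le> avg tc T ?b) at_top"
        using eventually_gt_at_top[of 0] by eventually_elim (intro avg_nonneg, auto)
      have fin: "emeasure (index_measure tc) (box_B tc (R' + 1) :: (real ^ 'd) set) < \<infinity>"
        by (rule box_B_finite) (simp add: R'_def)
      show "eventually (\<lambda>T. avg tc T ?b \<le> ?m / vol_C TYPE('d) T) at_top"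
        using eventually_gt_at_top[of 0]
      proof eventually_elim
        case (elim T)
        have "(\<integral>t. indicator (box_B tc T) t * ?b t \<partial>index_measure tc) \<le> (\<integral>t. ?b t \<partial>index_measure tc)"
        proof (rule integral_mono[OF integrable_box[OF bb elim] integrable_real_indicator[OF box_B_sets fin]])
          show "indicator (box_B tc T) t * ?b t \<le> ?b t" for t by (simp add: indicator_def)
        qed
        also have "\<dots> = ?m"
        proof -
          have "box_B tc (R' + 1) \<inter> index_set tc = (box_B tc (R' + 1) :: (real ^ 'd) set)" by (auto simp: box_B_def)
          then show ?thesis by simp
        qed
        finally show ?case unfolding avg_def using elim by (simp add: vol_C_def divide_right_mono)
      qed
      have "filterlim (\<lambda>T. vol_C TYPE('d) T) at_top at_top"
        unfolding vol_C_def
      proof (rule filterlim_pow_at_top)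
        show "filterlim (\<lambda>T :: real. 2 * T) at_top at_top" by real_asymp
      qed simp
      then show "((\<lambda>T. ?m / vol_C TYPE('d) T) \<longlongrightarrow> 0) at_top"
        by (intro real_tendsto_divide_at_top[OF tendsto_const])
    qed
    have pw: "\<bar>?J t - L\<bar> \<le> e / 4 + (indicator (index_set tc - D) t + ?b t)" if t: "t \<in> index_set tc" for t
    proof (cases "t \<in> D \<and> sup_norm t \<ge> R'")
      case True
      then have "\<bar>?J t - L\<bar> < e / 4" using R[of t] by (simp add: R'_def)
      then show ?thesis by (simp add: indicator_def)
    next
      case False
      have "t \<in> box_B tc (R' + 1)" if "sup_norm t < R'"
      proof -
        have "- (R' + 1) < t $ i \<and> t $ i \<le> R' + 1" for i
          using component_le_sup_norm[of t i] that by (simp add: abs_le_iff)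
        then show ?thesis using t by (simp add: box_B_def)
      qed
      then have "1 \<le> indicator (index_set tc - D) t + ?b t" using False t by (cases "t \<in> D") (auto simp: not_le)
      moreover have "\<bar>?J t - L\<bar> \<le> 1" using J01[of t] L01 by (simp add: abs_le_iff)
      ultimately show ?thesis using e by simp
    qed
    have bd: "bounded_measurable tc (\<lambda>t. ?J t - L)" by (intro bounded_measurable_diff bJ bounded_measurable_const)
    have bs: "bounded_measurable tc (\<lambda>t. indicator (index_set tc - D) t + ?b t)" by (intro bounded_measurable_add bE bb)
    have "eventually (\<lambda>T. avg tc T (\<lambda>t. indicator (index_set tc - D) t + ?b t) < e / 4) at_top"
      by (rule order_tendstoD(2)[OF avg_zero_add[OF bE bb D0 b0]]) (use e in simp)
    moreover have "eventually (\<lambda>T. avg tc T (\<lambda>t :: real ^ 'd. e / 4) < e / 2) at_top"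
      by (rule order_tendstoD(2)[OF avg_const_tendsto]) (use e in simp)
    ultimately show "eventually (\<lambda>T. dist (avg tc T (\<lambda>t. ?J t - L)) 0 < e) at_top"
      using eventually_gt_at_top[of 0]
    proof eventually_elim
      case (elim T)
      have "\<bar>avg tc T (\<lambda>t. ?J t - L)\<bar> \<le> avg tc T (\<lambda>t. \<bar>?J t - L\<bar>)" by (rule avg_abs_le[OF bd elim(3)])
      also have "\<dots> \<le> avg tc T (\<lambda>t. e / 4 + (indicator (index_set tc - D) t + ?b t))"
        by (intro avg_mono bounded_measurable_abs bd bounded_measurable_add bounded_measurable_const bE bb elim(3) pw box_B_index)
      also have "\<dots> = avg tc T (\<lambda>t :: real ^ 'd. e / 4) + avg tc T (\<lambda>t. indicator (index_set tc - D) t + ?b t)"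
        by (rule avg_add[OF bounded_measurable_const bs elim(3)])
      finally show ?case using elim(1,2) e by simp
    qed
  qed
  from tendsto_add[OF this avg_const_tendsto[of tc L, where 'd = 'd]]
  have "((\<lambda>T. avg tc T (\<lambda>t. ?J t - L) + avg tc T (\<lambda>t :: real ^ 'd. L)) \<longlongrightarrow> L) at_top" by simp
  moreover have "eventually (\<lambda>T. avg tc T (\<lambda>t. ?J t - L) + avg tc T (\<lambda>t :: real ^ 'd. L) = avg tc T ?J) at_top"
    using eventually_gt_at_top[of 0]
    by eventually_elim (simp add: avg_diff[OF bJ bounded_measurable_const])
  ultimately show "((\<lambda>T. avg tc T ?J) \<longlongrightarrow> path_prob P tc X A * path_prob P tc X B) at_top"
    unfolding L_def[symmetric] by (rule Lim_transform_eventually)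
qed

end

section \<open>Consequences of ergodicity\<close>

text \<open>Greedy choice: the sum of g (u - t i) over the points already chosen has vanishing
  averages, so it is below e at some u, and by nonnegativity so is each summand.\<close>

lemma avg_zero_separated_points:
  fixes g :: "real ^ 'd \<Rightarrow> real" and n :: nat
  assumes g: "bounded_measurable tc g" "\<And>t. t \<in> index_set tc \<Longrightarrow> 0 \<le> g t"
    and lim: "((\<lambda>T. avg tc T g) \<longlongrightarrow> 0) at_top" and e: "e > 0"
  shows "\<exists>t. (\<forall>i<n. t i \<in> index_set tc) \<and> (\<forall>j<n. \<forall>i<j. g (t j - t i) < e)"
proof (induction n)
  case 0
  show ?case by simp
next
  case (Suc n)
  then obtain t where t: "\<And>i. i < n \<Longrightarrow> t i \<in> index_set tc" "\<And>i j. j < n \<Longrightarrow> i < j \<Longrightarrow> g (t j - t i) < e" by blast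
  define h where "h u = (\<Sum>i<n. g (u + - t i))" for u
  have bm: "bounded_measurable tc (\<lambda>u. g (u + - t i))" if "i < n" for i
    by (rule bounded_measurable_shift[OF g(1) index_set_minus[OF t(1)[OF that]]])
  have h_bm: "bounded_measurable tc h" unfolding h_def by (rule bounded_measurable_sum) (use bm in auto)
  have h_lim: "((\<lambda>T. avg tc T h) \<longlongrightarrow> 0) at_top"
    unfolding h_def
  proof (rule avg_zero_sum)
    fix i assume "i \<in> {..<n}"
    then have i: "i < n" by simp
    show "bounded_measurable tc (\<lambda>u. g (u + - t i))" by (rule bm[OF i])
    show "((\<lambda>T. avg tc T (\<lambda>u. g (u + - t i))) \<longlongrightarrow> 0) at_top"
      by (rule avg_zero_shift[OF g index_set_minus[OF t(1)[OF i]] lim])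
  qed simp
  have "\<exists>u\<in>index_set tc. h u < e"
  proof (rule ccontr)
    assume "\<not> ?thesis"
    then have ge: "\<And>u. u \<in> index_set tc \<Longrightarrow> e \<le> h u" by (auto simp: not_less)
    have "e \<le> 0"
    proof (rule tendsto_le[OF _ h_lim avg_const_tendsto[of tc e, where 'd = 'd]])
      show "eventually (\<lambda>T. avg tc T (\<lambda>t :: real ^ 'd. e) \<le> avg tc T h) at_top"
        using eventually_gt_at_top[of 0]
        by eventually_elim (intro avg_mono bounded_measurable_const h_bm ge box_B_index)
    qed simp
    then show False using e by simp
  qed
  then obtain u where u: "u \<in> index_set tc" "h u < e" by blast
  have small: "g (u - t i) < e" if i: "i < n" for i
  proof -
    have "g (u + - t i) \<le> h u"
      unfolding h_def
      by (rule member_le_sum) (use i u t(1) in \<open>auto intro!: g(2) index_set_diff\<close>)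
    then show ?thesis using u(2) by simp
  qed
  show ?case
  proof (intro exI[of _ "t(n := u)"] conjI allI impI)
    show "(t(n := u)) i \<in> index_set tc" if "i < Suc n" for i using that t(1) u(1) by (auto simp: less_Suc_eq)
    show "g ((t(n := u)) j - (t(n := u)) i) < e" if "j < Suc n" "i < j" for i j
      using that t(2) small by (auto simp: less_Suc_eq)
  qed
qed

text \<open>A Bonferroni inequality: each new set meets the union of the earlier ones in at most the
  sum of the pairwise overlaps.\<close>

lemma measure_union_ge:
  fixes A :: "nat \<Rightarrow> 's set"
  assumes M: "finite_measure M" and A: "\<And>i. i < n \<Longrightarrow> A i \<in> sets M"
  shows "(\<Sum>i<n. measure M (A i)) - (\<Sum>j<n. \<Sum>i<j. measure M (A i \<inter> A j)) \<le> measure M (\<Union>i<n. A i)"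
  using A
proof (induction n)
  case (Suc n)
  interpret finite_measure M by fact
  let ?U = "\<Union>i<n. A i"
  have U: "?U \<in> sets M" using Suc.prems by auto
  have "measure M (?U \<inter> A n) = measure M (\<Union>i<n. A i \<inter> A n)" by (simp add: Int_UN_distrib2)
  also have "\<dots> \<le> (\<Sum>i<n. measure M (A i \<inter> A n))"
    using Suc.prems by (intro finite_measure_subadditive_finite) auto
  finally have i: "measure M (?U \<inter> A n) \<le> (\<Sum>i<n. measure M (A i \<inter> A n))" .
  have "measure M (A n \<union> ?U) = measure M (A n) + measure M ?U - measure M (A n \<inter> ?U)"
    using U Suc.prems by (intro measure_Un3) (auto simp: fmeasurable_def emeasure_eq_measure)
  moreover have "(\<Union>i<Suc n. A i) = A n \<union> ?U" by (auto simp: less_Suc_eq)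
  moreover have "(\<Sum>i<n. measure M (A i)) - (\<Sum>j<n. \<Sum>i<j. measure M (A i \<inter> A j)) \<le> measure M ?U"
    using Suc by auto
  ultimately show ?case using i by (simp add: Int_commute)
qed simp

section \<open>Ergodic averages of functions of two coordinates\<close>

context sas_field
begin

lemma real_X_joint_measurable:
  assumes "tc = RealCase"
  shows "(\<lambda>z. X (- fst z) (snd z)) \<in> borel_measurable ((lborel :: (real ^ 'd) measure) \<Otimes>\<^sub>M P)"
proof -
  have "(\<lambda>(t, \<omega>). X t \<omega>) \<in> borel_measurable ((lborel :: (real ^ 'd) measure) \<Otimes>\<^sub>M P)"
    using field_measurable assms by (simp add: measurable_field_def)
  moreover have "(\<lambda>z. (- fst z, snd z)) \<in> measurable ((lborel :: (real ^ 'd) measure) \<Otimes>\<^sub>M P) (lborel \<Otimes>\<^sub>M P)"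
    by measurable
  ultimately show ?thesis using measurable_compose by fastforce
qed

lemma expectation_product_bounded_measurable:
  fixes F G :: "real \<Rightarrow> real"
  assumes [measurable]: "F \<in> borel_measurable borel" "G \<in> borel_measurable borel"
    and F: "\<And>y. \<bar>F y\<bar> \<le> 1" and G: "\<And>y. \<bar>G y\<bar> \<le> 1"
  shows "bounded_measurable tc (\<lambda>t. \<integral>\<omega>. F (X 0 \<omega>) * G (X (- t) \<omega>) \<partial>P)"
proof (rule bounded_measurableI[of _ _ 1])
  fix t :: "real ^ 'd"
  have le: "\<bar>F (X 0 \<omega>) * G (X (- t) \<omega>)\<bar> \<le> 1" for \<omega>
    using mult_mono[OF F[of "X 0 \<omega>"] G[of "X (- t) \<omega>"]] by (simp add: abs_mult)
  show "\<bar>\<integral>\<omega>. F (X 0 \<omega>) * G (X (- t) \<omega>) \<partial>P\<bar> \<le> 1"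
  proof (cases "integrable P (\<lambda>\<omega>. F (X 0 \<omega>) * G (X (- t) \<omega>))")
    case True
    have "\<bar>\<integral>\<omega>. F (X 0 \<omega>) * G (X (- t) \<omega>) \<partial>P\<bar> \<le> (\<integral>\<omega>. \<bar>F (X 0 \<omega>) * G (X (- t) \<omega>)\<bar> \<partial>P)" by (rule integral_abs_bound)
    also have "\<dots> \<le> (\<integral>\<omega>. 1 \<partial>P)" using True le by (intro integral_mono) auto
    finally show ?thesis by (simp add: P.prob_space)
  qed (simp add: not_integrable_integral_eq)
next
  show "(\<lambda>t. \<integral>\<omega>. F (X 0 \<omega>) * G (X (- t) \<omega>) \<partial>P) \<in> borel_measurable (index_measure tc)"
  proof (cases tc)
    case IntCase
    then show ?thesis by (simp add: index_measure_def)
  next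
    case RealCase
    let ?M = "(lborel :: (real ^ 'd) measure) \<Otimes>\<^sub>M P"
    have "(\<lambda>z. X 0 (snd z)) \<in> borel_measurable ?M"
      by (rule measurable_compose[OF measurable_snd X_measurable[OF index_set_zero]])
    from measurable_compose[OF this assms(1)] measurable_compose[OF real_X_joint_measurable[OF RealCase] assms(2)]
    have "(\<lambda>z. F (X 0 (snd z)) * G (X (- fst z) (snd z))) \<in> borel_measurable ?M" by (rule borel_measurable_times)
    then have "(\<lambda>t. \<integral>\<omega>. F (X 0 \<omega>) * G (X (- t) \<omega>) \<partial>P) \<in> borel_measurable lborel"
      by (intro P.borel_measurable_lebesgue_integral) (simp add: case_prod_beta')
    then show ?thesis using RealCase by (simp add: index_measure_def)
  qed
qed

text \<open>Ergodicity for cylinder events over coordinate 0. The shifted path at that coordinate is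
  X (0 - t), whence the argument -t.\<close>

lemma ergodic_coordinate_sets:
  assumes erg: "ergodic_field P tc X" and A: "A \<in> sets borel" and B: "B \<in> sets borel"
  shows "((\<lambda>T. avg tc T (\<lambda>t. measure P {\<omega> \<in> space P. X 0 \<omega> \<in> A \<and> X (- t) \<omega> \<in> B}))
     \<longlongrightarrow> measure P {\<omega> \<in> space P. X 0 \<omega> \<in> A} * measure P {\<omega> \<in> space P. X 0 \<omega> \<in> B}) at_top"
    and "bounded_measurable tc (\<lambda>t. measure P {\<omega> \<in> space P. X 0 \<omega> \<in> A \<and> X (- t) \<omega> \<in> B})"
proof -
  define cyl :: "real set \<Rightarrow> (real ^ 'd \<Rightarrow> real) set" where "cyl A = (\<lambda>x. x 0) -` A \<inter> space path_space" for A
  have cyl: "cyl A \<in> path_sets tc" if "A \<in> sets borel" for A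
    unfolding cyl_def path_sets_def
    by (rule measurable_sets[OF measurable_component_singleton[OF index_set_zero] that])
  have sp: "path tc Y \<omega> \<in> space path_space" for Y and \<omega> :: 'w by (auto simp: path_def space_PiM)
  have ap: "path tc Y \<omega> 0 = Y 0 \<omega>" for Y :: "real ^ 'd \<Rightarrow> 'w \<Rightarrow> real" and \<omega> by (simp add: path_def)
  have mem: "path tc Y \<omega> \<in> cyl A \<longleftrightarrow> Y 0 \<omega> \<in> A" for Y :: "real ^ 'd \<Rightarrow> 'w \<Rightarrow> real" and \<omega> A by (simp add: cyl_def sp ap)
  have j: "joint_prob P tc X (cyl A) (cyl B) t = measure P {\<omega> \<in> space P. X 0 \<omega> \<in> A \<and> X (- t) \<omega> \<in> B}" for t
    unfolding joint_prob_def by (simp add: mem)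
  have p: "path_prob P tc X (cyl A) = measure P {\<omega> \<in> space P. X 0 \<omega> \<in> A}" for A
    unfolding path_prob_def by (simp add: mem)
  show "((\<lambda>T. avg tc T (\<lambda>t. measure P {\<omega> \<in> space P. X 0 \<omega> \<in> A \<and> X (- t) \<omega> \<in> B}))
     \<longlongrightarrow> measure P {\<omega> \<in> space P. X 0 \<omega> \<in> A} * measure P {\<omega> \<in> space P. X 0 \<omega> \<in> B}) at_top"
    using erg cyl[OF A] cyl[OF B] unfolding ergodic_field_def p[symmetric] j[symmetric] by blast
  show "bounded_measurable tc (\<lambda>t. measure P {\<omega> \<in> space P. X 0 \<omega> \<in> A \<and> X (- t) \<omega> \<in> B})"
    using joint_prob_bounded_measurable[OF cyl[OF A] cyl[OF B]] unfolding j[symmetric] by simp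
qed

text \<open>F and G are replaced by step functions with finitely many values, for which the claim is
  a finite combination of the statement about events. The rounding error is at most 2/m, uniformly
  in t.\<close>

lemma ergodic_expectation_product:
  fixes F G :: "real \<Rightarrow> real"
  assumes erg: "ergodic_field P tc X"
    and Fm [measurable]: "F \<in> borel_measurable borel" and Gm [measurable]: "G \<in> borel_measurable borel"
    and F: "\<And>y. \<bar>F y\<bar> \<le> 1" and G: "\<And>y. \<bar>G y\<bar> \<le> 1"
  shows "((\<lambda>T. avg tc T (\<lambda>t. \<integral>\<omega>. F (X 0 \<omega>) * G (X (- t) \<omega>) \<partial>P))
     \<longlongrightarrow> (\<integral>\<omega>. F (X 0 \<omega>) \<partial>P) * (\<integral>\<omega>. G (X 0 \<omega>) \<partial>P)) at_top"
proof (rule tendstoI)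
  fix e :: real assume e: "e > 0"
  \<comment> \<open>With 1/m < e/8 the rounding errors 2/m, one in the averages and one in the
    limit, are each below e/4; another e/4 is spent on the convergence for the step
    functions.\<close>
  obtain m0 :: nat where m0: "1 / real (Suc m0) < e / 8" using nat_approx_posE[of "e/8"] e by auto
  define m where "m = real (Suc m0)"
  have m: "m \<ge> 1" "1 / m < e / 8" using m0 by (auto simp: m_def)
  define K where "K = {- int (Suc m0)..int (Suc m0)}"
  have K: "finite K" by (simp add: K_def)
  \<comment> \<open>Rounding down to a multiple of 1/m keeps the modulus at most 1 because m is an
    integer.\<close>
  define q where "q H y = of_int \<lfloor>m * H y\<rfloor> / m" for H :: "real \<Rightarrow> real" and y
  define S where "S H k = {y. \<lfloor>m * H y\<rfloor> = k}" for H :: "real \<Rightarrow> real" and k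
  have S [measurable]: "S H k \<in> sets borel" if [measurable]: "H \<in> borel_measurable borel" for H k
  proof -
    have "{y \<in> space borel. \<lfloor>m * H y\<rfloor> = k} \<in> sets borel" by measurable
    then show ?thesis by (simp add: S_def)
  qed
  have qK: "\<lfloor>m * H y\<rfloor> \<in> K" if "\<And>y. \<bar>H y\<bar> \<le> 1" for H :: "real \<Rightarrow> real" and y
  proof -
    have "\<bar>m * H y\<bar> \<le> m" using that[of y] m(1) by (simp add: abs_mult)
    then have "of_int (- int (Suc m0)) \<le> m * H y" "m * H y \<le> of_int (int (Suc m0))"
      unfolding abs_le_iff m_def by auto
    then show ?thesis unfolding K_def
      by (intro atLeastAtMost_iff[THEN iffD2] conjI) (auto simp only: le_floor_iff dest: floor_mono[of "m * H y"] simp: floor_of_int)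
  qed
  have q_sum: "q H y = (\<Sum>k\<in>K. of_int k / m * indicator (S H k) y)" if H: "\<And>y. \<bar>H y\<bar> \<le> 1" for H :: "real \<Rightarrow> real" and y
  proof -
    have "(\<Sum>k\<in>K. of_int k / m * indicator (S H k) y) = (\<Sum>k\<in>K. if k = \<lfloor>m * H y\<rfloor> then of_int k / m else 0)"
      by (rule sum.cong) (auto simp: S_def indicator_def)
    also have "\<dots> = of_int \<lfloor>m * H y\<rfloor> / m"
    proof -
      have "\<lfloor>m * H y\<rfloor> \<in> K" by (rule qK) (rule H)
      then show ?thesis using K by simp
    qed
    finally show ?thesis by (simp add: q_def)
  qed
  have q_close: "\<bar>H y - q H y\<bar> \<le> 1 / m" for H :: "real \<Rightarrow> real" and y
  proof -
    have "\<bar>m * H y - of_int \<lfloor>m * H y\<rfloor>\<bar> \<le> 1" by linarith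
    then have "\<bar>m * H y - of_int \<lfloor>m * H y\<rfloor>\<bar> / m \<le> 1 / m" using m(1) by (intro divide_right_mono) auto
    moreover have "\<bar>m * H y - of_int \<lfloor>m * H y\<rfloor>\<bar> / m = \<bar>H y - q H y\<bar>"
    proof -
      have "H y - q H y = (m * H y - of_int \<lfloor>m * H y\<rfloor>) / m" using m(1) by (simp add: q_def field_simps)
      then show ?thesis using m(1) by simp
    qed
    ultimately show ?thesis by simp
  qed
  have q_bd: "\<bar>q H y\<bar> \<le> 1" if H: "\<And>y. \<bar>H y\<bar> \<le> 1" for H :: "real \<Rightarrow> real" and y
  proof -
    have "\<lfloor>m * H y\<rfloor> \<in> K" by (rule qK) (rule H)
    then have "\<bar>of_int \<lfloor>m * H y\<rfloor> :: real\<bar> \<le> m" unfolding K_def m_def atLeastAtMost_iff by linarith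
    then show ?thesis using m(1) by (simp add: q_def)
  qed
  have qm [measurable]: "q H \<in> borel_measurable borel" if [measurable]: "H \<in> borel_measurable borel" for H
    unfolding q_def by measurable
  have Xm: "X (- t) \<in> borel_measurable P" "X 0 \<in> borel_measurable P" if "t \<in> index_set tc" for t
    using X_measurable[OF index_set_minus[OF that]] X_measurable[OF index_set_zero] by auto
  have int: "integrable P (\<lambda>\<omega>. H (X 0 \<omega>) * H' (X (- t) \<omega>))"
    if [measurable]: "H \<in> borel_measurable borel" "H' \<in> borel_measurable borel" and "\<And>y. \<bar>H y\<bar> \<le> 1" "\<And>y. \<bar>H' y\<bar> \<le> 1" and t: "t \<in> index_set tc" for H H' :: "real \<Rightarrow> real" and t
  proof (rule P.integrable_const_bound[of _ 1])
    note [measurable] = Xm[OF t]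
    show "(\<lambda>\<omega>. H (X 0 \<omega>) * H' (X (- t) \<omega>)) \<in> borel_measurable P" by measurable
    show "AE \<omega> in P. norm (H (X 0 \<omega>) * H' (X (- t) \<omega>)) \<le> 1"
      using that(3,4) by (intro AE_I2) (auto simp: abs_mult intro!: mult_le_one)
  qed
  have int1: "integrable P (\<lambda>\<omega>. H (X 0 \<omega>))" if "H \<in> borel_measurable borel" "\<And>y. \<bar>H y\<bar> \<le> 1" for H :: "real \<Rightarrow> real"
    using int[of H "\<lambda>_. 1" 0] that by simp
  define a where "a t = (\<integral>\<omega>. F (X 0 \<omega>) * G (X (- t) \<omega>) \<partial>P)" for t
  define b where "b t = (\<integral>\<omega>. q F (X 0 \<omega>) * q G (X (- t) \<omega>) \<partial>P)" for t
  have a_bm: "bounded_measurable tc a" unfolding a_def by (intro expectation_product_bounded_measurable Fm Gm F G)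
  have b_bm: "bounded_measurable tc b" unfolding b_def by (intro expectation_product_bounded_measurable qm Fm Gm q_bd F G)
  have ab: "\<bar>a t - b t\<bar> \<le> 2 / m" if t: "t \<in> index_set tc" for t
  proof -
    note i = int[OF Fm Gm F G t] int[OF qm[OF Fm] qm[OF Gm] q_bd[OF F] q_bd[OF G] t]
    have "a t - b t = (\<integral>\<omega>. F (X 0 \<omega>) * G (X (- t) \<omega>) - q F (X 0 \<omega>) * q G (X (- t) \<omega>) \<partial>P)"
      unfolding a_def b_def using i by simp
    also have "\<bar>\<dots>\<bar> \<le> (\<integral>\<omega>. \<bar>F (X 0 \<omega>) * G (X (- t) \<omega>) - q F (X 0 \<omega>) * q G (X (- t) \<omega>)\<bar> \<partial>P)" by (rule integral_abs_bound)
    also have "\<dots> \<le> (\<integral>\<omega>. 2 / m \<partial>P)"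
    proof (rule integral_mono)
      show "integrable P (\<lambda>\<omega>. \<bar>F (X 0 \<omega>) * G (X (- t) \<omega>) - q F (X 0 \<omega>) * q G (X (- t) \<omega>)\<bar>)" using i by auto
      fix \<omega>
      let ?x = "X 0 \<omega>" and ?y = "X (- t) \<omega>"
      have "F ?x * G ?y - q F ?x * q G ?y = (F ?x - q F ?x) * G ?y + q F ?x * (G ?y - q G ?y)" by (simp add: algebra_simps)
      also have "\<bar>\<dots>\<bar> \<le> \<bar>F ?x - q F ?x\<bar> * \<bar>G ?y\<bar> + \<bar>q F ?x\<bar> * \<bar>G ?y - q G ?y\<bar>"
        unfolding abs_mult[symmetric] by (rule abs_triangle_ineq)
      also have "\<dots> \<le> 1 / m * 1 + 1 * (1 / m)"
        using m(1) by (intro add_mono mult_mono q_close G q_bd F) auto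
      finally show "\<bar>F ?x * G ?y - q F ?x * q G ?y\<bar> \<le> 2 / m" by simp
    qed simp
    finally show ?thesis by (simp add: P.prob_space)
  qed
  have lim_ab: "\<bar>(\<integral>\<omega>. F (X 0 \<omega>) \<partial>P) * (\<integral>\<omega>. G (X 0 \<omega>) \<partial>P) - (\<integral>\<omega>. q F (X 0 \<omega>) \<partial>P) * (\<integral>\<omega>. q G (X 0 \<omega>) \<partial>P)\<bar> \<le> 2 / m"
  proof -
    have c: "\<bar>(\<integral>\<omega>. H (X 0 \<omega>) \<partial>P) - (\<integral>\<omega>. q H (X 0 \<omega>) \<partial>P)\<bar> \<le> 1 / m"
      if Hm: "H \<in> borel_measurable borel" and H: "\<And>y. \<bar>H y\<bar> \<le> 1" for H :: "real \<Rightarrow> real"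
    proof -
      note i = int1[OF Hm H] int1[OF qm[OF Hm] q_bd[OF H]]
      have "(\<integral>\<omega>. H (X 0 \<omega>) \<partial>P) - (\<integral>\<omega>. q H (X 0 \<omega>) \<partial>P) = (\<integral>\<omega>. H (X 0 \<omega>) - q H (X 0 \<omega>) \<partial>P)" using i by simp
      also have "\<bar>\<dots>\<bar> \<le> (\<integral>\<omega>. \<bar>H (X 0 \<omega>) - q H (X 0 \<omega>)\<bar> \<partial>P)" by (rule integral_abs_bound)
      also have "\<dots> \<le> (\<integral>\<omega>. 1 / m \<partial>P)" using i by (intro integral_mono q_close) auto
      finally show ?thesis by (simp add: P.prob_space)
    qed
    have d: "\<bar>\<integral>\<omega>. H (X 0 \<omega>) \<partial>P\<bar> \<le> 1" if Hm: "H \<in> borel_measurable borel" and H: "\<And>y. \<bar>H y\<bar> \<le> 1" for H :: "real \<Rightarrow> real"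
    proof -
      have "\<bar>\<integral>\<omega>. H (X 0 \<omega>) \<partial>P\<bar> \<le> (\<integral>\<omega>. \<bar>H (X 0 \<omega>)\<bar> \<partial>P)" by (rule integral_abs_bound)
      also have "\<dots> \<le> (\<integral>\<omega>. 1 \<partial>P)" using int1[OF Hm H] H by (intro integral_mono) auto
      finally show ?thesis by (simp add: P.prob_space)
    qed
    let ?f = "\<integral>\<omega>. F (X 0 \<omega>) \<partial>P" and ?g = "\<integral>\<omega>. G (X 0 \<omega>) \<partial>P" and ?f' = "\<integral>\<omega>. q F (X 0 \<omega>) \<partial>P" and ?g' = "\<integral>\<omega>. q G (X 0 \<omega>) \<partial>P"
    have prod_diff: "\<bar>x * y - x' * y'\<bar> \<le> \<bar>x - x'\<bar> * \<bar>y\<bar> + \<bar>x'\<bar> * \<bar>y - y'\<bar>" for x y x' y' :: real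
    proof -
      have "x * y - x' * y' = (x - x') * y + x' * (y - y')" by (simp add: algebra_simps)
      then show ?thesis using abs_triangle_ineq[of "(x - x') * y" "x' * (y - y')"] by (simp add: abs_mult)
    qed
    have "\<bar>?f * ?g - ?f' * ?g'\<bar> \<le> \<bar>?f - ?f'\<bar> * \<bar>?g\<bar> + \<bar>?f'\<bar> * \<bar>?g - ?g'\<bar>"
      by (rule prod_diff)
    also have "\<dots> \<le> 1 / m * 1 + 1 * (1 / m)"
    proof -
      have c1: "\<bar>?f - ?f'\<bar> \<le> 1 / m" by (rule c[OF Fm]) (rule F)
      have c2: "\<bar>?g - ?g'\<bar> \<le> 1 / m" by (rule c[OF Gm]) (rule G)
      have d1: "\<bar>?g\<bar> \<le> 1" by (rule d[OF Gm]) (rule G)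
      have d2: "\<bar>?f'\<bar> \<le> 1" by (rule d[OF qm[OF Fm]]) (rule q_bd, rule F)
      show ?thesis using m(1) by (intro add_mono mult_mono c1 c2 d1 d2) auto
    qed
    finally show ?thesis by simp
  qed
  have b_lim: "((\<lambda>T. avg tc T b) \<longlongrightarrow> (\<integral>\<omega>. q F (X 0 \<omega>) \<partial>P) * (\<integral>\<omega>. q G (X 0 \<omega>) \<partial>P)) at_top"
  proof -
    let ?p = "\<lambda>k l t. measure P {\<omega> \<in> space P. X 0 \<omega> \<in> S F k \<and> X (- t) \<omega> \<in> S G l}"
    let ?s = "\<lambda>H k. measure P {\<omega> \<in> space P. X 0 \<omega> \<in> S H k}"
    have bt: "b t = (\<Sum>k\<in>K. \<Sum>l\<in>K. (of_int k / m * (of_int l / m)) * ?p k l t)" if t: "t \<in> index_set tc" for t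
    proof -
      note [measurable] = Xm[OF t] S[OF Fm] S[OF Gm]
      have "b t = (\<integral>\<omega>. (\<Sum>k\<in>K. \<Sum>l\<in>K. (of_int k / m * (of_int l / m)) * indicator {\<omega> \<in> space P. X 0 \<omega> \<in> S F k \<and> X (- t) \<omega> \<in> S G l} \<omega>) \<partial>P)"
        unfolding b_def q_sum[OF F] q_sum[OF G] sum_product
        by (intro Bochner_Integration.integral_cong refl sum.cong) (auto simp: indicator_def)
      also have "\<dots> = (\<Sum>k\<in>K. \<Sum>l\<in>K. (of_int k / m * (of_int l / m)) * ?p k l t)"
      proof -
        have i: "integrable P (indicator {\<omega> \<in> space P. X 0 \<omega> \<in> S F k \<and> X (- t) \<omega> \<in> S G l} :: _ \<Rightarrow> real)" for k l
          by (rule integrable_real_indicator) (auto simp: P.emeasure_eq_measure)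
        have e: "{\<omega> \<in> space P. X 0 \<omega> \<in> S F k \<and> X (- t) \<omega> \<in> S G l} \<inter> space P = {\<omega> \<in> space P. X 0 \<omega> \<in> S F k \<and> X (- t) \<omega> \<in> S G l}" for k l by auto
        show ?thesis using i by (simp add: Bochner_Integration.integral_sum e)
      qed
      finally show ?thesis .
    qed
    have qs: "(\<integral>\<omega>. q H (X 0 \<omega>) \<partial>P) = (\<Sum>k\<in>K. of_int k / m * ?s H k)" if Hm: "H \<in> borel_measurable borel" and H: "\<And>y. \<bar>H y\<bar> \<le> 1" for H :: "real \<Rightarrow> real"
    proof -
      note [measurable] = Xm[OF index_set_zero] S[OF Hm]
      have "(\<integral>\<omega>. q H (X 0 \<omega>) \<partial>P) = (\<integral>\<omega>. (\<Sum>k\<in>K. of_int k / m * indicator {\<omega> \<in> space P. X 0 \<omega> \<in> S H k} \<omega>) \<partial>P)"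
        unfolding q_sum[OF H] by (intro Bochner_Integration.integral_cong refl sum.cong) (auto simp: indicator_def)
      also have "\<dots> = (\<Sum>k\<in>K. of_int k / m * ?s H k)"
      proof -
        have i: "integrable P (indicator {\<omega> \<in> space P. X 0 \<omega> \<in> S H k} :: _ \<Rightarrow> real)" for k
          by (rule integrable_real_indicator) (auto simp: P.emeasure_eq_measure)
        have e: "{\<omega> \<in> space P. X 0 \<omega> \<in> S H k} \<inter> space P = {\<omega> \<in> space P. X 0 \<omega> \<in> S H k}" for k by auto
        show ?thesis using i by (simp add: Bochner_Integration.integral_sum e)
      qed
      finally show ?thesis .
    qed
    note es = ergodic_coordinate_sets[OF erg S[OF Fm] S[OF Gm]]
    have "eventually (\<lambda>T. (\<Sum>k\<in>K. \<Sum>l\<in>K. (of_int k / m * (of_int l / m)) * avg tc T (?p k l)) = avg tc T b) at_top"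
      using eventually_gt_at_top[of 0]
    proof eventually_elim
      case (elim T)
      have sum_avg: "avg tc T (\<lambda>t. \<Sum>i\<in>A. g i t) = (\<Sum>i\<in>A. avg tc T (g i))"
        if "finite A" "\<And>i. i \<in> A \<Longrightarrow> bounded_measurable tc (g i)" for A :: "int set" and g :: "int \<Rightarrow> real ^ 'd \<Rightarrow> real"
        using that
      proof (induction A rule: finite_induct)
        case empty
        show ?case by (simp add: avg_def)
      next
        case (insert i A)
        then have "avg tc T (\<lambda>t. g i t + (\<Sum>i\<in>A. g i t)) = avg tc T (g i) + avg tc T (\<lambda>t. \<Sum>i\<in>A. g i t)"
          by (intro avg_add bounded_measurable_sum elim) auto
        with insert show ?case by simp
      qed
      have bm1: "bounded_measurable tc (\<lambda>t. (of_int k / m * (of_int l / m)) * ?p k l t)" for k l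
        by (intro bounded_measurable_mult bounded_measurable_const es(2))
      have "avg tc T b = avg tc T (\<lambda>t. \<Sum>k\<in>K. \<Sum>l\<in>K. (of_int k / m * (of_int l / m)) * ?p k l t)"
        unfolding avg_def using bt
        by (intro arg_cong[where f = "\<lambda>z. _ * z"] Bochner_Integration.integral_cong) (auto simp: indicator_def box_B_index)
      also have "\<dots> = (\<Sum>k\<in>K. avg tc T (\<lambda>t. \<Sum>l\<in>K. (of_int k / m * (of_int l / m)) * ?p k l t))"
        by (rule sum_avg[OF K]) (intro bounded_measurable_sum bm1)
      also have "\<dots> = (\<Sum>k\<in>K. \<Sum>l\<in>K. avg tc T (\<lambda>t. (of_int k / m * (of_int l / m)) * ?p k l t))"
        by (intro sum.cong refl sum_avg[OF K] bm1)
      also have "\<dots> = (\<Sum>k\<in>K. \<Sum>l\<in>K. (of_int k / m * (of_int l / m)) * avg tc T (?p k l))"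
        by (simp only: avg_cmult)
      finally show ?case by simp
    qed
    moreover have "((\<lambda>T. \<Sum>k\<in>K. \<Sum>l\<in>K. (of_int k / m * (of_int l / m)) * avg tc T (?p k l))
       \<longlongrightarrow> (\<Sum>k\<in>K. \<Sum>l\<in>K. (of_int k / m * (of_int l / m)) * (?s F k * ?s G l))) at_top"
      by (intro tendsto_sum tendsto_mult tendsto_const es(1))
    moreover have "(\<Sum>k\<in>K. \<Sum>l\<in>K. (of_int k / m * (of_int l / m)) * (?s F k * ?s G l)) = (\<integral>\<omega>. q F (X 0 \<omega>) \<partial>P) * (\<integral>\<omega>. q G (X 0 \<omega>) \<partial>P)"
      unfolding qs[OF Fm F] qs[OF Gm G] sum_product by (intro sum.cong refl) (simp only: mult_ac)
    ultimately show ?thesis by (simp only: tendsto_cong)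
  qed
  have "eventually (\<lambda>T. dist (avg tc T b) ((\<integral>\<omega>. q F (X 0 \<omega>) \<partial>P) * (\<integral>\<omega>. q G (X 0 \<omega>) \<partial>P)) < e / 4) at_top"
    by (rule tendstoD[OF b_lim]) (use e in simp)
  moreover have "eventually (\<lambda>T. avg tc T (\<lambda>t :: real ^ 'd. 2 / m) < e / 4) at_top"
  proof (rule order_tendstoD(2)[OF avg_const_tendsto])
    have "2 / m = 2 * (1 / m)" by simp
    then show "2 / m < e / 4" using m(2) by linarith
  qed
  ultimately show "eventually (\<lambda>T. dist (avg tc T (\<lambda>t. \<integral>\<omega>. F (X 0 \<omega>) * G (X (- t) \<omega>) \<partial>P))
      ((\<integral>\<omega>. F (X 0 \<omega>) \<partial>P) * (\<integral>\<omega>. G (X 0 \<omega>) \<partial>P)) < e) at_top"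
    using eventually_gt_at_top[of 0]
  proof eventually_elim
    case (elim T)
    have "\<bar>avg tc T a - avg tc T b\<bar> = \<bar>avg tc T (\<lambda>t. a t - b t)\<bar>" by (simp add: avg_diff[OF a_bm b_bm elim(3)])
    also have "\<dots> \<le> avg tc T (\<lambda>t. \<bar>a t - b t\<bar>)" by (intro avg_abs_le bounded_measurable_diff a_bm b_bm elim)
    also have "\<dots> \<le> avg tc T (\<lambda>t :: real ^ 'd. 2 / m)"
      by (intro avg_mono bounded_measurable_abs bounded_measurable_diff a_bm b_bm bounded_measurable_const elim ab box_B_index)
    finally have 1: "\<bar>avg tc T a - avg tc T b\<bar> < e / 4" using elim(2) by linarith
    have "2 / m = 2 * (1 / m)" by simp
    then have 2: "2 / m < e / 4" using m(2) by linarith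
    have "\<bar>avg tc T a - (\<integral>\<omega>. F (X 0 \<omega>) \<partial>P) * (\<integral>\<omega>. G (X 0 \<omega>) \<partial>P)\<bar> < e"
      using 1 2 lim_ab elim(1) e unfolding dist_real_def by linarith
    then show ?case unfolding a_def dist_real_def .
  qed
qed

end

section \<open>From ergodicity to almost disjoint translates\<close>

context sas_field
begin

text \<open>Meant for the signs 1 and -1. The time is -t because the shifted path at coordinate 0 is
  X (- t).\<close>

definition pair_norm :: "real \<Rightarrow> real ^ 'd \<Rightarrow> real" where
  "pair_norm \<sigma> t = (\<integral>x. \<bar>f 0 x + \<sigma> * f (- t) x\<bar> powr \<alpha> \<partial>\<mu>)"

lemma cis_integrable:
  assumes "Y \<in> borel_measurable P"
  shows "integrable P (\<lambda>\<omega>. cis (Y \<omega>))"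
proof (rule P.integrable_const_bound[of _ 1])
  have "cis \<in> borel_measurable borel" by (intro borel_measurable_continuous_onI continuous_on_cis continuous_on_id)
  from measurable_compose[OF assms this] show "(\<lambda>\<omega>. cis (Y \<omega>)) \<in> borel_measurable P" .
qed simp

lemma cos_expectation:
  "(\<integral>\<omega>. cos (\<theta> * X 0 \<omega>) \<partial>P) = exp (- (\<bar>\<theta>\<bar> powr \<alpha> * kernel 0))"
  "(\<integral>\<omega>. sin (\<theta> * X 0 \<omega>) \<partial>P) = 0"
proof -
  have "(CLINT \<omega>|P. cis (\<theta> * X 0 \<omega>)) = complex_of_real (exp (- (\<integral>x. \<bar>\<theta> * f 0 x\<bar> powr \<alpha> \<partial>\<mu>)))"
    using characteristic_function[of "{()}" "\<lambda>_. 0" "\<lambda>_. \<theta>"] by simp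
  also have "(\<integral>x. \<bar>\<theta> * f 0 x\<bar> powr \<alpha> \<partial>\<mu>) = \<bar>\<theta>\<bar> powr \<alpha> * kernel 0"
    using v_norm[OF index_set_zero] by (simp add: abs_mult powr_mult v_square)
  finally have c: "(CLINT \<omega>|P. cis (\<theta> * X 0 \<omega>)) = complex_of_real (exp (- (\<bar>\<theta>\<bar> powr \<alpha> * kernel 0)))" .
  have i: "integrable P (\<lambda>\<omega>. cis (\<theta> * X 0 \<omega>))"
    by (intro cis_integrable borel_measurable_times borel_measurable_const X_measurable index_set_zero)
  show "(\<integral>\<omega>. cos (\<theta> * X 0 \<omega>) \<partial>P) = exp (- (\<bar>\<theta>\<bar> powr \<alpha> * kernel 0))"
    using integral_Re[OF i] c by (simp del: of_real_exp)
  show "(\<integral>\<omega>. sin (\<theta> * X 0 \<omega>) \<partial>P) = 0"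
    using integral_Im[OF i] c by (simp del: of_real_exp)
qed

text \<open>By the addition formula the left side is the expectation of cos(\<theta> X 0 + \<sigma>
  \<theta> X (- t)), which is the real part of a joint characteristic function.\<close>

lemma pair_expectation:
  assumes t: "t \<in> index_set tc" and \<sigma>: "\<sigma> \<in> {1, -1}"
  shows "(\<integral>\<omega>. cos (\<theta> * X 0 \<omega>) * cos (\<theta> * X (- t) \<omega>) \<partial>P) - \<sigma> * (\<integral>\<omega>. sin (\<theta> * X 0 \<omega>) * sin (\<theta> * X (- t) \<omega>) \<partial>P)
    = exp (- (\<bar>\<theta>\<bar> powr \<alpha> * pair_norm \<sigma> t))"
proof -
  have mt: "- t \<in> index_set tc" using t by (rule index_set_minus)
  note [measurable] = X_measurable[OF mt] X_measurable[OF index_set_zero]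
  let ?\<tau> = "\<lambda>b. if b then 0 else - t" and ?a = "\<lambda>b. if b then \<theta> else \<sigma> * \<theta>"
  have tau: "?\<tau> b \<in> index_set tc" for b using mt by simp
  have "(CLINT \<omega>|P. cis (\<theta> * X 0 \<omega> + \<sigma> * \<theta> * X (- t) \<omega>)) = complex_of_real (exp (- (\<integral>x. \<bar>\<theta> * f 0 x + \<sigma> * \<theta> * f (- t) x\<bar> powr \<alpha> \<partial>\<mu>)))"
    using characteristic_function[of UNIV ?\<tau> ?a, OF finite tau] by (simp add: UNIV_bool add.commute)
  also have "(\<lambda>x. \<bar>\<theta> * f 0 x + \<sigma> * \<theta> * f (- t) x\<bar> powr \<alpha>) = (\<lambda>x. \<bar>\<theta>\<bar> powr \<alpha> * \<bar>f 0 x + \<sigma> * f (- t) x\<bar> powr \<alpha>)"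
  proof
    fix x
    have "\<theta> * f 0 x + \<sigma> * \<theta> * f (- t) x = \<theta> * (f 0 x + \<sigma> * f (- t) x)" by (simp add: algebra_simps)
    then show "\<bar>\<theta> * f 0 x + \<sigma> * \<theta> * f (- t) x\<bar> powr \<alpha> = \<bar>\<theta>\<bar> powr \<alpha> * \<bar>f 0 x + \<sigma> * f (- t) x\<bar> powr \<alpha>"
      by (simp only: abs_mult powr_mult abs_ge_zero)
  qed
  finally have c: "(CLINT \<omega>|P. cis (\<theta> * X 0 \<omega> + \<sigma> * \<theta> * X (- t) \<omega>)) = complex_of_real (exp (- (\<bar>\<theta>\<bar> powr \<alpha> * pair_norm \<sigma> t)))"
    by (simp add: pair_norm_def del: of_real_exp)
  have i: "integrable P (\<lambda>\<omega>. cis (\<theta> * X 0 \<omega> + \<sigma> * \<theta> * X (- t) \<omega>))" by (rule cis_integrable) measurable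
  have ic: "integrable P (\<lambda>\<omega>. cos (\<theta> * X 0 \<omega>) * cos (\<theta> * X (- t) \<omega>))"
    by (rule P.integrable_const_bound[of _ 1]) (auto simp: abs_mult intro!: mult_le_one)
  have is': "integrable P (\<lambda>\<omega>. sin (\<theta> * X 0 \<omega>) * sin (\<theta> * X (- t) \<omega>))"
    by (rule P.integrable_const_bound[of _ 1]) (auto simp: abs_mult intro!: mult_le_one)
  have "(\<integral>\<omega>. cos (\<theta> * X 0 \<omega>) * cos (\<theta> * X (- t) \<omega>) \<partial>P) - \<sigma> * (\<integral>\<omega>. sin (\<theta> * X 0 \<omega>) * sin (\<theta> * X (- t) \<omega>) \<partial>P)
     = (\<integral>\<omega>. cos (\<theta> * X 0 \<omega>) * cos (\<theta> * X (- t) \<omega>) - \<sigma> * (sin (\<theta> * X 0 \<omega>) * sin (\<theta> * X (- t) \<omega>)) \<partial>P)"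
    using ic is' by simp
  also have "\<dots> = (\<integral>\<omega>. Re (cis (\<theta> * X 0 \<omega> + \<sigma> * \<theta> * X (- t) \<omega>)) \<partial>P)"
    using \<sigma> by (intro Bochner_Integration.integral_cong) (auto simp: cos_add)
  also have "\<dots> = exp (- (\<bar>\<theta>\<bar> powr \<alpha> * pair_norm \<sigma> t))"
    unfolding integral_Re[OF i] c by simp
  finally show ?thesis .
qed

text \<open>Ergodicity is applied to the product of cosines and to the product of sines; the sine
  part has limit 0 since the sine of X 0 has mean zero.\<close>

lemma ergodic_avg_exp_pair_norm:
  assumes erg: "ergodic_field P tc X" and \<sigma>: "\<sigma> \<in> {1, -1}"
  shows "((\<lambda>T. avg tc T (\<lambda>t. exp (- (\<bar>\<theta>\<bar> powr \<alpha> * pair_norm \<sigma> t)))) \<longlongrightarrow> exp (- (2 * \<bar>\<theta>\<bar> powr \<alpha> * kernel 0))) at_top"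
    and "bounded_measurable tc (\<lambda>t. exp (- (\<bar>\<theta>\<bar> powr \<alpha> * pair_norm \<sigma> t)))"
proof -
  let ?c = "\<lambda>t. \<integral>\<omega>. cos (\<theta> * X 0 \<omega>) * cos (\<theta> * X (- t) \<omega>) \<partial>P" and ?s = "\<lambda>t. \<integral>\<omega>. sin (\<theta> * X 0 \<omega>) * sin (\<theta> * X (- t) \<omega>) \<partial>P"
  let ?e = "\<lambda>t. exp (- (\<bar>\<theta>\<bar> powr \<alpha> * pair_norm \<sigma> t))"
  have cm: "(\<lambda>y. cos (\<theta> * y)) \<in> borel_measurable borel" "(\<lambda>y. sin (\<theta> * y)) \<in> borel_measurable borel" by measurable
  have bc: "bounded_measurable tc ?c"
    by (rule expectation_product_bounded_measurable[where F = "\<lambda>y. cos (\<theta> * y)" and G = "\<lambda>y. cos (\<theta> * y)", OF cm(1) cm(1)]) auto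
  have bs: "bounded_measurable tc ?s"
    by (rule expectation_product_bounded_measurable[where F = "\<lambda>y. sin (\<theta> * y)" and G = "\<lambda>y. sin (\<theta> * y)", OF cm(2) cm(2)]) auto
  have lc: "((\<lambda>T. avg tc T ?c) \<longlongrightarrow> exp (- (\<bar>\<theta>\<bar> powr \<alpha> * kernel 0)) * exp (- (\<bar>\<theta>\<bar> powr \<alpha> * kernel 0))) at_top"
    using ergodic_expectation_product[where F = "\<lambda>y. cos (\<theta> * y)" and G = "\<lambda>y. cos (\<theta> * y)", OF erg cm(1) cm(1)]
    by (simp add: cos_expectation)
  have ls: "((\<lambda>T. avg tc T ?s) \<longlongrightarrow> 0) at_top"
    using ergodic_expectation_product[where F = "\<lambda>y. sin (\<theta> * y)" and G = "\<lambda>y. sin (\<theta> * y)", OF erg cm(2) cm(2)]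
    by (simp add: cos_expectation)
  have bd: "bounded_measurable tc (\<lambda>t. ?c t - \<sigma> * ?s t)"
    by (intro bounded_measurable_diff bounded_measurable_mult bounded_measurable_const bc bs)
  have eq: "?e t = ?c t - \<sigma> * ?s t" if "t \<in> index_set tc" for t using pair_expectation[OF that \<sigma>, of \<theta>] by simp
  show "bounded_measurable tc ?e" using bd eq by (rule bounded_measurable_cong)
  have "((\<lambda>T. avg tc T ?c - \<sigma> * avg tc T ?s) \<longlongrightarrow> exp (- (\<bar>\<theta>\<bar> powr \<alpha> * kernel 0)) * exp (- (\<bar>\<theta>\<bar> powr \<alpha> * kernel 0)) - \<sigma> * 0) at_top"
    by (intro tendsto_diff tendsto_mult[OF tendsto_const ls] lc)
  moreover have "exp (- (\<bar>\<theta>\<bar> powr \<alpha> * kernel 0)) * exp (- (\<bar>\<theta>\<bar> powr \<alpha> * kernel 0)) - \<sigma> * 0 = exp (- (2 * \<bar>\<theta>\<bar> powr \<alpha> * kernel 0))"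
    by (simp flip: exp_add)
  moreover have "eventually (\<lambda>T. avg tc T ?c - \<sigma> * avg tc T ?s = avg tc T ?e) at_top"
    using eventually_gt_at_top[of 0]
  proof eventually_elim
    case (elim T)
    have "avg tc T ?e = avg tc T (\<lambda>t. ?c t - \<sigma> * ?s t)"
      by (rule avg_cong) (rule eq)
    also have "\<dots> = avg tc T ?c - avg tc T (\<lambda>t. \<sigma> * ?s t)"
      by (intro avg_diff bc bounded_measurable_mult bounded_measurable_const bs elim)
    finally show ?case by (simp only: avg_cmult)
  qed
  ultimately show "((\<lambda>T. avg tc T ?e) \<longlongrightarrow> exp (- (2 * \<bar>\<theta>\<bar> powr \<alpha> * kernel 0))) at_top"
    by (simp only: tendsto_cong)
qed

text \<open>The value of \<open>exp (- pair_norm \<sigma> t)\<close> that independence of X 0 and X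
  (- t) would give.\<close>

definition limit_char :: real where "limit_char = exp (- (2 * kernel 0))"

text \<open>Squares, so that a small average means smallness at most times; both signs in one
  function, so that good times are common to both.\<close>

definition deviation :: "real ^ 'd \<Rightarrow> real" where
  "deviation t = (exp (- pair_norm 1 t) - limit_char)\<^sup>2 + (exp (- pair_norm (-1) t) - limit_char)\<^sup>2"

text \<open>A variance computation for a = exp(-N), where N is the pair norm. Frequency 1 gives the
  limit q for the averages of a; frequency \<open>2 powr (1 / \<alpha>)\<close> doubles the exponent
  and gives the limit q^2 for a^2. So the average of (a - q)^2 tends to q^2 - 2 q q + q^2 =
  0.\<close>

lemma ergodic_avg_deviation:
  assumes erg: "ergodic_field P tc X"
  shows "bounded_measurable tc deviation" "((\<lambda>T. avg tc T deviation) \<longlongrightarrow> 0) at_top"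
proof -
  let ?q = limit_char
  have one: "bounded_measurable tc (\<lambda>t. (exp (- pair_norm \<sigma> t) - ?q)\<^sup>2) \<and> ((\<lambda>T. avg tc T (\<lambda>t. (exp (- pair_norm \<sigma> t) - ?q)\<^sup>2)) \<longlongrightarrow> 0) at_top"
    if \<sigma>: "\<sigma> \<in> {1, -1}" for \<sigma>
  proof -
    let ?a = "\<lambda>t. exp (- pair_norm \<sigma> t)" and ?b = "\<lambda>t. exp (- (2 * pair_norm \<sigma> t))"
    have two: "\<bar>2 powr (1 / \<alpha>)\<bar> powr \<alpha> = 2" using alpha by (simp add: powr_powr)
    have la: "((\<lambda>T. avg tc T ?a) \<longlongrightarrow> ?q) at_top" and ba: "bounded_measurable tc ?a"
      using ergodic_avg_exp_pair_norm[OF erg \<sigma>, of 1] by (auto simp: limit_char_def)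
    have lb: "((\<lambda>T. avg tc T ?b) \<longlongrightarrow> ?q\<^sup>2) at_top" and bb: "bounded_measurable tc ?b"
    proof -
      have "exp (- (2 * 2 * kernel 0)) = ?q\<^sup>2" by (simp add: limit_char_def power2_eq_square flip: exp_add)
      then show "((\<lambda>T. avg tc T ?b) \<longlongrightarrow> ?q\<^sup>2) at_top" "bounded_measurable tc ?b"
        using ergodic_avg_exp_pair_norm[OF erg \<sigma>, of "2 powr (1 / \<alpha>)"] unfolding two by simp_all
    qed
    have sq: "(?a t - ?q)\<^sup>2 = ?b t + (- (2 * ?q)) * ?a t + ?q\<^sup>2" for t
    proof -
      have "?b t = (?a t)\<^sup>2" by (simp add: power2_eq_square flip: exp_add)
      then show ?thesis by (simp add: power2_eq_square algebra_simps)
    qed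
    note b1 = bounded_measurable_mult[OF bounded_measurable_const[of tc "- (2 * ?q)"] ba]
    note b2 = bounded_measurable_add[OF bb b1]
    have "((\<lambda>T. avg tc T ?b + (- (2 * ?q)) * avg tc T ?a + avg tc T (\<lambda>t :: real ^ 'd. ?q\<^sup>2)) \<longlongrightarrow> ?q\<^sup>2 + (- (2 * ?q)) * ?q + ?q\<^sup>2) at_top"
      by (intro tendsto_add tendsto_mult lb la tendsto_const avg_const_tendsto)
    moreover have "?q\<^sup>2 + (- (2 * ?q)) * ?q + ?q\<^sup>2 = 0" by (simp add: power2_eq_square)
    moreover have "eventually (\<lambda>T. avg tc T ?b + (- (2 * ?q)) * avg tc T ?a + avg tc T (\<lambda>t :: real ^ 'd. ?q\<^sup>2) = avg tc T (\<lambda>t. (?a t - ?q)\<^sup>2)) at_top"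
      using eventually_gt_at_top[of 0]
    proof eventually_elim
      case (elim T)
      show ?case unfolding sq avg_add[OF b2 bounded_measurable_const elim] avg_add[OF bb b1 elim] avg_cmult ..
    qed
    ultimately have "((\<lambda>T. avg tc T (\<lambda>t. (?a t - ?q)\<^sup>2)) \<longlongrightarrow> 0) at_top" by (simp only: tendsto_cong)
    moreover have "bounded_measurable tc (\<lambda>t. (?a t - ?q)\<^sup>2)"
      unfolding sq by (rule bounded_measurable_add[OF b2 bounded_measurable_const])
    ultimately show ?thesis by simp
  qed
  from one[of 1] one[of "-1"]
  show "bounded_measurable tc deviation" "((\<lambda>T. avg tc T deviation) \<longlongrightarrow> 0) at_top"
    unfolding deviation_def by (auto intro!: bounded_measurable_add avg_zero_add)
qed

text \<open>Continuity of the logarithm at the positive number \<open>limit_char\<close>, whose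
  logarithm is minus twice \<open>kernel 0\<close>, used for each of the two signs.\<close>

lemma deviation_small:
  assumes e: "e > 0"
  shows "\<exists>d>0. \<forall>t. deviation t < d \<longrightarrow> 4 * kernel 0 - pair_norm 1 t - pair_norm (-1) t < e"
proof -
  have q: "limit_char > 0" by (simp add: limit_char_def)
  have "isCont ln limit_char" using q by (intro isCont_ln) simp
  then obtain d where d: "d > 0" "\<And>y. dist y limit_char < d \<Longrightarrow> dist (ln y) (ln limit_char) < e / 2"
    using e unfolding continuous_at_eps_delta by (metis half_gt_zero)
  have lnq: "ln limit_char = - (2 * kernel 0)" by (simp add: limit_char_def)
  have "4 * kernel 0 - pair_norm 1 t - pair_norm (-1) t < e" if "deviation t < d\<^sup>2" for t
  proof -
    have one: "2 * kernel 0 - pair_norm \<sigma> t < e / 2" if "(exp (- pair_norm \<sigma> t) - limit_char)\<^sup>2 < d\<^sup>2" for \<sigma>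
    proof -
      have "\<bar>exp (- pair_norm \<sigma> t) - limit_char\<bar> < d" 
        by (rule power2_less_imp_less) (use that d(1) in simp_all)
      then have "dist (ln (exp (- pair_norm \<sigma> t))) (ln limit_char) < e / 2" by (intro d(2)) (simp add: dist_real_def)
      then show ?thesis unfolding lnq dist_real_def ln_exp by linarith
    qed
    have "(exp (- pair_norm 1 t) - limit_char)\<^sup>2 < d\<^sup>2" "(exp (- pair_norm (-1) t) - limit_char)\<^sup>2 < d\<^sup>2"
      using that zero_le_power2[of "exp (- pair_norm 1 t) - limit_char"] zero_le_power2[of "exp (- pair_norm (-1) t) - limit_char"]
      unfolding deviation_def by linarith+
    from one[OF this(1)] one[OF this(2)] show ?thesis by linarith
  qed
  then show ?thesis using d(1) by (intro exI[of _ "d\<^sup>2"]) auto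
qed

text \<open>\<open>abs_powr_parallelogram_defect\<close> is integrated; f 0 and f (- t) both have
  norm \<open>kernel 0\<close>.\<close>

lemma min_integral_le:
  assumes t: "t \<in> index_set tc"
  shows "2 * (1 - 2 powr (\<alpha>/2 - 1)) * (\<integral>x. min (\<bar>f 0 x\<bar> powr \<alpha>) (\<bar>f (- t) x\<bar> powr \<alpha>) \<partial>\<mu>)
     \<le> 4 * kernel 0 - pair_norm 1 t - pair_norm (-1) t"
    and "integrable \<mu> (\<lambda>x. min (\<bar>f 0 x\<bar> powr \<alpha>) (\<bar>f (- t) x\<bar> powr \<alpha>))"
proof -
  have mt: "- t \<in> index_set tc" using t by (rule index_set_minus)
  have i0: "integrable \<mu> (\<lambda>x. \<bar>f 0 x\<bar> powr \<alpha>)" "integrable \<mu> (\<lambda>x. \<bar>f (- t) x\<bar> powr \<alpha>)"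
    by (intro f_integrable mt index_set_zero)+
  have n0: "(\<integral>x. \<bar>f 0 x\<bar> powr \<alpha> \<partial>\<mu>) = kernel 0" "(\<integral>x. \<bar>f (- t) x\<bar> powr \<alpha> \<partial>\<mu>) = kernel 0"
    using v_norm[OF index_set_zero] v_norm[OF mt] by (simp_all add: v_square)
  show im: "integrable \<mu> (\<lambda>x. min (\<bar>f 0 x\<bar> powr \<alpha>) (\<bar>f (- t) x\<bar> powr \<alpha>))" using i0 by (rule integrable_min)
  have ip: "integrable \<mu> (\<lambda>x. \<bar>f 0 x + \<sigma> * f (- t) x\<bar> powr \<alpha>)" for \<sigma>
  proof -
    let ?\<tau> = "\<lambda>b. if b then 0 else - t" and ?a = "\<lambda>b. if b then 1 else \<sigma>"
    have tau: "?\<tau> b \<in> index_set tc" for b using mt by simp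
    show ?thesis using linear_combination_integrable[of UNIV ?\<tau> ?a, OF finite tau] by (simp add: UNIV_bool add.commute)
  qed
  let ?c = "2 * (1 - 2 powr (\<alpha>/2 - 1))"
  have "?c * (\<integral>x. min (\<bar>f 0 x\<bar> powr \<alpha>) (\<bar>f (- t) x\<bar> powr \<alpha>) \<partial>\<mu>) = (\<integral>x. ?c * min (\<bar>f 0 x\<bar> powr \<alpha>) (\<bar>f (- t) x\<bar> powr \<alpha>) \<partial>\<mu>)"
    by simp
  also have "\<dots> \<le> (\<integral>x. 2 * \<bar>f 0 x\<bar> powr \<alpha> + 2 * \<bar>f (- t) x\<bar> powr \<alpha> - \<bar>f 0 x + 1 * f (- t) x\<bar> powr \<alpha> - \<bar>f 0 x + (-1) * f (- t) x\<bar> powr \<alpha> \<partial>\<mu>)"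
  proof (rule integral_mono)
    show "integrable \<mu> (\<lambda>x. ?c * min (\<bar>f 0 x\<bar> powr \<alpha>) (\<bar>f (- t) x\<bar> powr \<alpha>))" using im by (rule integrable_mult_right)
    show "integrable \<mu> (\<lambda>x. 2 * \<bar>f 0 x\<bar> powr \<alpha> + 2 * \<bar>f (- t) x\<bar> powr \<alpha> - \<bar>f 0 x + 1 * f (- t) x\<bar> powr \<alpha> - \<bar>f 0 x + (-1) * f (- t) x\<bar> powr \<alpha>)"
      by (intro Bochner_Integration.integrable_diff Bochner_Integration.integrable_add integrable_mult_right i0 ip)
    show "?c * min (\<bar>f 0 x\<bar> powr \<alpha>) (\<bar>f (- t) x\<bar> powr \<alpha>)
      \<le> 2 * \<bar>f 0 x\<bar> powr \<alpha> + 2 * \<bar>f (- t) x\<bar> powr \<alpha> - \<bar>f 0 x + 1 * f (- t) x\<bar> powr \<alpha> - \<bar>f 0 x + (-1) * f (- t) x\<bar> powr \<alpha>" for x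
      using abs_powr_parallelogram_defect[OF alpha, of "f 0 x" "f (- t) x"] by simp
  qed
  also have "\<dots> = 2 * kernel 0 + 2 * kernel 0 - pair_norm 1 t - pair_norm (-1) t"
    unfolding pair_norm_def n0(1)[symmetric] using n0(2)[folded n0(1)] i0 ip[of 1] ip[of "-1"] by simp
  finally show "?c * (\<integral>x. min (\<bar>f 0 x\<bar> powr \<alpha>) (\<bar>f (- t) x\<bar> powr \<alpha>) \<partial>\<mu>) \<le> 4 * kernel 0 - pair_norm 1 t - pair_norm (-1) t"
    by simp
qed

text \<open>A fixed level d gives the uniform comparison by which overlaps measured by \<nu> are
  converted into overlaps of the spectral functions.\<close>

definition level_set :: "'s measure \<Rightarrow> real \<Rightarrow> 's set" where
  "level_set \<nu> d = {x \<in> space \<mu>. ennreal d * RN_deriv \<mu> \<nu> x \<le> ennreal (\<bar>f 0 x\<bar> powr \<alpha>)}"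

lemma level_set_sets [measurable]: "level_set \<nu> d \<in> sets \<mu>"
  unfolding level_set_def using f_measurable[OF index_set_zero] by measurable

text \<open>At a point x of the return set, the level condition at \<open>\<phi> t x\<close> is
  multiplied by the derivative of the flow. Invariance turns its left side into d times the density
  at x, and the action form turns its right side into |f t x|^\<alpha>. So d times the density is
  below both terms of the minimum.\<close>

lemma level_set_return:
  assumes \<nu>: "invariant_finite_ac tc \<mu> \<phi> \<nu>" and t: "t \<in> index_set tc" and d: "d > 0"
  shows "ennreal d * emeasure \<nu> (level_set \<nu> d \<inter> (\<phi> t -` level_set \<nu> d \<inter> space \<mu>))
     \<le> (\<integral>\<^sup>+x. ennreal (min (\<bar>f 0 x\<bar> powr \<alpha>) (\<bar>f t x\<bar> powr \<alpha>)) \<partial>\<mu>)"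
proof -
  let ?E = "level_set \<nu> d" and ?w = "RN_deriv \<mu> \<nu>"
  let ?A = "?E \<inter> (\<phi> t -` ?E \<inter> space \<mu>)"
  have A [measurable]: "?A \<in> sets \<mu>" by (intro sets.Int level_set_sets measurable_sets[OF flow_measurable[OF t]])
  have dens: "density \<mu> ?w = \<nu>" using \<nu> by (intro density_RN_deriv) (auto simp: invariant_finite_ac_def)
  have "emeasure \<nu> ?A = (\<integral>\<^sup>+x. ?w x * indicator ?A x \<partial>\<mu>)"
    by (subst dens[symmetric], subst emeasure_density) auto
  then have "ennreal d * emeasure \<nu> ?A = (\<integral>\<^sup>+x. ennreal d * (?w x * indicator ?A x) \<partial>\<mu>)"
    by (subst nn_integral_cmult) auto
  also have "\<dots> \<le> (\<integral>\<^sup>+x. ennreal (min (\<bar>f 0 x\<bar> powr \<alpha>) (\<bar>f t x\<bar> powr \<alpha>)) \<partial>\<mu>)"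
  proof (rule nn_integral_mono_AE)
    show "AE x in \<mu>. ennreal d * (?w x * indicator ?A x) \<le> ennreal (min (\<bar>f 0 x\<bar> powr \<alpha>) (\<bar>f t x\<bar> powr \<alpha>))"
      using v_form[OF t] invariant_density[OF \<nu> t] flow_deriv_finite[OF t]
    proof eventually_elim
      case (elim x)
      show ?case
      proof (cases "x \<in> ?A")
        case True
        let ?r = "enn2real (flow_deriv t x)"
        have r: "ennreal ?r = flow_deriv t x" using elim(3) by (simp add: less_top)
        have "(v t x)\<^sup>2 = ?r * (v 0 (\<phi> t x))\<^sup>2" unfolding elim(1) by (simp add: power_mult_distrib)
        then have ft: "\<bar>f t x\<bar> powr \<alpha> = ?r * \<bar>f 0 (\<phi> t x)\<bar> powr \<alpha>" by (simp add: v_square)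
        have 1: "ennreal d * ?w x \<le> ennreal (\<bar>f 0 x\<bar> powr \<alpha>)" using True by (auto simp: level_set_def)
        have "ennreal d * ?w (\<phi> t x) \<le> ennreal (\<bar>f 0 (\<phi> t x)\<bar> powr \<alpha>)" using True by (auto simp: level_set_def)
        then have "flow_deriv t x * (ennreal d * ?w (\<phi> t x)) \<le> flow_deriv t x * ennreal (\<bar>f 0 (\<phi> t x)\<bar> powr \<alpha>)"
          by (rule mult_left_mono) simp
        also have "\<dots> = ennreal ?r * ennreal (\<bar>f 0 (\<phi> t x)\<bar> powr \<alpha>)" by (simp only: r)
        also have "\<dots> = ennreal (\<bar>f t x\<bar> powr \<alpha>)" unfolding ft by (rule ennreal_mult[symmetric]) auto
        also have "flow_deriv t x * (ennreal d * ?w (\<phi> t x)) = ennreal d * (flow_deriv t x * ?w (\<phi> t x))" by (simp only: mult_ac)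
        also have "\<dots> = ennreal d * ?w x" unfolding elim(2) ..
        finally have 2: "ennreal d * ?w x \<le> ennreal (\<bar>f t x\<bar> powr \<alpha>)" .
        from 1 2 True show ?thesis by (simp add: min_def)
      qed simp
    qed
  qed
  finally show ?thesis .
qed

text \<open>By counting: n translates of mass e0 whose pairwise overlaps are at most e1 have a union
  of mass at least n e0 / 2, which is more than \<nu> can hold.\<close>

lemma ergodic_level_set_null:
  assumes erg: "ergodic_field P tc X" and \<nu>: "invariant_finite_ac tc \<mu> \<phi> \<nu>" and d: "d > 0"
  shows "measure \<nu> (level_set \<nu> d) = 0"
proof (rule ccontr)
  assume nz: "measure \<nu> (level_set \<nu> d) \<noteq> 0"
  interpret n: finite_measure \<nu> using \<nu> by (simp add: invariant_finite_ac_def)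
  let ?E = "level_set \<nu> d"
  have sets: "sets \<nu> = sets \<mu>" using \<nu> by (simp add: invariant_finite_ac_def)
  note space = sets_eq_imp_space_eq[OF sets]
  define e0 where "e0 = measure \<nu> ?E"
  have e0: "e0 > 0" using nz unfolding e0_def by (simp add: order_less_le)
  \<comment> \<open>The factor 2 leaves room for the overlaps: already n e0 / 2 exceeds the total
    mass.\<close>
  obtain n :: nat where n: "2 * measure \<nu> (space \<nu>) / e0 < real n" using reals_Archimedean2 by blast
  have n0: "real n > 0" using n e0 by (smt (verit) divide_nonneg_pos measure_nonneg)
  \<comment> \<open>At most n^2 overlaps of this size take away no more than half of n e0.\<close>
  define e1 where "e1 = e0 / (2 * real n)"
  have e1: "e1 > 0" using e0 n0 by (simp add: e1_def)
  define c0 where "c0 = 2 * (1 - 2 powr (\<alpha>/2 - 1))"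
  have c0: "c0 > 0"
  proof -
    have "2 powr (\<alpha>/2 - 1) < 2 powr (0 :: real)" using alpha by (intro powr_less_mono) auto
    then show ?thesis by (simp add: c0_def)
  qed
  \<comment> \<open>Dividing the defect \<open>c0 * (d * e1)\<close> by the constant c0 of the
    parallelogram estimate and by the level d leaves an overlap of at most e1.\<close>
  obtain \<eta> where \<eta>: "\<eta> > 0" "\<And>t. deviation t < \<eta> \<Longrightarrow> 4 * kernel 0 - pair_norm 1 t - pair_norm (-1) t < c0 * (d * e1)"
    using deviation_small[of "c0 * (d * e1)"] c0 d e1 by auto
  have ret: "measure \<nu> (?E \<inter> (\<phi> (- t) -` ?E \<inter> space \<mu>)) \<le> e1" if t: "t \<in> index_set tc" and dev: "deviation t < \<eta>" for t
  proof -
    have mt: "- t \<in> index_set tc" using t by (rule index_set_minus)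
    let ?m = "\<lambda>x. min (\<bar>f 0 x\<bar> powr \<alpha>) (\<bar>f (- t) x\<bar> powr \<alpha>)"
    note mi = min_integral_le[OF t]
    have "c0 * (\<integral>x. ?m x \<partial>\<mu>) < c0 * (d * e1)" using mi(1) \<eta>(2)[OF dev] unfolding c0_def by (rule le_less_trans)
    then have I: "(\<integral>x. ?m x \<partial>\<mu>) < d * e1" using c0 by (simp add: mult_less_cancel_left_pos)
    have "ennreal (d * measure \<nu> (?E \<inter> (\<phi> (- t) -` ?E \<inter> space \<mu>))) = ennreal d * emeasure \<nu> (?E \<inter> (\<phi> (- t) -` ?E \<inter> space \<mu>))"
      using d by (simp add: n.emeasure_eq_measure ennreal_mult)
    also have "\<dots> \<le> (\<integral>\<^sup>+x. ennreal (?m x) \<partial>\<mu>)" by (rule level_set_return[OF \<nu> mt d])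
    also have "\<dots> = ennreal (\<integral>x. ?m x \<partial>\<mu>)" by (rule nn_integral_eq_integral[OF mi(2)]) auto
    finally have "d * measure \<nu> (?E \<inter> (\<phi> (- t) -` ?E \<inter> space \<mu>)) \<le> (\<integral>x. ?m x \<partial>\<mu>)"
      by (subst (asm) ennreal_le_iff) (auto intro!: integral_nonneg_AE)
    then have "d * measure \<nu> (?E \<inter> (\<phi> (- t) -` ?E \<inter> space \<mu>)) \<le> d * e1" using I by linarith
    then show ?thesis using d by (simp add: mult_le_cancel_left_pos)
  qed
  note dev = ergodic_avg_deviation[OF erg]
  have dev0: "0 \<le> deviation t" for t by (simp add: deviation_def)
  obtain t where t: "\<And>i. i < n \<Longrightarrow> t i \<in> index_set tc" "\<And>i j. j < n \<Longrightarrow> i < j \<Longrightarrow> deviation (t j - t i) < \<eta>"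
    using avg_zero_separated_points[OF dev(1) dev0 dev(2) \<eta>(1), of n] by blast
  define A where "A i = \<phi> (- t i) -` ?E \<inter> space \<mu>" for i
  have A_sets: "A i \<in> sets \<mu>" if "i < n" for i
    unfolding A_def by (rule measurable_sets[OF flow_measurable[OF index_set_minus[OF t(1)[OF that]]] level_set_sets])
  have inv: "measure \<nu> (\<phi> s -` B \<inter> space \<mu>) = measure \<nu> B" if "s \<in> index_set tc" "B \<in> sets \<mu>" for s B
    using \<nu> that by (simp add: invariant_finite_ac_def measure_def)
  have mA: "measure \<nu> (A i) = e0" if "i < n" for i
    unfolding A_def e0_def by (rule inv[OF index_set_minus[OF t(1)[OF that]] level_set_sets])
  have mAA: "measure \<nu> (A i \<inter> A j) \<le> e1" if ij: "i < j" "j < n" for i j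
  proof -
    have i: "i < n" using ij by simp
    let ?s = "t j - t i"
    have s: "?s \<in> index_set tc" by (intro index_set_diff t(1) i ij(2))
    have "\<phi> (- t j) x = \<phi> (- ?s) (\<phi> (- t i) x)" if "x \<in> space \<mu>" for x
      using flow_add[OF index_set_minus[OF s] index_set_minus[OF t(1)[OF i]] that] by simp
    \<comment> \<open>The overlap of two translates is a pullback of the return set for the time
      difference, so by invariance it has the same mass.\<close>
    then have "A i \<inter> A j = \<phi> (- t i) -` (?E \<inter> (\<phi> (- ?s) -` ?E \<inter> space \<mu>)) \<inter> space \<mu>"
      using flow_space[OF index_set_minus[OF t(1)[OF i]]] by (auto simp: A_def)
    then have "measure \<nu> (A i \<inter> A j) = measure \<nu> (?E \<inter> (\<phi> (- ?s) -` ?E \<inter> space \<mu>))"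
      using inv[OF index_set_minus[OF t(1)[OF i]], of "?E \<inter> (\<phi> (- ?s) -` ?E \<inter> space \<mu>)"]
        measurable_sets[OF flow_measurable[OF index_set_minus[OF s]] level_set_sets, of \<nu> d] by simp
    also have "\<dots> \<le> e1" by (rule ret[OF s t(2)[OF ij(2,1)]])
    finally show ?thesis .
  qed
  have "(\<Sum>i<n. measure \<nu> (A i)) - (\<Sum>j<n. \<Sum>i<j. measure \<nu> (A i \<inter> A j)) \<le> measure \<nu> (\<Union>i<n. A i)"
    by (rule measure_union_ge[OF n.finite_measure_axioms]) (simp add: sets A_sets)
  also have "\<dots> \<le> measure \<nu> (space \<nu>)" by (rule n.bounded_measure)
  finally have *: "(\<Sum>i<n. measure \<nu> (A i)) - (\<Sum>j<n. \<Sum>i<j. measure \<nu> (A i \<inter> A j)) \<le> measure \<nu> (space \<nu>)" .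
  have s1: "(\<Sum>i<n. measure \<nu> (A i)) = real n * e0" using mA by simp
  have "(\<Sum>j<n. \<Sum>i<j. measure \<nu> (A i \<inter> A j)) \<le> (\<Sum>j<n. \<Sum>i<j. e1)"
    by (intro sum_mono) (auto intro: mAA)
  also have "\<dots> \<le> (\<Sum>j<n. real n * e1)"
    using e1 by (intro sum_mono) (auto intro!: mult_right_mono)
  also have "\<dots> = real n * (e0 / 2)" using n0 by (simp add: e1_def)
  finally have s2: "(\<Sum>j<n. \<Sum>i<j. measure \<nu> (A i \<inter> A j)) \<le> real n * (e0 / 2)" .
  have "real n * e0 / 2 \<le> measure \<nu> (space \<nu>)" using * s1 s2 by simp
  moreover have "2 * measure \<nu> (space \<nu>) < real n * e0" using n e0 by (simp add: divide_less_eq)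
  ultimately show False by simp
qed

text \<open>As the density is finite almost everywhere, \<nu>-almost every point with f 0 nonzero
  lies in a level set with d = 1/(k + 1) for some k. So f 0 vanishes \<nu>-almost everywhere, by
  invariance its composition with \<open>\<phi> t\<close> does too, and the support of \<nu> is null
  by the full support condition.\<close>

lemma ergodic_imp_support_null:
  assumes erg: "ergodic_field P tc X" and \<nu>: "invariant_finite_ac tc \<mu> \<phi> \<nu>"
  shows "emeasure \<mu> (density_support \<mu> \<nu>) = 0"
proof -
  interpret n: finite_measure \<nu> using \<nu> by (simp add: invariant_finite_ac_def)
  have sets: "sets \<nu> = sets \<mu>" using \<nu> by (simp add: invariant_finite_ac_def)
  let ?w = "RN_deriv \<mu> \<nu>"
  have ac: "absolutely_continuous \<mu> \<nu>" using \<nu> by (simp add: invariant_finite_ac_def)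
  have dens: "density \<mu> ?w = \<nu>" using ac sets by (rule density_RN_deriv)
  have wfin: "AE x in \<mu>. ?w x \<noteq> \<infinity>"
    by (rule RN_deriv_finite[OF n.sigma_finite_measure_axioms ac sets])
  define Z where "Z = {x \<in> space \<mu>. f 0 x \<noteq> 0}"
  have Z: "Z \<in> sets \<mu>" unfolding Z_def using f_measurable[OF index_set_zero] by measurable
  have lev: "level_set \<nu> (1 / real (Suc k)) \<in> null_sets \<nu>" for k
    using ergodic_level_set_null[OF erg \<nu>, of "1 / real (Suc k)"] sets
    by (auto simp: null_sets_def n.emeasure_eq_measure)
  have AE_n: "AE x in \<nu>. Q x" if "AE x in \<mu>. Q x" for Q
    using absolutely_continuous_AE[OF sets ac that] .
  have "AE x in \<nu>. \<forall>k :: nat. x \<notin> level_set \<nu> (1 / real (Suc k))"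
    unfolding AE_all_countable using AE_not_in[OF lev] by blast
  with AE_n[OF wfin] have "AE x in \<nu>. x \<notin> Z"
  proof eventually_elim
    case (elim x)
    show ?case
    proof
      assume x: "x \<in> Z"
      define u where "u = \<bar>f 0 x\<bar> powr \<alpha>"
      have u: "u > 0" using x by (simp add: u_def Z_def)
      have w: "?w x = ennreal (enn2real (?w x))" using elim(1) by (simp add: less_top)
      obtain k where k: "enn2real (?w x) / u < real k" using reals_Archimedean2 by blast
      have "1 / real (Suc k) * enn2real (?w x) \<le> u"
      proof -
        have "enn2real (?w x) < real k * u" using k u by (simp add: divide_less_eq)
        also have "\<dots> \<le> real (Suc k) * u" using u by (intro mult_right_mono) auto
        finally show ?thesis by (simp add: divide_le_eq mult.commute)
      qed
      then have "ennreal (1 / real (Suc k)) * ?w x \<le> ennreal u"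
        by (subst w, subst ennreal_mult[symmetric]) (auto intro: ennreal_leI)
      then have "x \<in> level_set \<nu> (1 / real (Suc k))" using x by (simp add: level_set_def u_def Z_def)
      then show False using elim(2) by blast
    qed
  qed
  then have Z0: "emeasure \<nu> Z = 0" using AE_iff_null_sets[of Z \<nu>] Z sets by (auto simp: null_sets_def)
  have "AE x in \<mu>. x \<in> density_support \<mu> \<nu> \<longrightarrow> f t x = 0" if t: "t \<in> index_set tc" for t
  proof -
    let ?B = "\<phi> t -` Z \<inter> space \<mu>"
    have B: "?B \<in> sets \<mu>" by (rule measurable_sets[OF flow_measurable[OF t] Z])
    have "emeasure \<nu> ?B = 0" using \<nu> t Z Z0 by (simp add: invariant_finite_ac_def)
    then have "?B \<in> null_sets (density \<mu> ?w)" unfolding dens using B sets by (auto simp: null_sets_def)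
    then have "AE x in \<mu>. x \<in> ?B \<longrightarrow> ?w x = 0" by (subst (asm) null_sets_density_iff) auto
    moreover have "AE x in \<mu>. x \<in> space \<mu>" by simp
    ultimately show ?thesis using v_form[OF t]
    proof eventually_elim
      case (elim x)
      show ?case
      proof
        assume "x \<in> density_support \<mu> \<nu>"
        then have "x \<notin> ?B" using elim(1) by (auto simp: density_support_def)
        then have "f 0 (\<phi> t x) = 0" using elim(2) flow_space[OF t] by (auto simp: Z_def)
        then have "v t x = 0" using elim(3) by (simp add: v_def)
        then show "f t x = 0" by (simp add: v_def)
      qed
    qed
  qed
  then show ?thesis using minimal density_support_sets unfolding minimal_rep_def by blast
qed

text \<open>A finite invariant measure is carried by the support of its density, which is contained
  in the positive part up to a null set.\<close>

lemma positive_part_null_imp_null: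
  assumes P: "positive_part tc \<mu> \<phi> Pset" "emeasure \<mu> Pset = 0" and \<nu>: "invariant_finite_ac tc \<mu> \<phi> \<nu>"
  shows "emeasure \<nu> (space \<mu>) = 0"
proof -
  let ?w = "RN_deriv \<mu> \<nu>" and ?S = "density_support \<mu> \<nu>"
  have Ps: "Pset \<in> sets \<mu>" and d0: "emeasure \<mu> (?S - Pset) = 0" using P(1) \<nu> by (auto simp: positive_part_def)
  have null: "Pset \<in> null_sets \<mu>" "?S - Pset \<in> null_sets \<mu>"
    using Ps P(2) d0 by (auto simp: null_sets_def)
  note AE_not_in[OF null(1)] AE_not_in[OF null(2)]
  moreover have "AE x in \<mu>. x \<in> space \<mu>" by simp
  ultimately have "AE x in \<mu>. ?w x = 0"
    by eventually_elim (auto simp: density_support_def)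
  then have "(\<integral>\<^sup>+x. ?w x * indicator (space \<mu>) x \<partial>\<mu>) = 0"
    by (subst nn_integral_0_iff_AE) auto
  moreover have "density \<mu> ?w = \<nu>" using \<nu> by (intro density_RN_deriv) (auto simp: invariant_finite_ac_def)
  ultimately show ?thesis using emeasure_density[of ?w \<mu> "space \<mu>"] by simp
qed

lemma ergodic_imp_positive_part_null:
  assumes erg: "ergodic_field P tc X" and P: "positive_part tc \<mu> \<phi> Pset"
  shows "emeasure \<mu> Pset = 0"
proof -
  obtain \<nu> where \<nu>: "invariant_finite_ac tc \<mu> \<phi> \<nu>"
    and d: "emeasure \<mu> ((Pset - density_support \<mu> \<nu>) \<union> (density_support \<mu> \<nu> - Pset)) = 0" and Ps: "Pset \<in> sets \<mu>"
    using P by (auto simp: positive_part_def)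
  let ?S = "density_support \<mu> \<nu>"
  have "emeasure \<mu> Pset \<le> emeasure \<mu> (((Pset - ?S) \<union> (?S - Pset)) \<union> ?S)"
    using Ps by (intro emeasure_mono) auto
  also have "\<dots> \<le> emeasure \<mu> ((Pset - ?S) \<union> (?S - Pset)) + emeasure \<mu> ?S"
    using Ps by (intro emeasure_subadditive) auto
  also have "\<dots> = 0" using d ergodic_imp_support_null[OF erg \<nu>] by simp
  finally show ?thesis by simp
qed

end

theorem mainTheorem10:
  fixes \<alpha> :: real and tc :: tcase
    and P :: "'w measure" and X :: "real ^ 'd \<Rightarrow> 'w \<Rightarrow> real"
    and \<mu> :: "'s :: polish_space measure" and f :: "real ^ 'd \<Rightarrow> 's \<Rightarrow> real"
    and \<phi> :: "real ^ 'd \<Rightarrow> 's \<Rightarrow> 's" and c :: "real ^ 'd \<Rightarrow> 's \<Rightarrow> real"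
  assumes "0 < \<alpha>" "\<alpha> < 2"
    and "prob_space P"
    and "measurable_field P tc X"
    and "stationary_field P tc X"
    and "sets \<mu> = sets borel" "sigma_finite_measure \<mu>"
    and "sas_spectral_rep \<alpha> P tc X \<mu> f"
    and "minimal_rep tc \<mu> f"
    and "nonsingular_action tc \<mu> \<phi>"
    and "sign_cocycle tc \<mu> \<phi> c"
    and "action_form \<alpha> tc \<mu> \<phi> c f"
  shows "(\<exists>Pset. positive_part tc \<mu> \<phi> Pset) \<and>
         (\<forall>Pset. positive_part tc \<mu> \<phi> Pset \<longrightarrow>
            (weakly_mixing_field P tc X \<longleftrightarrow> emeasure \<mu> Pset = 0) \<and>
            (ergodic_field P tc X \<longleftrightarrow> emeasure \<mu> Pset = 0))"
proof -
  interpret sas_field \<mu> tc \<phi> P \<alpha> X f c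
    using assms
    by (intro sas_field.intro nonsingular_flow.intro nonsingular_flow_axioms.intro sas_field_axioms.intro)
  \<comment> \<open>The equivalences close in a circle: weak mixing gives ergodicity, ergodicity
    gives a null positive part, and a null positive part gives back weak mixing.\<close>
  show ?thesis
    using exists_positive_part weakly_mixing_imp_ergodic ergodic_imp_positive_part_null
      avg_kernel_imp_weakly_mixing null_imp_avg_kernel positive_part_null_imp_null
    by meson
qed

end
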